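(* Let $\eta\in\mathbb{C}\setminus\{0\}$ and $s\le-1/2$. Then, for any $T>0$, the data-to-solution map $u_0\mapsto u$ of the Cauchy problem $$i\partial_tu-\Delta u=\eta|u|^2\ \text{ in }\mathbb{R}\times\mathbb{R}^2,\qquad u(0,\cdot)=u_0,$$ as a map from the unit ball in $H^s_{\mathrm{rad}}(\mathbb{R}^2)$ to $C([0,T];H^s_{\mathrm{rad}}(\mathbb{R}^2))$, fails to be $C^2$ at the origin.
   Context: $H^s_{\mathrm{rad}}(\mathbb{R}^2)$ is the subspace of radially symmetric elements of the Sobolev space $H^s(\mathbb{R}^2)$. Solutions are solutions of the integral equation $u(t)=e^{-it\Delta}u_0-i\eta\int_0^te^{-i(t-t')\Delta}|u(t')|^2\,dt'$. For smooth radial data $u_0\in\bigcap_kH^k(\mathbb{R}^2)$ for which a solution $u\in C([0,T];\bigcap_kH^k(\mathbb{R}^2))$ exists, this solution is unique and is the one assigned to $u_0$ by the data-to-solution map (in particular $0\mapsto0$). The assertion means that no map from the unit ball of $H^s_{\mathrm{rad}}(\mathbb{R}^2)$ to $C([0,T];H^s_{\mathrm{rad}}(\mathbb{R}^2))$ which agrees with this assignment on such smooth data is $C^2$ (in the Fréchet sense, over the reals) at $u_0=0$. *)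

theory Defs
  imports "HOL-Analysis.Analysis" "HOL-Library.Function_Algebras"
begin

text \<open>
  The Sobolev spaces below depend on a real parameter, so they cannot be types of class
  \<open>real_normed_vector\<close>. A normed space is therefore a linear subspace of an ambient real
  vector space together with a norm on it; functions carry the pointwise vector space structure.
\<close>

instantiation "fun" :: (type, real_vector) real_vector
begin

definition scaleR_fun_def: "scaleR c f = (\<lambda>x. scaleR c (f x))"

instance
  by standard (auto simp: scaleR_fun_def fun_eq_iff scaleR_add_right scaleR_add_left)

end

record 'a nspace =
  vecs :: "'a set"
  nrm :: "'a \<Rightarrow> real"

text \<open>
  Bounded real-linear maps with the operator norm. The maps are set to zero outside the domain
  space, so that equal operators are equal functions.
\<close>

definition lin_maps :: "'a::real_vector nspace \<Rightarrow> 'b::real_vector nspace \<Rightarrow> ('a \<Rightarrow> 'b) nspace" where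
  "lin_maps X Y =
    \<lparr> vecs = {L. (\<forall>x\<in>vecs X. L x \<in> vecs Y) \<and>
                  (\<forall>x\<in>vecs X. \<forall>y\<in>vecs X. L (x + y) = L x + L y) \<and>
                  (\<forall>c. \<forall>x\<in>vecs X. L (c *\<^sub>R x) = c *\<^sub>R L x) \<and>
                  (\<exists>K. \<forall>x\<in>vecs X. nrm Y (L x) \<le> K * nrm X x) \<and>
                  (\<forall>x. x \<notin> vecs X \<longrightarrow> L x = 0)},
      nrm = (\<lambda>L. SUP x\<in>{x \<in> vecs X. nrm X x \<le> 1}. nrm Y (L x)) \<rparr>"

definition has_frechet_deriv ::
  "'a::real_vector nspace \<Rightarrow> 'b::real_vector nspace \<Rightarrow> ('a \<Rightarrow> 'b) \<Rightarrow> ('a \<Rightarrow> 'b) \<Rightarrow> 'a \<Rightarrow> bool" where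
  "has_frechet_deriv X Y f L x \<longleftrightarrow>
     L \<in> vecs (lin_maps X Y) \<and>
     (\<forall>e>0. \<exists>d>0. \<forall>h\<in>vecs X. nrm X h < d \<longrightarrow> nrm Y (f (x + h) - f x - L h) \<le> e * nrm X h)"

text \<open>
  \<open>f\<close> is twice Frechet differentiable near \<open>x\<close> and the second derivative is continuous at \<open>x\<close>.
  Only the values of \<open>f\<close> near \<open>x\<close> matter, so \<open>f\<close> may be arbitrary away from \<open>x\<close>.
\<close>

definition C2_at ::
  "'a::real_vector nspace \<Rightarrow> 'b::real_vector nspace \<Rightarrow> ('a \<Rightarrow> 'b) \<Rightarrow> 'a \<Rightarrow> bool" where
  "C2_at X Y f x \<longleftrightarrow>
     (\<exists>r>0. \<exists>f' f''.
        (\<forall>y\<in>vecs X. nrm X (y - x) < r \<longrightarrow>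
            has_frechet_deriv X Y f (f' y) y \<and>
            has_frechet_deriv X (lin_maps X Y) f' (f'' y) y) \<and>
        (\<forall>e>0. \<exists>d>0. \<forall>y\<in>vecs X. nrm X (y - x) < d \<longrightarrow>
            nrm (lin_maps X (lin_maps X Y)) (f'' y - f'' x) < e))"

definition continuous_into :: "real \<Rightarrow> 'a::real_vector nspace \<Rightarrow> (real \<Rightarrow> 'a) \<Rightarrow> bool" where
  "continuous_into T X u \<longleftrightarrow>
     (\<forall>t\<in>{0..T}. u t \<in> vecs X \<and>
        ((\<lambda>t'. nrm X (u t' - u t)) \<longlongrightarrow> 0) (at t within {0..T}))"

text \<open>The space \<open>C([0,T]; X)\<close>; its elements are extended by zero outside \<open>[0,T]\<close>.\<close>

definition C_space :: "real \<Rightarrow> 'a::real_vector nspace \<Rightarrow> (real \<Rightarrow> 'a) nspace" where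
  "C_space T X =
    \<lparr> vecs = {u. continuous_into T X u \<and> (\<forall>t. t \<notin> {0..T} \<longrightarrow> u t = 0)},
      nrm = (\<lambda>u. SUP t\<in>{0..T}. nrm X (u t)) \<rparr>"

definition partial_deriv :: "2 \<Rightarrow> (real^2 \<Rightarrow> complex) \<Rightarrow> real^2 \<Rightarrow> complex" where
  "partial_deriv i f x = frechet_derivative f (at x) (axis i 1)"

primrec partial_derivs :: "2 list \<Rightarrow> (real^2 \<Rightarrow> complex) \<Rightarrow> real^2 \<Rightarrow> complex" where
  "partial_derivs [] f = f"
| "partial_derivs (i # is) f = partial_deriv i (partial_derivs is f)"

definition schwartz :: "(real^2 \<Rightarrow> complex) set" where
  "schwartz = {f. \<forall>is. (\<forall>x. partial_derivs is f differentiable (at x)) \<and>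
                 (\<forall>k. bdd_above (range (\<lambda>x. norm x ^ k * cmod (partial_derivs is f x))))}"

definition schwartz_seminorm :: "nat \<Rightarrow> 2 list \<Rightarrow> (real^2 \<Rightarrow> complex) \<Rightarrow> real" where
  "schwartz_seminorm k is f = (SUP x. norm x ^ k * cmod (partial_derivs is f x))"

text \<open>
  Distributions are functionals on Schwartz functions, extended by zero to all other functions.
\<close>

type_synonym dist = "(real^2 \<Rightarrow> complex) \<Rightarrow> complex"

definition tempered :: "dist set" where
  "tempered = {f.
     (\<forall>\<phi>\<in>schwartz. \<forall>\<psi>\<in>schwartz. f (\<lambda>x. \<phi> x + \<psi> x) = f \<phi> + f \<psi>) \<and>
     (\<forall>c. \<forall>\<phi>\<in>schwartz. f (\<lambda>x. c * \<phi> x) = c * f \<phi>) \<and>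
     (\<exists>C N. \<forall>\<phi>\<in>schwartz.
        cmod (f \<phi>) \<le> C * (\<Sum>k\<le>N. \<Sum>is\<in>{is. length is \<le> N}. schwartz_seminorm k is \<phi>)) \<and>
     (\<forall>\<phi>. \<phi> \<notin> schwartz \<longrightarrow> f \<phi> = 0)}"

definition radial :: "dist set" where
  "radial = {f. \<forall>R. orthogonal_transformation R \<longrightarrow> (\<forall>\<phi>\<in>schwartz. f (\<phi> \<circ> R) = f \<phi>)}"

text \<open>The distribution \<open>\<phi> \<mapsto> \<integral> v \<phi>\<close> given by a function \<open>v\<close>.\<close>

definition regular_dist :: "(real^2 \<Rightarrow> complex) \<Rightarrow> dist" where
  "regular_dist v = (\<lambda>\<phi>. if \<phi> \<in> schwartz then LINT x|lborel. v x * \<phi> x else 0)"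

definition represents :: "(real^2 \<Rightarrow> complex) \<Rightarrow> dist \<Rightarrow> bool" where
  "represents v f \<longleftrightarrow> v \<in> borel_measurable lborel \<and>
     (\<forall>\<phi>\<in>schwartz. integrable lborel (\<lambda>x. v x * \<phi> x)) \<and> f = regular_dist v"

text \<open>
  The function representing a regular distribution; it is determined up to equality
  almost everywhere, and is only used in ways that do not depend on the choice.
\<close>

definition fun_of :: "dist \<Rightarrow> real^2 \<Rightarrow> complex" where
  "fun_of f = (SOME v. represents v f)"

definition fourier :: "(real^2 \<Rightarrow> complex) \<Rightarrow> real^2 \<Rightarrow> complex" where
  "fourier \<phi> \<xi> = (LINT x|lborel. cis (- (x \<bullet> \<xi>)) * \<phi> x) / of_real (2 * pi)"

definition inv_fourier :: "(real^2 \<Rightarrow> complex) \<Rightarrow> real^2 \<Rightarrow> complex" where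
  "inv_fourier \<phi> x = (LINT \<xi>|lborel. cis (x \<bullet> \<xi>) * \<phi> \<xi>) / of_real (2 * pi)"

definition dist_fourier :: "dist \<Rightarrow> dist" where
  "dist_fourier f = (\<lambda>\<phi>. if \<phi> \<in> schwartz then f (fourier \<phi>) else 0)"

definition sobolev :: "real \<Rightarrow> dist nspace" where
  "sobolev s =
    \<lparr> vecs = {f \<in> tempered. (\<exists>g. represents g (dist_fourier f)) \<and>
               integrable lborel
                 (\<lambda>\<xi>. (1 + (norm \<xi>)\<^sup>2) powr s * (cmod (fun_of (dist_fourier f) \<xi>))\<^sup>2)},
      nrm = (\<lambda>f. sqrt (LINT \<xi>|lborel.
                 (1 + (norm \<xi>)\<^sup>2) powr s * (cmod (fun_of (dist_fourier f) \<xi>))\<^sup>2)) \<rparr>"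

definition sobolev_rad :: "real \<Rightarrow> dist nspace" where
  "sobolev_rad s = \<lparr> vecs = vecs (sobolev s) \<inter> radial, nrm = nrm (sobolev s) \<rparr>"

text \<open>
  The group \<open>e^(-i t \<Delta>)\<close> has the symbol \<open>e^(i t |\<xi>|^2)\<close>. The symbol is even, so the group is
  its own transpose for the bilinear pairing, and it acts on distributions by acting on
  the test function.
\<close>

definition schwartz_group :: "real \<Rightarrow> (real^2 \<Rightarrow> complex) \<Rightarrow> real^2 \<Rightarrow> complex" where
  "schwartz_group t \<phi> = inv_fourier (\<lambda>\<xi>. cis (t * (norm \<xi>)\<^sup>2) * fourier \<phi> \<xi>)"

definition schroedinger_group :: "real \<Rightarrow> dist \<Rightarrow> dist" where
  "schroedinger_group t f = (\<lambda>\<phi>. if \<phi> \<in> schwartz then f (schwartz_group t \<phi>) else 0)"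

definition abs_square :: "dist \<Rightarrow> dist" where
  "abs_square f = regular_dist (\<lambda>x. of_real ((cmod (fun_of f x))\<^sup>2))"

text \<open>
  \<open>u\<close> lies in \<open>C([0,T]; \<Inter>k. H^k)\<close> and satisfies
  \<open>u(t) = e^(-i t \<Delta>) u0 - i \<eta> \<integral>_0^t e^(-i (t - t') \<Delta>) |u(t')|^2 dt'\<close> on \<open>[0,T]\<close>. The integral
  is that of a distribution-valued function, taken against each test function; for such \<open>u\<close> it
  is also the integral in every \<open>H^k\<close>.
\<close>

definition smooth_solution :: "complex \<Rightarrow> real \<Rightarrow> dist \<Rightarrow> (real \<Rightarrow> dist) \<Rightarrow> bool" where
  "smooth_solution \<eta> T u0 u \<longleftrightarrow>
     (\<forall>k::nat. continuous_into T (sobolev (real k)) u) \<and>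
     (\<forall>t\<in>{0..T}. \<forall>\<phi>\<in>schwartz.
        (\<lambda>t'. schroedinger_group (t - t') (abs_square (u t')) \<phi>) integrable_on {0..t} \<and>
        u t \<phi> = schroedinger_group t u0 \<phi>
                - \<i> * \<eta> * integral {0..t} (\<lambda>t'. schroedinger_group (t - t') (abs_square (u t')) \<phi>))"

definition smooth_radial_data :: "dist set" where
  "smooth_radial_data = (\<Inter>k::nat. vecs (sobolev_rad (real k)))"

text \<open>Values outside the unit ball are unconstrained.\<close>

definition data_to_solution_map ::
  "complex \<Rightarrow> real \<Rightarrow> real \<Rightarrow> (dist \<Rightarrow> real \<Rightarrow> dist) \<Rightarrow> bool" where
  "data_to_solution_map \<eta> s T \<Phi> \<longleftrightarrow>
     (\<forall>u0\<in>vecs (sobolev_rad s). nrm (sobolev_rad s) u0 < 1 \<longrightarrow>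
        \<Phi> u0 \<in> vecs (C_space T (sobolev_rad s))) \<and>
     (\<forall>u0\<in>smooth_radial_data. \<forall>u. nrm (sobolev_rad s) u0 < 1 \<longrightarrow> smooth_solution \<eta> T u0 u \<longrightarrow>
        (\<forall>t\<in>{0..T}. \<Phi> u0 t = u t))"

end

theory Submission
  imports Defs "HOL-Probability.Characteristic_Functions" "HOL-Probability.Sinc_Integral"
begin

text \<open>
  If the map were \<open>C^2\<close> at \<open>0\<close>, its second derivative there would be a bounded bilinear map, and on
  smooth data it is twice the second Picard iterate. So it suffices to find data \<open>u_N\<close> in the unit
  ball of \<open>H^s\<close> whose second iterates are unbounded. On the Fourier side the iterate is
  \<open>\<integral>_0^T \<integral> e^(2 i \<tau> \<xi>.\<zeta>) g(\<zeta> + \<xi>) conj(g(\<zeta>)) d\<zeta> d\<tau>\<close>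
  up to a unimodular factor and a constant. For the Gaussian
  \<open>g(\<xi>) = c N^(-1/2) e^(-|\<xi>|^2 / (2 N^2))\<close>, which is bounded in \<open>H^(-1/2)\<close>, the inner integral is an
  explicit Gaussian, and the iterate has size \<open>1 / |\<xi>|\<close> for \<open>1/N < |\<xi>| < 1\<close>: this high-high-to-low
  interaction makes its \<open>L^2\<close> norm diverge like the square root of \<open>log N\<close>. The divergence is
  detected by testing against the dyadic sum \<open>\<Sum>_{j \<le> J} 2^j e^(- A 4^j |\<xi>|^2)\<close> with \<open>N \<approx> 2^J\<close>, whose
  pairing with the iterate is at least of order \<open>J\<close> while its norm is of order \<open>J^(1/2)\<close>.

  Since the hypothesis on the data-to-solution map speaks of smooth solutions only, these have to be
  constructed for small multiples of \<open>g\<close>. This is a fixed point problem for the profile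
  \<open>e^(-i t |\<xi>|^2) (F u)(t, \<xi>)\<close>, with \<open>F\<close> the Fourier transform in space, in a space of continuous functions with a fixed exponentially decaying weight.
\<close>

section \<open>Integration over the plane\<close>

text \<open>The threshold -1/2 comes from a count of powers of N. The integral of (1 +
  |\<xi>|^2)^(-1/2) e^(-|\<xi>|^2 / N^2) over the plane grows like N, which forces the amplitude
  N^(-1/2). The self-interaction then has height of order N and, at output frequency \<xi>, lasts a
  time of order 1 / (N |\<xi>|). For smaller s the data norm only drops, while the output sits at
  bounded frequencies, where all weights are comparable, so one family of data covers every s \<le>
  -1/2. The radius of existence of the small solutions and the constant of their cubic remainder
  depend on N without any uniformity. This is harmless: only the second-order coefficient at
  \<epsilon> = 0 is compared with the second derivative, and the bound on that coefficient is
  uniform in N. The comparison is made for scalar functions \<epsilon> \<mapsto>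
  \<l>(\<Phi>(\<epsilon> e)), where \<l> evaluates at time T on one test function; duality of H^s
  and H^(-s) makes \<l> bounded, and Taylor expansion in one real variable suffices.\<close>

lemma vec2_Basis: "(Basis :: (real^2) set) = {axis 1 1, axis 2 1}"
  by (auto simp: Basis_vec_def UNIV_2)

lemma norm_vec2: "(norm (x::real^2))\<^sup>2 = (x$1)\<^sup>2 + (x$2)\<^sup>2"
  by (simp add: norm_vec_def L2_set_def sum_2)

lemma inner_vec2: "(x::real^2) \<bullet> y = x$1 * y$1 + x$2 * y$2"
  by (simp add: inner_vec_def sum_2)

lemma borel_measurable_cis [measurable (raw)]:
  "f \<in> borel_measurable M \<Longrightarrow> (\<lambda>x. cis (f x)) \<in> borel_measurable M"
  by (rule measurable_compose[OF _ borel_measurable_continuous_onI]) (auto intro!: continuous_intros)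

text \<open>\<open>lborel_eq\<close> presents Lebesgue measure as the image of the product measure
  over \<open>Basis\<close>, so a product of functions of the two coordinates integrates factor by
  factor.\<close>

lemma lborel_prod_vec2:
  fixes f g :: "real \<Rightarrow> complex"
  assumes f: "integrable lborel f" and g: "integrable lborel g"
  shows "integrable lborel (\<lambda>x::real^2. f (x$1) * g (x$2))" (is ?I)
    and "(LINT x|lborel. f ((x::real^2)$1) * g (x$2)) = (LINT x|lborel. f x) * (LINT x|lborel. g x)" (is ?E)
proof -
  interpret product_sigma_finite "\<lambda>b::real^2. lborel :: real measure" ..
  define F where "F = (\<lambda>b::real^2. if b = axis 1 1 then f else g)"
  have ne: "axis 1 1 \<noteq> (axis 2 1 :: real^2)" by (simp add: axis_eq_axis)
  have int: "integrable lborel (F b)" for b using f g by (simp add: F_def)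
  have [measurable]: "f \<in> borel_measurable borel" "g \<in> borel_measurable borel"
    using f g by auto
  let ?M = "\<Pi>\<^sub>M b\<in>(Basis::(real^2) set). (lborel::real measure)"
  let ?T = "\<lambda>h. (\<Sum>b\<in>(Basis::(real^2) set). h b *\<^sub>R b)"
  have T: "?T \<in> measurable ?M borel" by measurable
  have eq: "f (?T h $ 1) * g (?T h $ 2) = (\<Prod>b\<in>Basis. F b (h b))" for h
    using ne by (simp add: vec2_Basis F_def) (simp add: axis_def)
  have 1: "integrable ?M (\<lambda>h. \<Prod>b\<in>Basis. F b (h b))"
    by (rule product_integrable_prod) (use int in auto)
  have 2: "(LINT h|?M. (\<Prod>b\<in>Basis. F b (h b))) = (\<Prod>b\<in>Basis. (LINT x|lborel. F b x))"
    by (rule product_integral_prod) (use int in auto)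
  have m: "(\<lambda>x::real^2. f (x$1) * g (x$2)) \<in> borel_measurable borel" by measurable
  show ?I
    by (subst lborel_eq, subst integrable_distr_eq[OF T m]) (use 1 in \<open>simp only: eq\<close>)
  show ?E
    apply (subst lborel_eq, subst integral_distr[OF T m])
    apply (subst eq, subst 2)
    using ne by (simp add: vec2_Basis F_def)
qed

text \<open>The integral is the characteristic function e^(-s^2 / 2) of the standard normal
  distribution, after the substitution x \<mapsto> sqrt(2 a) x and with s = t / sqrt(2 a).\<close>

lemma gauss_line:
  fixes a t :: real
  assumes a: "a > 0"
  shows "integrable lborel (\<lambda>x. cis (x * t) * of_real (exp (- (a * x\<^sup>2))))"
    and "(LINT x|lborel. cis (x * t) * of_real (exp (- (a * x\<^sup>2)))) = of_real (sqrt (pi / a) * exp (- t\<^sup>2 / (4 * a)))"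
proof -
  have "char std_normal_distribution s = (LINT x|lborel. std_normal_density x *\<^sub>R cis (s * x))" for s
    unfolding char_def by (subst integral_density) (auto simp: cis_conv_exp)
  hence ch: "(LINT x|lborel. std_normal_density x *\<^sub>R cis (s * x)) = of_real (exp (- s\<^sup>2 / 2))" for s
    by (simp add: char_std_normal_distribution)
  have i0: "integrable lborel (\<lambda>x. std_normal_density x *\<^sub>R cis (s * x))" for s
    by (rule Bochner_Integration.integrable_bound[of _ std_normal_density]) auto
  let ?c = "sqrt (2 * a)" and ?s = "t / sqrt (2 * a)"
  have c: "?c > 0" using a by simp
  have hb: "has_bochner_integral lborel (\<lambda>x. std_normal_density x *\<^sub>R cis (?s * x)) (of_real (exp (- ?s\<^sup>2 / 2)))"
    using i0[of ?s] ch[of ?s] by (simp add: has_bochner_integral_iff)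
  have "has_bochner_integral lborel (\<lambda>x. std_normal_density (?c * x) *\<^sub>R cis (?s * (?c * x)))
          (of_real (exp (- ?s\<^sup>2 / 2)) /\<^sub>R \<bar>?c\<bar>)"
    using lborel_has_bochner_integral_real_affine_iff[of ?c "\<lambda>x. std_normal_density x *\<^sub>R cis (?s * x)" _ 0] c hb by simp
  hence "has_bochner_integral lborel (\<lambda>x. sqrt (2 * pi) *\<^sub>R (std_normal_density (?c * x) *\<^sub>R cis (?s * (?c * x))))
          (sqrt (2*pi) *\<^sub>R (of_real (exp (- ?s\<^sup>2 / 2)) /\<^sub>R \<bar>?c\<bar>))"
    by (rule has_bochner_integral_scaleR_right)
  moreover have "sqrt (2 * pi) *\<^sub>R (std_normal_density (?c * x) *\<^sub>R cis (?s * (?c * x)))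
      = cis (x * t) * of_real (exp (- (a * x\<^sup>2)))" for x
    using a c by (simp add: std_normal_density_def power_mult_distrib scaleR_conv_of_real mult.commute)
  moreover have "sqrt (2*pi) *\<^sub>R (complex_of_real (exp (- ?s\<^sup>2 / 2)) /\<^sub>R \<bar>?c\<bar>)
      = of_real (sqrt (pi / a) * exp (- t\<^sup>2 / (4 * a)))"
    using a by (simp add: power_divide scaleR_conv_of_real real_sqrt_divide real_sqrt_mult field_simps flip: of_real_mult)
  ultimately have "has_bochner_integral lborel (\<lambda>x. cis (x * t) * of_real (exp (- (a * x\<^sup>2))))
     (of_real (sqrt (pi / a) * exp (- t\<^sup>2 / (4 * a))))" by simp
  thus "integrable lborel (\<lambda>x. cis (x * t) * of_real (exp (- (a * x\<^sup>2))))"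
    and "(LINT x|lborel. cis (x * t) * of_real (exp (- (a * x\<^sup>2)))) = of_real (sqrt (pi / a) * exp (- t\<^sup>2 / (4 * a)))"
    by (simp_all add: has_bochner_integral_iff)
qed

lemma gauss_plane:
  fixes a :: real and \<xi> :: "real^2"
  assumes a: "a > 0"
  shows "integrable lborel (\<lambda>x::real^2. cis (x \<bullet> \<xi>) * of_real (exp (- (a * (norm x)\<^sup>2))))" (is ?I)
    and "(LINT x|lborel. cis ((x::real^2) \<bullet> \<xi>) * of_real (exp (- (a * (norm x)\<^sup>2))))
          = of_real (pi / a * exp (- (norm \<xi>)\<^sup>2 / (4 * a)))" (is ?E)
proof -
  have eq: "cis (x \<bullet> \<xi>) * of_real (exp (- (a * (norm x)\<^sup>2)))
     = (cis (x$1 * \<xi>$1) * of_real (exp (- (a * (x$1)\<^sup>2)))) * (cis (x$2 * \<xi>$2) * of_real (exp (- (a * (x$2)\<^sup>2))))" for x :: "real^2"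
    by (simp add: norm_vec2 inner_vec2 distrib_left cis_mult[symmetric] exp_add[symmetric] del: of_real_exp flip: of_real_mult)
  show ?I unfolding eq by (rule lborel_prod_vec2) (rule gauss_line[OF a])+
  have "(LINT x|lborel. cis ((x::real^2) \<bullet> \<xi>) * of_real (exp (- (a * (norm x)\<^sup>2))))
     = of_real (sqrt (pi / a) * exp (- (\<xi>$1)\<^sup>2 / (4 * a))) * of_real (sqrt (pi / a) * exp (- (\<xi>$2)\<^sup>2 / (4 * a)))"
    unfolding eq by (subst lborel_prod_vec2) (simp_all add: gauss_line[OF a])
  also have "\<dots> = of_real ((sqrt (pi / a) * sqrt (pi / a)) * (exp (- (\<xi>$1)\<^sup>2 / (4 * a)) * exp (- (\<xi>$2)\<^sup>2 / (4 * a))))"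
    by (simp only: of_real_mult mult_ac)
  also have "\<dots> = of_real (pi / a * exp (- (norm \<xi>)\<^sup>2 / (4 * a)))"
    using a by (simp add: norm_vec2 add_divide_distrib diff_divide_distrib flip: exp_add)
  finally show ?E .
qed

lemma gauss_plane_real:
  fixes a :: real
  assumes a: "a > 0"
  shows "integrable lborel (\<lambda>x::real^2. exp (- (a * (norm x)\<^sup>2)))"
    and "(LINT x|lborel. exp (- (a * (norm (x::real^2))\<^sup>2))) = pi / a"
proof -
  have "integrable lborel (\<lambda>x::real^2. complex_of_real (exp (- (a * (norm x)\<^sup>2))))"
    using gauss_plane(1)[OF a, of 0] by simp
  thus "integrable lborel (\<lambda>x::real^2. exp (- (a * (norm x)\<^sup>2)))"
    by (simp only: complex_of_real_integrable_eq)
  have "complex_of_real (LINT x|lborel. exp (- (a * (norm (x::real^2))\<^sup>2))) = of_real (pi / a)"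
    using gauss_plane(2)[OF a, of 0] by (simp flip: integral_complex_of_real)
  thus "(LINT x|lborel. exp (- (a * (norm (x::real^2))\<^sup>2))) = pi / a"
    by (simp only: of_real_eq_iff)
qed

text \<open>(1 + x1^2) (1 + x2^2) \<le> (1 + |x|^2)^2 bounds the function by a product of two
  integrable functions of one variable.\<close>

lemma integrable_inverse_square_weight:
  "integrable lborel (\<lambda>x::real^2. 1 / (1 + (norm x)\<^sup>2)\<^sup>2)"
proof -
  have 1: "integrable lborel (\<lambda>x::real. complex_of_real (1 / (1 + x\<^sup>2)))"
    using integrable_inverse_1_plus_square
    by (simp add: set_integrable_def inverse_eq_divide complex_of_real_integrable_eq del: of_real_divide of_real_add of_real_inverse)
  have "integrable lborel (\<lambda>x::real^2. complex_of_real (1 / (1 + (x$1)\<^sup>2)) * complex_of_real (1 / (1 + (x$2)\<^sup>2)))"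
    using lborel_prod_vec2(1)[OF 1 1] .
  thus ?thesis
  proof (rule Bochner_Integration.integrable_bound)
    show "AE x in lborel. norm (1 / (1 + (norm (x::real^2))\<^sup>2)\<^sup>2)
        \<le> cmod (complex_of_real (1 / (1 + (x$1)\<^sup>2)) * complex_of_real (1 / (1 + (x$2)\<^sup>2)))"
    proof (rule AE_I2)
      fix x :: "real^2"
      have "(1 + (x$1)\<^sup>2) * (1 + (x$2)\<^sup>2) \<le> (1 + (norm x)\<^sup>2) * (1 + (norm x)\<^sup>2)"
        by (rule mult_mono) (auto simp: norm_vec2)
      hence "1 / (1 + (norm x)\<^sup>2)\<^sup>2 \<le> 1 / ((1 + (x$1)\<^sup>2) * (1 + (x$2)\<^sup>2))"
        by (intro divide_left_mono) (auto simp: power2_eq_square[of "1 + _"] intro!: mult_pos_pos add_pos_nonneg)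
      moreover have "cmod (complex_of_real (1 / (1 + (x$1)\<^sup>2)) * complex_of_real (1 / (1 + (x$2)\<^sup>2)))
          = 1 / ((1 + (x$1)\<^sup>2) * (1 + (x$2)\<^sup>2))"
        unfolding of_real_mult[symmetric] norm_of_real by (auto intro!: abs_of_nonneg mult_nonneg_nonneg)
      ultimately show "norm (1 / (1 + (norm x)\<^sup>2)\<^sup>2)
        \<le> cmod (complex_of_real (1 / (1 + (x$1)\<^sup>2)) * complex_of_real (1 / (1 + (x$2)\<^sup>2)))" by simp
    qed
  qed auto
qed

lemma lborel_integrable_affine:
  fixes f :: "'a::euclidean_space \<Rightarrow> 'b::{banach, second_countable_topology}"
  assumes f: "integrable lborel f" and c: "c \<noteq> 0"
  shows "integrable lborel (\<lambda>x. f (t + c *\<^sub>R x))"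
proof -
  have [measurable]: "f \<in> borel_measurable borel" using f by auto
  have "integrable (density (distr lborel borel (\<lambda>x. t + c *\<^sub>R x)) (\<lambda>_. ennreal (\<bar>c\<bar>^DIM('a)))) f"
    using f unfolding lborel_affine[OF c, of t, symmetric] by simp
  hence "integrable lborel (\<lambda>x. \<bar>c\<bar> ^ DIM('a) *\<^sub>R f (t + c *\<^sub>R x))"
    by (subst (asm) integrable_density) (auto simp: integrable_distr_eq)
  from integrable_scaleR_right[OF this, of "inverse (\<bar>c\<bar> ^ DIM('a))"] show ?thesis using c by simp
qed

lemma lborel_integral_affine:
  fixes f :: "'a::euclidean_space \<Rightarrow> 'b::{banach, second_countable_topology}"
  assumes f[measurable]: "f \<in> borel_measurable borel" and c: "c \<noteq> 0"
  shows "(LINT x|lborel. f x) = \<bar>c\<bar> ^ DIM('a) *\<^sub>R (LINT x|lborel. f (t + c *\<^sub>R x))"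
  by (subst lborel_affine[OF c, of t]) (simp add: integral_density integral_distr)

lemma lborel_integral_reflect:
  fixes f :: "'a::euclidean_space \<Rightarrow> 'b::{banach, second_countable_topology}"
  assumes "f \<in> borel_measurable borel"
  shows "(LINT x|lborel. f (- x)) = (LINT x|lborel. f x)"
  using lborel_integral_affine[OF assms, of "-1" 0] by simp

lemma lborel_integral_translate:
  fixes f :: "'a::euclidean_space \<Rightarrow> 'b::{banach, second_countable_topology}"
  assumes "f \<in> borel_measurable borel"
  shows "(LINT x|lborel. f (t + x)) = (LINT x|lborel. f x)"
  using lborel_integral_affine[OF assms, of 1 t] by simp

text \<open>A measure that gives every box its volume is \<open>lborel\<close>, and orthogonal maps
  preserve the Lebesgue measure of boxes; hence the passage through \<open>lebesgue\<close>.\<close>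

lemma lborel_distr_orthogonal:
  fixes R :: "real^2 \<Rightarrow> real^2"
  assumes R: "orthogonal_transformation R"
  shows "distr lborel borel R = lborel"
proof (rule lborel_eqI[symmetric])
  have "linear R" using R by (rule orthogonal_transformation_linear)
  hence meas: "R \<in> borel_measurable borel"
    by (intro borel_measurable_continuous_onI linear_continuous_on) (simp add: linear_conv_bounded_linear)
  obtain S where S: "orthogonal_transformation S" "\<And>x. S (R x) = x" "\<And>x. R (S x) = x"
    using R by (metis orthogonal_transformation_inv orthogonal_transformation_bij bij_inv_eq_iff)
  fix l u :: "real^2"
  assume lu: "\<And>b. b \<in> Basis \<Longrightarrow> l \<bullet> b \<le> u \<bullet> b"
  have RS: "R -` box l u = S ` box l u" using S by (auto simp: image_iff) metis
  have m1: "box l u \<in> lmeasurable" by simp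
  have "emeasure (distr lborel borel R) (box l u) = emeasure lborel (R -` box l u)"
    using meas by (subst emeasure_distr) auto
  also have "\<dots> = emeasure lebesgue (S ` box l u)"
  proof -
    have "R -` box l u \<in> sets lborel"
      using measurable_sets_borel[OF meas, of "box l u"] by simp
    hence "emeasure lebesgue (R -` box l u) = emeasure lborel (R -` box l u)" by simp
    thus ?thesis by (simp only: RS)
  qed
  also have "\<dots> = emeasure lebesgue (box l u)"
  proof -
    have m2: "S ` box l u \<in> lmeasurable" by (rule measurable_orthogonal_image[OF S(1) m1])
    have "emeasure lebesgue (S ` box l u) = ennreal (measure lebesgue (S ` box l u))"
      by (rule emeasure_eq_measure2[OF m2])
    also have "\<dots> = ennreal (measure lebesgue (box l u))"
      by (simp only: measure_orthogonal_image[OF S(1) m1])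
    also have "\<dots> = emeasure lebesgue (box l u)"
      by (rule emeasure_eq_measure2[OF m1, symmetric])
    finally show ?thesis .
  qed
  also have "\<dots> = emeasure lborel (box l u)" by simp
  also have "\<dots> = (\<Prod>b\<in>Basis. (u - l) \<bullet> b)" using lu by simp
  finally show "emeasure (distr lborel borel R) (box l u) = (\<Prod>b\<in>Basis. (u - l) \<bullet> b)" .
qed simp

section \<open>Schwartz functions\<close>

lemma partial_deriv_eqI:
  "(f has_derivative f') (at x) \<Longrightarrow> partial_deriv i f x = f' (axis i 1)"
  unfolding partial_deriv_def by (metis frechet_derivative_at)

lemma frechet_derivative_partial:
  assumes "f differentiable (at x)"
  shows "frechet_derivative f (at x) h = (\<Sum>i\<in>UNIV. h $ i *\<^sub>R partial_deriv i f x)"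
proof -
  interpret bounded_linear "frechet_derivative f (at x)"
    using assms frechet_derivative_works has_derivative_bounded_linear by blast
  have "h = (\<Sum>i\<in>UNIV. h $ i *\<^sub>R axis i 1)"
    using basis_expansion[of h] by (simp add: scalar_mult_eq_scaleR)
  hence "frechet_derivative f (at x) h = frechet_derivative f (at x) (\<Sum>i\<in>UNIV. h $ i *\<^sub>R axis i 1)"
    by (rule arg_cong)
  thus ?thesis by (simp only: sum scaleR partial_deriv_def)
qed

lemma has_derivative_partial:
  assumes "f differentiable (at x)"
  shows "(f has_derivative (\<lambda>h. \<Sum>i\<in>UNIV. h $ i *\<^sub>R partial_deriv i f x)) (at x)"
proof -
  have "frechet_derivative f (at x) = (\<lambda>h. \<Sum>i\<in>UNIV. h $ i *\<^sub>R partial_deriv i f x)"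
    using frechet_derivative_partial[OF assms] by blast
  thus ?thesis using assms frechet_derivative_works by metis
qed

lemma partial_deriv_add:
  assumes "\<And>x. f differentiable (at x)" "\<And>x. g differentiable (at x)"
  shows "partial_deriv i (\<lambda>x. f x + g x) = (\<lambda>x. partial_deriv i f x + partial_deriv i g x)"
proof
  fix x
  show "partial_deriv i (\<lambda>x. f x + g x) x = partial_deriv i f x + partial_deriv i g x"
    using partial_deriv_eqI[OF has_derivative_add[OF
      iffD1[OF frechet_derivative_works assms(1)] iffD1[OF frechet_derivative_works assms(2)]]]
    by (simp add: partial_deriv_def)
qed

lemma partial_deriv_mult:
  assumes "\<And>x. f differentiable (at x)" "\<And>x. g differentiable (at x)"
  shows "partial_deriv i (\<lambda>x. f x * g x) = (\<lambda>x. f x * partial_deriv i g x + partial_deriv i f x * g x)"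
proof
  fix x
  show "partial_deriv i (\<lambda>x. f x * g x) x = f x * partial_deriv i g x + partial_deriv i f x * g x"
    using partial_deriv_eqI[OF has_derivative_mult[OF
      iffD1[OF frechet_derivative_works assms(1)] iffD1[OF frechet_derivative_works assms(2)]]]
    by (simp add: partial_deriv_def)
qed

lemma partial_deriv_const: "partial_deriv i (\<lambda>x. c) = (\<lambda>x. 0)"
  by (rule ext) (simp add: partial_deriv_eqI[OF has_derivative_const])

lemma has_derivative_coord: "((\<lambda>x::real^2. complex_of_real (x $ j)) has_derivative (\<lambda>h. complex_of_real (h $ j))) (at x)"
  by (intro bounded_linear_imp_has_derivative bounded_linear_compose[OF bounded_linear_of_real bounded_linear_vec_nth])

lemma partial_deriv_coord: "partial_deriv i (\<lambda>x. complex_of_real (x $ j)) = (\<lambda>x. if i = j then 1 else 0)"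
  by (rule ext) (simp add: partial_deriv_eqI[OF has_derivative_coord] axis_def)

definition rapid :: "(real^2 \<Rightarrow> complex) \<Rightarrow> bool" where
  "rapid f \<longleftrightarrow> (\<forall>k. \<exists>C. \<forall>x. norm x ^ k * cmod (f x) \<le> C)"

lemma one_plus_square_power_le: "(1 + r\<^sup>2) ^ k \<le> 2 ^ k * (1 + r ^ (2 * k))" for r :: real
proof -
  have "(1 + r\<^sup>2) ^ k \<le> (2 * max 1 (r\<^sup>2)) ^ k" by (intro power_mono) auto
  also have "\<dots> = 2 ^ k * (max 1 (r\<^sup>2)) ^ k" by (simp add: power_mult_distrib)
  also have "(max 1 (r\<^sup>2)) ^ k \<le> 1 + (r\<^sup>2) ^ k" by (cases "1 \<le> r\<^sup>2") (auto simp: max_def)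
  finally show ?thesis by (simp add: power_mult mult_left_mono)
qed

lemma power_le_one_plus_square: "0 \<le> r \<Longrightarrow> r ^ k \<le> (1 + r\<^sup>2) ^ k" for r :: real
proof (rule power_mono)
  show "r \<le> 1 + r\<^sup>2" using sum_squares_ge_zero[of "r - 1/2" 0] by (simp add: power2_eq_square algebra_simps)
qed

lemma rapidD:
  assumes "rapid f"
  obtains C where "C > 0" "\<And>x. cmod (f x) \<le> C / (1 + (norm x)\<^sup>2) ^ k"
proof -
  obtain C0 C1 where C: "\<And>x. norm x ^ 0 * cmod (f x) \<le> C0" "\<And>x. norm x ^ (2 * k) * cmod (f x) \<le> C1"
    using assms unfolding rapid_def by metis
  define C where "C = 2 ^ k * (C0 + C1) + 1"
  have C0: "0 \<le> C0" "0 \<le> C1" using C[of 0] norm_ge_zero[of "f 0"]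
    by (auto intro: order_trans[OF _ C(1)[of 0]] order_trans[OF _ C(2)[of 0]])
  hence "C > 0" by (simp add: C_def add_nonneg_pos)
  moreover have "cmod (f x) \<le> C / (1 + (norm x)\<^sup>2) ^ k" for x
  proof -
    have p: "(1 + (norm x)\<^sup>2) ^ k > 0" by (simp add: add_pos_nonneg)
    have "(1 + (norm x)\<^sup>2) ^ k * cmod (f x) \<le> 2 ^ k * (1 + norm x ^ (2 * k)) * cmod (f x)"
      by (intro mult_right_mono one_plus_square_power_le) auto
    also have "\<dots> = 2 ^ k * (norm x ^ 0 * cmod (f x) + norm x ^ (2 * k) * cmod (f x))"
      by (simp add: algebra_simps)
    also have "\<dots> \<le> 2 ^ k * (C0 + C1)" using C by (intro mult_left_mono add_mono) auto
    also have "\<dots> \<le> C" by (simp add: C_def)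
    finally show ?thesis using p by (simp add: field_simps)
  qed
  ultimately show thesis using that by blast
qed

lemma rapidI:
  assumes "\<And>k. \<exists>C. \<forall>x. (1 + (norm x)\<^sup>2) ^ k * cmod (f x) \<le> C"
  shows "rapid f"
  unfolding rapid_def
proof
  fix k
  obtain C where C: "\<And>x. (1 + (norm x)\<^sup>2) ^ k * cmod (f x) \<le> C" using assms by blast
  have "norm x ^ k * cmod (f x) \<le> C" for x
    by (rule order_trans[OF mult_right_mono C]) (auto intro: power_le_one_plus_square)
  thus "\<exists>C. \<forall>x. norm x ^ k * cmod (f x) \<le> C" by blast
qed

lemma rapid_dominated:
  assumes f: "rapid f" and g: "\<And>x. cmod (g x) \<le> C * (1 + (norm x)\<^sup>2) ^ m * cmod (f x)"
  shows "rapid g"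
proof (rule rapidI)
  fix k
  obtain D where D: "D > 0" "\<And>x. cmod (f x) \<le> D / (1 + (norm x)\<^sup>2) ^ (k + m)" using rapidD[OF f] by blast
  have "(1 + (norm x)\<^sup>2) ^ k * cmod (g x) \<le> \<bar>C\<bar> * D" for x
  proof -
    have p: "(1 + (norm x)\<^sup>2) ^ n > 0" for n by (simp add: add_pos_nonneg)
    have "cmod (g x) \<le> \<bar>C\<bar> * (1 + (norm x)\<^sup>2) ^ m * cmod (f x)"
      by (rule order_trans[OF g]) (intro mult_right_mono, auto)
    hence "(1 + (norm x)\<^sup>2) ^ k * cmod (g x) \<le> (1 + (norm x)\<^sup>2) ^ k * (\<bar>C\<bar> * (1 + (norm x)\<^sup>2) ^ m * cmod (f x))"
      using p[of k] by (intro mult_left_mono) auto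
    also have "\<dots> = \<bar>C\<bar> * ((1 + (norm x)\<^sup>2) ^ (k + m) * cmod (f x))"
      by (simp add: power_add algebra_simps)
    also have "(1 + (norm x)\<^sup>2) ^ (k + m) * cmod (f x) \<le> D"
      using D(2)[of x] p[of "k+m"] by (simp add: field_simps)
    finally show ?thesis by (simp add: mult_left_mono)
  qed
  thus "\<exists>C. \<forall>x. (1 + (norm x)\<^sup>2) ^ k * cmod (g x) \<le> C" by blast
qed

lemma rapid_add: "rapid f \<Longrightarrow> rapid g \<Longrightarrow> rapid (\<lambda>x. f x + g x)"
  unfolding rapid_def
proof
  fix k assume "\<forall>k. \<exists>C. \<forall>x. norm x ^ k * cmod (f x) \<le> C" "\<forall>k. \<exists>C. \<forall>x. norm x ^ k * cmod (g x) \<le> C"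
  then obtain C D where "\<And>x. norm x ^ k * cmod (f x) \<le> C" "\<And>x. norm x ^ k * cmod (g x) \<le> D" by metis
  hence "norm x ^ k * cmod (f x + g x) \<le> C + D" for x
    by (intro order_trans[OF mult_left_mono[OF norm_triangle_ineq]]) (auto simp: distrib_left intro!: add_mono)
  thus "\<exists>C. \<forall>x. norm x ^ k * cmod (f x + g x) \<le> C" by blast
qed

text \<open>Membership speaks of all iterated derivatives at once. A set of differentiable, rapidly
  decreasing functions that is closed under partial derivatives contains them all as soon as it
  contains \<phi>, so each closure property reduces to the choice of such a set.\<close>

lemma schwartz_coinduct:
  assumes "\<phi> \<in> S"
    and "\<And>f x. f \<in> S \<Longrightarrow> f differentiable (at x)"
    and "\<And>f. f \<in> S \<Longrightarrow> rapid f"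
    and "\<And>f i. f \<in> S \<Longrightarrow> partial_deriv i f \<in> S"
  shows "\<phi> \<in> schwartz"
proof -
  have "partial_derivs is \<phi> \<in> S" for "is" by (induction "is") (auto intro: assms)
  thus ?thesis using assms(2,3)
    by (fastforce simp: schwartz_def rapid_def bdd_above_def)
qed

lemma schwartz_differentiable: "\<phi> \<in> schwartz \<Longrightarrow> \<phi> differentiable (at x)"
  unfolding schwartz_def by (metis (mono_tags, lifting) mem_Collect_eq partial_derivs.simps(1))

lemma schwartz_rapid: assumes "\<phi> \<in> schwartz" shows "rapid \<phi>"
proof -
  have "bdd_above (range (\<lambda>x. norm x ^ k * cmod (\<phi> x)))" for k
    using assms[unfolded schwartz_def mem_Collect_eq, THEN spec[of _ "[]"]] by simp
  thus ?thesis by (auto simp: rapid_def bdd_above_def)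
qed

lemma partial_derivs_snoc: "partial_derivs (is @ [i]) f = partial_derivs is (partial_deriv i f)"
  by (induction "is") auto

lemma schwartz_partial: "\<phi> \<in> schwartz \<Longrightarrow> partial_deriv i \<phi> \<in> schwartz"
  by (simp add: schwartz_def flip: partial_derivs_snoc)

lemma schwartz_add:
  assumes "\<phi> \<in> schwartz" "\<psi> \<in> schwartz" shows "(\<lambda>x. \<phi> x + \<psi> x) \<in> schwartz"
proof (rule schwartz_coinduct)
  let ?S = "{\<lambda>x. \<phi> x + \<psi> x | \<phi> \<psi>. \<phi> \<in> schwartz \<and> \<psi> \<in> schwartz}"
  show "(\<lambda>x. \<phi> x + \<psi> x) \<in> ?S" using assms by blast
  fix f assume "f \<in> ?S"
  then obtain \<alpha> \<beta> where f: "f = (\<lambda>x. \<alpha> x + \<beta> x)" "\<alpha> \<in> schwartz" "\<beta> \<in> schwartz" by blast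
  show "f differentiable (at x)" for x unfolding f(1) by (rule differentiable_add) (use f in \<open>auto intro: schwartz_differentiable\<close>)
  show "rapid f" unfolding f(1) by (intro rapid_add schwartz_rapid f(2,3))
  show "partial_deriv i f \<in> ?S" for i
    using f partial_deriv_add[of \<alpha> \<beta>] schwartz_partial schwartz_differentiable by blast
qed

inductive_set polys :: "(real^2 \<Rightarrow> complex) set" where
  const: "(\<lambda>x. c) \<in> polys"
| coord: "(\<lambda>x. complex_of_real (x $ i)) \<in> polys"
| add: "p \<in> polys \<Longrightarrow> q \<in> polys \<Longrightarrow> (\<lambda>x. p x + q x) \<in> polys"
| mult: "p \<in> polys \<Longrightarrow> q \<in> polys \<Longrightarrow> (\<lambda>x. p x * q x) \<in> polys"

lemma polys_differentiable: "p \<in> polys \<Longrightarrow> p differentiable (at x)"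
  by (induction rule: polys.induct)
     (auto intro!: derivative_intros differentiableI[OF has_derivative_coord])

lemma polys_partial: "p \<in> polys \<Longrightarrow> partial_deriv i p \<in> polys"
  by (induction rule: polys.induct)
     (auto simp: partial_deriv_const partial_deriv_coord partial_deriv_add partial_deriv_mult polys_differentiable
           intro: polys.intros)

lemma polys_bound: "p \<in> polys \<Longrightarrow> \<exists>C k. \<forall>x. cmod (p x) \<le> C * (1 + (norm x)\<^sup>2) ^ k"
proof (induction rule: polys.induct)
  case (const c)
  show ?case by (intro exI[of _ "cmod c"] exI[of _ 0]) auto
next
  case (coord i)
  have "cmod (complex_of_real (x $ i)) \<le> 1 * (1 + (norm x)\<^sup>2) ^ 1" for x :: "real^2"
    using component_le_norm_cart[of x i] power_le_one_plus_square[of "norm x" 1] by simp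
  thus ?case by blast
next
  case (add p q)
  then obtain C k D m where b: "\<And>x. cmod (p x) \<le> C * (1 + (norm x)\<^sup>2) ^ k" "\<And>x. cmod (q x) \<le> D * (1 + (norm x)\<^sup>2) ^ m"
    by metis
  have "cmod (p x + q x) \<le> (\<bar>C\<bar> + \<bar>D\<bar>) * (1 + (norm x)\<^sup>2) ^ (k + m)" for x
  proof -
    have "1 \<le> 1 + (norm x)\<^sup>2" by simp
    hence i: "(1 + (norm x)\<^sup>2) ^ k \<le> (1 + (norm x)\<^sup>2) ^ (k + m)" "(1 + (norm x)\<^sup>2) ^ m \<le> (1 + (norm x)\<^sup>2) ^ (k + m)"
      by (intro power_increasing; simp)+
    have "cmod (p x) \<le> \<bar>C\<bar> * (1 + (norm x)\<^sup>2) ^ (k + m)"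
      by (rule order_trans[OF b(1) mult_mono[OF abs_ge_self i(1)]]) (auto simp: add_nonneg_nonneg)
    moreover have "cmod (q x) \<le> \<bar>D\<bar> * (1 + (norm x)\<^sup>2) ^ (k + m)"
      by (rule order_trans[OF b(2) mult_mono[OF abs_ge_self i(2)]]) (auto simp: add_nonneg_nonneg)
    ultimately show ?thesis using norm_triangle_ineq[of "p x" "q x"] by (simp add: distrib_right)
  qed
  thus ?case by blast
next
  case (mult p q)
  then obtain C k D m where b: "\<And>x. cmod (p x) \<le> C * (1 + (norm x)\<^sup>2) ^ k" "\<And>x. cmod (q x) \<le> D * (1 + (norm x)\<^sup>2) ^ m"
    by metis
  have "cmod (p x * q x) \<le> (C * D) * (1 + (norm x)\<^sup>2) ^ (k + m)" for x
    using mult_mono[OF b(1)[of x] b(2)[of x] order_trans[OF norm_ge_zero b(1)]]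
    by (simp add: norm_mult power_add mult_ac)
  thus ?case by blast
qed

text \<open>The product rule turns one product into a sum of products, so the set used with
  \<open>schwartz_coinduct\<close> has to contain finite sums.\<close>

inductive_set exp_span :: "(real^2 \<Rightarrow> complex) \<Rightarrow> (real^2 \<Rightarrow> complex) set" for \<theta> where
  base: "Q \<in> polys \<Longrightarrow> \<phi> \<in> schwartz \<Longrightarrow> (\<lambda>x. (Q x * \<theta> x) * \<phi> x) \<in> exp_span \<theta>"
| add: "f \<in> exp_span \<theta> \<Longrightarrow> g \<in> exp_span \<theta> \<Longrightarrow> (\<lambda>x. f x + g x) \<in> exp_span \<theta>"

text \<open>If every partial derivative of \<theta> is a polynomial times \<theta>, as for \<theta>
  = 1 and for \<theta> = e^(i t |x|^2), differentiation never leaves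
  \<open>exp_span \<theta>\<close>, and |\<theta>| \<le> 1 preserves the decay of \<phi>.\<close>

lemma schwartz_mult_exp:
  assumes \<theta>: "\<And>x. \<theta> differentiable (at x)" "\<And>x. cmod (\<theta> x) \<le> 1"
    "\<And>i. \<exists>q\<in>polys. partial_deriv i \<theta> = (\<lambda>x. q x * \<theta> x)"
    and Q: "Q \<in> polys" and \<phi>: "\<phi> \<in> schwartz"
  shows "(\<lambda>x. (Q x * \<theta> x) * \<phi> x) \<in> schwartz"
proof (rule schwartz_coinduct)
  show "(\<lambda>x. (Q x * \<theta> x) * \<phi> x) \<in> exp_span \<theta>" by (intro exp_span.base Q \<phi>)
  show d: "f differentiable (at x)" if "f \<in> exp_span \<theta>" for f x
    using that by induction
      (auto intro!: differentiable_add differentiable_mult intro: polys_differentiable \<theta> schwartz_differentiable)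
  show "rapid f" if "f \<in> exp_span \<theta>" for f
    using that
  proof induction
    case (base Q \<phi>)
    obtain C k where C: "\<And>x. cmod (Q x) \<le> C * (1 + (norm x)\<^sup>2) ^ k" using polys_bound[OF base(1)] by blast
    show ?case
    proof (rule rapid_dominated[OF schwartz_rapid[OF base(2)]])
      fix x
      have "cmod (Q x) * cmod (\<theta> x) \<le> cmod (Q x)" using \<theta>(2)[of x] by (simp add: mult_left_le)
      also have "\<dots> \<le> C * (1 + (norm x)\<^sup>2) ^ k" by (rule C)
      finally show "cmod ((Q x * \<theta> x) * \<phi> x) \<le> C * (1 + (norm x)\<^sup>2) ^ k * cmod (\<phi> x)"
        by (simp add: norm_mult mult_right_mono)
    qed
  next
    case (add f g) thus ?case by (intro rapid_add)
  qed
  show "partial_deriv i f \<in> exp_span \<theta>" if "f \<in> exp_span \<theta>" for f i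
    using that
  proof induction
    case (base Q \<phi>)
    obtain q where q: "q \<in> polys" "partial_deriv i \<theta> = (\<lambda>x. q x * \<theta> x)" using \<theta>(3) by blast
    have Q\<theta>: "(\<lambda>x. Q x * \<theta> x) differentiable (at x)" for x
      by (intro differentiable_mult polys_differentiable[OF base(1)] \<theta>(1))
    have "partial_deriv i (\<lambda>x. (Q x * \<theta> x) * \<phi> x) =
      (\<lambda>x. (Q x * \<theta> x) * partial_deriv i \<phi> x + ((Q x * q x + partial_deriv i Q x) * \<theta> x) * \<phi> x)"
      by (simp add: partial_deriv_mult[OF Q\<theta> schwartz_differentiable[OF base(2)]]
          partial_deriv_mult[OF polys_differentiable[OF base(1)] \<theta>(1)] q(2)) (simp add: algebra_simps)
    also have "\<dots> \<in> exp_span \<theta>"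
    proof (rule exp_span.add)
      show "(\<lambda>x. (Q x * \<theta> x) * partial_deriv i \<phi> x) \<in> exp_span \<theta>"
        by (rule exp_span.base[OF base(1) schwartz_partial[OF base(2)]])
      show "(\<lambda>x. ((Q x * q x + partial_deriv i Q x) * \<theta> x) * \<phi> x) \<in> exp_span \<theta>"
        by (rule exp_span.base) (intro polys.add polys.mult polys_partial base(1) q(1), rule base(2))
    qed
    finally show ?case .
  next
    case (add f g)
    thus ?case by (simp add: partial_deriv_add d exp_span.add)
  qed
qed

lemma schwartz_mult_poly:
  assumes "Q \<in> polys" "\<phi> \<in> schwartz" shows "(\<lambda>x. Q x * \<phi> x) \<in> schwartz"
  using schwartz_mult_exp[of "\<lambda>x. 1", OF _ _ _ assms] polys.const[of 0]
  by (simp add: partial_deriv_const)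

lemma schwartz_cmult: "\<phi> \<in> schwartz \<Longrightarrow> (\<lambda>x. c * \<phi> x) \<in> schwartz"
  using schwartz_mult_poly[OF polys.const] .

lemma schwartz_coord_mult: "\<phi> \<in> schwartz \<Longrightarrow> (\<lambda>x. complex_of_real (x $ i) * \<phi> x) \<in> schwartz"
  using schwartz_mult_poly[OF polys.coord] .

lemma has_derivative_norm_sq:
  "((\<lambda>x::real^2. (norm x)\<^sup>2) has_derivative (\<lambda>h. 2 * (x \<bullet> h))) (at x)"
proof -
  have "((\<lambda>x::real^2. x \<bullet> x) has_derivative (\<lambda>h. x \<bullet> h + h \<bullet> x)) (at x)"
    by (intro derivative_eq_intros) auto
  thus ?thesis by (simp add: power2_norm_eq_inner inner_commute)
qed

lemma has_derivative_exp_comp: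
  fixes g :: "'a::real_normed_vector \<Rightarrow> complex"
  assumes "(g has_derivative g') (at x)"
  shows "((\<lambda>x. exp (g x)) has_derivative (\<lambda>h. g' h * exp (g x))) (at x)"
proof -
  have "(exp has_derivative (*) (exp (g x))) (at (g x))"
    using DERIV_exp[of "g x"] by (simp add: has_field_derivative_def)
  from has_derivative_compose[OF assms this] show ?thesis by (simp add: mult.commute)
qed

lemma has_derivative_cis_comp:
  fixes g :: "'a::real_normed_vector \<Rightarrow> real"
  assumes "(g has_derivative g') (at x)"
  shows "((\<lambda>x. cis (g x)) has_derivative (\<lambda>h. \<i> * g' h * cis (g x))) (at x)"
  using has_derivative_exp_comp[OF has_derivative_mult_right[OF has_derivative_of_real[OF assms], of \<i>]]
  by (simp add: cis_conv_exp)

lemma schwartz_mult_cis: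
  assumes "\<phi> \<in> schwartz" shows "(\<lambda>x. cis (t * (norm x)\<^sup>2) * \<phi> x) \<in> schwartz"
proof -
  let ?\<theta> = "\<lambda>x::real^2. cis (t * (norm x)\<^sup>2)"
  have d: "(?\<theta> has_derivative (\<lambda>h. \<i> * complex_of_real (t * (2 * (x \<bullet> h))) * ?\<theta> x)) (at x)" for x :: "real^2"
    by (rule has_derivative_cis_comp) (rule has_derivative_mult_right[OF has_derivative_norm_sq])
  have p: "partial_deriv i ?\<theta> = (\<lambda>x. (\<lambda>x. (\<i> * of_real (2 * t)) * of_real (x $ i)) x * ?\<theta> x)" for i
    by (rule ext) (simp add: partial_deriv_eqI[OF d] inner_axis mult_ac)
  have q: "\<exists>q\<in>polys. partial_deriv i ?\<theta> = (\<lambda>x. q x * ?\<theta> x)" for i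
    by (rule bexI[where x = "\<lambda>x. (\<i> * of_real (2 * t)) * of_real (x $ i)"])
       (simp_all only: p, intro polys.intros)
  have "(\<lambda>x. (1 * ?\<theta> x) * \<phi> x) \<in> schwartz"
    using differentiableI[OF d] q by (intro schwartz_mult_exp polys.const assms) auto
  thus ?thesis by simp
qed

text \<open>Derivatives of e^(-P) are polynomials times e^(-P), so rapid decay of e^(-P) itself
  carries over to all derivatives. It serves for Gaussians and for the smooth substitutes of box
  indicators.\<close>

lemma schwartz_exp_poly:
  assumes P: "(\<lambda>x. complex_of_real (P x)) \<in> polys"
    and R: "rapid (\<lambda>x. complex_of_real (exp (- P x)))"
  shows "(\<lambda>x. complex_of_real (exp (- P x))) \<in> schwartz"
proof (rule schwartz_coinduct)
  let ?P = "\<lambda>x. complex_of_real (P x)"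
  let ?S = "{\<lambda>x. Q x * exp (- ?P x) | Q. Q \<in> polys}"
  show "(\<lambda>x. complex_of_real (exp (- P x))) \<in> ?S"
    by (rule CollectI, rule exI[of _ "\<lambda>x. 1"]) (auto simp: exp_of_real[symmetric] polys.const)
  have E: "((\<lambda>x. exp (- ?P x)) has_derivative (\<lambda>h. - frechet_derivative ?P (at x) h * exp (- ?P x))) (at x)" for x
    by (rule has_derivative_exp_comp, rule has_derivative_minus)
       (rule iffD1[OF frechet_derivative_works polys_differentiable[OF P]])
  have pE: "partial_deriv i (\<lambda>x. exp (- ?P x)) = (\<lambda>x. - partial_deriv i ?P x * exp (- ?P x))" for i
    by (rule ext) (simp add: partial_deriv_eqI[OF E] partial_deriv_def)
  have dE: "(\<lambda>x. exp (- ?P x)) differentiable (at x)" for x using E differentiableI by blast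
  fix f assume "f \<in> ?S"
  then obtain Q where f: "f = (\<lambda>x. Q x * exp (- ?P x))" and Q: "Q \<in> polys" by blast
  show "f differentiable (at x)" for x
    unfolding f by (intro derivative_intros polys_differentiable Q dE)
  obtain C k where C: "\<And>x. cmod (Q x) \<le> C * (1 + (norm x)\<^sup>2) ^ k" using polys_bound[OF Q] by blast
  show "rapid f" unfolding f
    by (rule rapid_dominated[OF R, of _ C k]) (auto simp: norm_mult exp_of_real[symmetric] intro!: mult_right_mono C)
  show "partial_deriv i f \<in> ?S" for i
  proof -
    have "partial_deriv i f = (\<lambda>x. (Q x * ((-1) * partial_deriv i ?P x) + partial_deriv i Q x) * exp (- ?P x))"
      unfolding f by (simp add: partial_deriv_mult[OF polys_differentiable[OF Q] dE] pE algebra_simps)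
    moreover have "(\<lambda>x. Q x * ((-1) * partial_deriv i ?P x) + partial_deriv i Q x) \<in> polys"
      by (intro polys.intros Q P polys_partial)
    ultimately show ?thesis by (intro CollectI exI conjI)
  qed
qed

lemma schwartz_comp_orthogonal:
  assumes R: "orthogonal_transformation R" and \<phi>: "\<phi> \<in> schwartz"
  shows "\<phi> \<circ> R \<in> schwartz"
proof (rule schwartz_coinduct)
  let ?S = "{\<phi> \<circ> R | \<phi>. \<phi> \<in> schwartz}"
  show "\<phi> \<circ> R \<in> ?S" using \<phi> by blast
  fix f assume "f \<in> ?S"
  then obtain \<psi> where f: "f = \<psi> \<circ> R" and \<psi>: "\<psi> \<in> schwartz" by blast
  have bl: "bounded_linear R"
    using R orthogonal_transformation_linear linear_conv_bounded_linear by blast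
  have D: "(f has_derivative (\<lambda>h. \<Sum>i\<in>UNIV. R h $ i *\<^sub>R partial_deriv i \<psi> (R x))) (at x)" for x
    unfolding f comp_def
    by (rule has_derivative_compose[OF bounded_linear_imp_has_derivative[OF bl] has_derivative_partial[OF schwartz_differentiable[OF \<psi>]]])
  show "f differentiable (at x)" for x using D differentiableI by blast
  show "rapid f" using schwartz_rapid[OF \<psi>] orthogonal_transformation_norm[OF R]
    unfolding rapid_def f by (metis comp_apply)
  show "partial_deriv i f \<in> ?S" for i
  proof -
    \<comment> \<open>Chain rule: the coefficients are the coordinates of the image of the i-th
      basis vector under R, hence constants.\<close>
    let ?\<chi> = "\<lambda>y. of_real (R (axis i 1) $ 1) * partial_deriv 1 \<psi> y + of_real (R (axis i 1) $ 2) * partial_deriv 2 \<psi> y"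
    have "partial_deriv i f = ?\<chi> \<circ> R"
      by (rule ext) (simp add: partial_deriv_eqI[OF D] sum_2 scaleR_conv_of_real)
    moreover have "?\<chi> \<in> schwartz" by (intro schwartz_add schwartz_cmult schwartz_partial \<psi>)
    ultimately show ?thesis by blast
  qed
qed

lemma power_fact_le_exp:
  fixes x :: real
  assumes "0 \<le> x" shows "x ^ k / fact k \<le> exp x"
proof -
  have "x ^ k / fact k \<le> (\<Sum>n<Suc k. x ^ n /\<^sub>R fact n)"
    using assms member_le_sum[of k "{..<Suc k}" "\<lambda>n. x ^ n /\<^sub>R fact n"]
    by (auto simp: divide_inverse mult.commute)
  also have "\<dots> \<le> exp x"
    unfolding exp_def by (rule sum_le_suminf[OF summable_exp_generic]) (use assms in auto)
  finally show ?thesis .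
qed

text \<open>With y = 1 + |x|^2, a single term of the exponential series gives (a y)^k \<le> k! e^(a
  y), and e^(a y) e^(-a |x|^2) is the constant e^a.\<close>

lemma rapid_gaussian:
  assumes a: "a > 0" shows "rapid (\<lambda>x. complex_of_real (exp (- (a * (norm x)\<^sup>2))))"
proof (rule rapidI)
  fix k
  have "(1 + (norm x)\<^sup>2) ^ k * cmod (complex_of_real (exp (- (a * (norm x)\<^sup>2)))) \<le> exp a * fact k / a ^ k" for x :: "real^2"
  proof -
    let ?y = "1 + (norm x)\<^sup>2"
    have "(a * ?y) ^ k / fact k \<le> exp (a * ?y)"
      using a by (intro power_fact_le_exp) simp
    hence "a ^ k * ?y ^ k \<le> exp (a * ?y) * fact k"
      unfolding power_mult_distrib by (simp only: pos_divide_le_eq[OF fact_gt_zero])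
    hence "?y ^ k \<le> exp (a * ?y) * fact k / a ^ k"
      using a by (simp only: pos_le_divide_eq zero_less_power mult.commute)
    hence "?y ^ k * exp (- (a * (norm x)\<^sup>2)) \<le> exp (a * ?y) * fact k / a ^ k * exp (- (a * (norm x)\<^sup>2))"
      by (intro mult_right_mono) auto
    also have "\<dots> = exp (a * ?y + - (a * (norm x)\<^sup>2)) * fact k / a ^ k" by (simp only: exp_add mult_ac times_divide_eq_right times_divide_eq_left)
    also have "\<dots> = exp a * fact k / a ^ k" by (simp add: algebra_simps)
    finally show ?thesis by simp
  qed
  thus "\<exists>C. \<forall>x::real^2. (1 + (norm x)\<^sup>2) ^ k * cmod (complex_of_real (exp (- (a * (norm x)\<^sup>2)))) \<le> C" by blast
qed

lemma polys_power: "p \<in> polys \<Longrightarrow> (\<lambda>x. p x ^ n) \<in> polys"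
  by (induction n) (auto intro: polys.intros)

lemma schwartz_gaussian:
  assumes a: "a > 0" shows "(\<lambda>x. complex_of_real (exp (- (a * (norm x)\<^sup>2)))) \<in> schwartz"
proof (rule schwartz_exp_poly[OF _ rapid_gaussian[OF a]])
  have "(\<lambda>x. of_real a * (complex_of_real (x $ 1) ^ 2 + complex_of_real (x $ 2) ^ 2)) \<in> polys"
    by (intro polys.mult polys.add polys_power polys.const polys.coord)
  thus "(\<lambda>x. complex_of_real (a * (norm x)\<^sup>2)) \<in> polys" by (simp add: norm_vec2)
qed

lemma schwartz_continuous: "\<phi> \<in> schwartz \<Longrightarrow> continuous_on A \<phi>"
  by (meson continuous_at_imp_continuous_on differentiable_imp_continuous_within schwartz_differentiable)

lemma schwartz_measurable [measurable]: "\<phi> \<in> schwartz \<Longrightarrow> \<phi> \<in> borel_measurable borel"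
  by (intro borel_measurable_continuous_onI schwartz_continuous)

lemma integrable_square_weight_bound:
  fixes f :: "real^2 \<Rightarrow> 'a::{banach, second_countable_topology}"
  assumes "f \<in> borel_measurable borel" and "\<And>x. norm (f x) \<le> C / (1 + (norm x)\<^sup>2)\<^sup>2"
  shows "integrable lborel f"
proof (rule Bochner_Integration.integrable_bound)
  show "integrable lborel (\<lambda>x::real^2. C * (1 / (1 + (norm x)\<^sup>2)\<^sup>2))"
    by (intro integrable_mult_right integrable_inverse_square_weight)
  show "AE x in lborel. norm (f x) \<le> norm (C * (1 / (1 + (norm x)\<^sup>2)\<^sup>2))"
    using assms(2) by (auto intro!: AE_I2 order_trans[OF assms(2)] simp: abs_ge_self divide_right_mono)
qed (use assms in auto)

lemma schwartz_integrable: assumes "\<phi> \<in> schwartz" shows "integrable lborel \<phi>"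
  using rapidD[OF schwartz_rapid[OF assms], of 2] assms
  by (metis integrable_square_weight_bound schwartz_measurable)

lemma integrable_mult_bounded:
  fixes f g :: "'a \<Rightarrow> complex"
  assumes "integrable M f" "g \<in> borel_measurable M" "\<And>x. cmod (g x) \<le> C"
  shows "integrable M (\<lambda>x. g x * f x)"
proof (rule Bochner_Integration.integrable_bound)
  show "integrable M (\<lambda>x. C * cmod (f x))" using assms(1) by auto
  show "AE x in M. norm (g x * f x) \<le> norm (C * cmod (f x))"
    by (auto intro!: AE_I2 mult_right_mono order_trans[OF assms(3)] simp: norm_mult abs_mult)
qed (use assms in auto)

section \<open>The Fourier transform of Schwartz functions\<close>

lemma has_derivative_quadratic_bound:
  fixes f :: "'a::real_normed_vector \<Rightarrow> 'b::real_normed_vector"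
  assumes L: "bounded_linear L" and b: "\<And>h. norm (f (x + h) - f x - L h) \<le> C * (norm h)\<^sup>2"
  shows "(f has_derivative L) (at x)"
  unfolding has_derivative_at
proof (intro conjI L)
  have "norm (norm (f (x + h) - f x - L h) / norm h) \<le> \<bar>C\<bar> * norm h" for h
  proof (cases "h = 0")
    case False
    have "norm (f (x + h) - f x - L h) \<le> \<bar>C\<bar> * (norm h)\<^sup>2"
      by (rule order_trans[OF b mult_right_mono]) auto
    thus ?thesis using False by (simp add: divide_le_eq power2_eq_square)
  qed auto
  moreover have "((\<lambda>h::'a. \<bar>C\<bar> * norm h) \<longlongrightarrow> 0) (at 0)"
    by (auto intro!: tendsto_eq_intros)
  ultimately show "(\<lambda>h. norm (f (x + h) - f x - L h) / norm h) \<midarrow>0\<rightarrow> 0"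
    by - (rule Lim_null_comparison[rotated], assumption, simp add: always_eventually)
qed

lemma cis_taylor1: "cmod (cis (a + b) - cis a - \<i> * b * cis a) \<le> b\<^sup>2 / 2"
proof -
  have "cmod (iexp b - (\<Sum>k\<le>1. (\<i> * b) ^ k / fact k)) \<le> \<bar>b\<bar> ^ Suc 1 / fact (Suc 1)"
    by (rule iexp_approx1)
  hence "cmod (cis b - 1 - \<i> * b) \<le> b\<^sup>2 / 2"
    by (simp add: cis_conv_exp diff_diff_eq power2_eq_square)
  moreover have "cis (a + b) - cis a - \<i> * b * cis a = cis a * (cis b - 1 - \<i> * b)"
    by (simp add: cis_mult[symmetric] algebra_simps)
  ultimately show ?thesis by (simp add: norm_mult)
qed

lemma integrable_cis_mult:
  fixes g :: "'a \<Rightarrow> real"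
  assumes "integrable M f" "g \<in> borel_measurable M"
  shows "integrable M (\<lambda>x. cis (g x) * f x)"
  using assms by (intro integrable_mult_bounded[where C = 1]) auto

lemma schwartz_fourier_integrable:
  "\<phi> \<in> schwartz \<Longrightarrow> integrable lborel (\<lambda>x. cis (- (x \<bullet> \<xi>)) * \<phi> x)"
  by (intro integrable_cis_mult schwartz_integrable) auto

lemma fourier_add:
  "\<phi> \<in> schwartz \<Longrightarrow> \<psi> \<in> schwartz \<Longrightarrow> fourier (\<lambda>x. \<phi> x + \<psi> x) \<xi> = fourier \<phi> \<xi> + fourier \<psi> \<xi>"
  by (simp add: fourier_def distrib_left schwartz_fourier_integrable add_divide_distrib)

lemma fourier_cmult: "fourier (\<lambda>x. c * \<phi> x) \<xi> = c * fourier \<phi> \<xi>"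
  by (simp add: fourier_def mult.left_commute[of _ c])

lemma fourier_bound: "\<phi> \<in> schwartz \<Longrightarrow> cmod (fourier \<phi> \<xi>) \<le> (LINT x|lborel. cmod (\<phi> x)) / (2 * pi)"
  using integral_norm_bound[of lborel "\<lambda>x. cis (- (x \<bullet> \<xi>)) * \<phi> x"]
  by (simp add: fourier_def norm_mult norm_divide divide_right_mono)

text \<open>The first-order Taylor error of the exponential is at most (x \<bullet> h)^2 / 2, which
  is integrable against |\<phi>|. This bounds the increment quadratically in h and replaces a limit
  under the integral.\<close>

lemma fourier_has_derivative:
  assumes \<phi>: "\<phi> \<in> schwartz"
  shows "(fourier \<phi> has_derivative
    (\<lambda>h. \<Sum>i\<in>UNIV. h $ i *\<^sub>R fourier (\<lambda>x. - \<i> * (of_real (x $ i) * \<phi> x)) \<xi>)) (at \<xi>)"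
proof (rule has_derivative_quadratic_bound)
  let ?L = "\<lambda>h. \<Sum>i\<in>UNIV. (h::real^2) $ i *\<^sub>R fourier (\<lambda>x. - \<i> * (of_real (x $ i) * \<phi> x)) \<xi>"
  show "bounded_linear ?L"
    by (intro bounded_linear_sum bounded_linear_compose[OF bounded_linear_scaleR_left] bounded_linear_vec_nth)
  have xi: "(\<lambda>x. - \<i> * (of_real (x $ i) * \<phi> x)) \<in> schwartz" for i
    by (intro schwartz_cmult schwartz_coord_mult \<phi>)
  have r2: "integrable lborel (\<lambda>x. (norm x)\<^sup>2 * cmod (\<phi> x))"
  proof -
    have "(\<lambda>x. of_real (x $ 1) * (of_real (x $ 1) * \<phi> x) + of_real (x $ 2) * (of_real (x $ 2) * \<phi> x)) \<in> schwartz"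
      by (intro schwartz_add schwartz_coord_mult \<phi>)
    hence "integrable lborel (\<lambda>x. cmod (of_real (x $ 1) * (of_real (x $ 1) * \<phi> x) + of_real (x $ 2) * (of_real (x $ 2) * \<phi> x)))"
      by (intro integrable_norm schwartz_integrable)
    moreover have "of_real (x $ 1) * (of_real (x $ 1) * \<phi> x) + of_real (x $ 2) * (of_real (x $ 2) * \<phi> x)
       = of_real ((norm x)\<^sup>2) * \<phi> x" for x by (simp only: norm_vec2) (simp add: power2_eq_square algebra_simps)
    ultimately show ?thesis by (simp add: norm_mult norm_power)
  qed
  fix h :: "real^2"
  have L: "?L h = (LINT x|lborel. cis (- (x \<bullet> \<xi>)) * (- \<i> * of_real (x \<bullet> h) * \<phi> x)) / of_real (2 * pi)"
  proof -
    have "?L h = fourier (\<lambda>x. of_real (h $ 1) * (- \<i> * (of_real (x $ 1) * \<phi> x)) + of_real (h $ 2) * (- \<i> * (of_real (x $ 2) * \<phi> x))) \<xi>"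
      using fourier_add[OF schwartz_cmult[OF xi[of 1]] schwartz_cmult[OF xi[of 2]]]
      by (simp only: sum_2 fourier_cmult scaleR_conv_of_real)
    also have "(\<lambda>x. of_real (h $ 1) * (- \<i> * (of_real (x $ 1) * \<phi> x)) + of_real (h $ 2) * (- \<i> * (of_real (x $ 2) * \<phi> x)))
       = (\<lambda>x. - \<i> * of_real (x \<bullet> h) * \<phi> x)" by (auto simp: inner_vec2 algebra_simps)
    finally show ?thesis by (simp add: fourier_def)
  qed
  have ih: "integrable lborel (\<lambda>x. cis (- (x \<bullet> \<xi>)) * (- \<i> * of_real (x \<bullet> h) * \<phi> x))"
  proof -
    have "(\<lambda>x. of_real (h $ 1) * (- \<i> * (of_real (x $ 1) * \<phi> x)) + of_real (h $ 2) * (- \<i> * (of_real (x $ 2) * \<phi> x))) \<in> schwartz"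
      by (intro schwartz_add schwartz_cmult schwartz_coord_mult \<phi>)
    also have "(\<lambda>x. of_real (h $ 1) * (- \<i> * (of_real (x $ 1) * \<phi> x)) + of_real (h $ 2) * (- \<i> * (of_real (x $ 2) * \<phi> x)))
       = (\<lambda>x. - \<i> * of_real (x \<bullet> h) * \<phi> x)" by (auto simp: inner_vec2 algebra_simps)
    finally show ?thesis by (rule schwartz_fourier_integrable)
  qed
  have "fourier \<phi> (\<xi> + h) - fourier \<phi> \<xi> - ?L h
     = (LINT x|lborel. cis (- (x \<bullet> (\<xi> + h))) * \<phi> x - cis (- (x \<bullet> \<xi>)) * \<phi> x - cis (- (x \<bullet> \<xi>)) * (- \<i> * of_real (x \<bullet> h) * \<phi> x)) / of_real (2 * pi)"
    unfolding L unfolding fourier_def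
    using schwartz_fourier_integrable[OF \<phi>]
    by (simp only: Bochner_Integration.integral_diff Bochner_Integration.integrable_diff ih diff_divide_distrib)
  hence "cmod (fourier \<phi> (\<xi> + h) - fourier \<phi> \<xi> - ?L h) = cmod (LINT x|lborel. cis (- (x \<bullet> (\<xi> + h))) * \<phi> x - cis (- (x \<bullet> \<xi>)) * \<phi> x - cis (- (x \<bullet> \<xi>)) * (- \<i> * of_real (x \<bullet> h) * \<phi> x)) / (2 * pi)"
    by (simp only:) (simp add: norm_divide)
  also have "\<dots> \<le> (LINT x|lborel. (norm h)\<^sup>2 * ((norm x)\<^sup>2 * cmod (\<phi> x))) / (2 * pi)"
  proof (rule divide_right_mono, rule Bochner_Integration.integral_norm_bound_integral)
    show "integrable lborel (\<lambda>x. cis (- (x \<bullet> (\<xi> + h))) * \<phi> x - cis (- (x \<bullet> \<xi>)) * \<phi> x - cis (- (x \<bullet> \<xi>)) * (- \<i> * of_real (x \<bullet> h) * \<phi> x))"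
      by (rule Bochner_Integration.integrable_diff[OF Bochner_Integration.integrable_diff[OF
            schwartz_fourier_integrable[OF \<phi>] schwartz_fourier_integrable[OF \<phi>]] ih])
    show "integrable lborel (\<lambda>x. (norm h)\<^sup>2 * ((norm x)\<^sup>2 * cmod (\<phi> x)))" by (rule integrable_mult_right[OF r2])
    fix x
    have "cis (- (x \<bullet> (\<xi> + h))) * \<phi> x - cis (- (x \<bullet> \<xi>)) * \<phi> x - cis (- (x \<bullet> \<xi>)) * (- \<i> * of_real (x \<bullet> h) * \<phi> x)
      = (cis (- (x \<bullet> \<xi>) + - (x \<bullet> h)) - cis (- (x \<bullet> \<xi>)) - \<i> * of_real (- (x \<bullet> h)) * cis (- (x \<bullet> \<xi>))) * \<phi> x"
      by (simp add: inner_add_right algebra_simps)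
    hence "cmod (cis (- (x \<bullet> (\<xi> + h))) * \<phi> x - cis (- (x \<bullet> \<xi>)) * \<phi> x - cis (- (x \<bullet> \<xi>)) * (- \<i> * of_real (x \<bullet> h) * \<phi> x))
      \<le> (- (x \<bullet> h))\<^sup>2 / 2 * cmod (\<phi> x)"
      by (simp only: norm_mult mult_right_mono[OF cis_taylor1 norm_ge_zero])
    also have "(- (x \<bullet> h))\<^sup>2 / 2 \<le> (norm h)\<^sup>2 * (norm x)\<^sup>2"
    proof -
      have "\<bar>x \<bullet> h\<bar>\<^sup>2 \<le> (norm x * norm h)\<^sup>2" by (intro power_mono Cauchy_Schwarz_ineq2) auto
      moreover have "0 \<le> (norm h)\<^sup>2 * (norm x)\<^sup>2" by simp
      ultimately have "(x \<bullet> h)\<^sup>2 \<le> 2 * ((norm h)\<^sup>2 * (norm x)\<^sup>2)"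
        by (simp only: power2_abs power_mult_distrib mult.commute[of "(norm h)\<^sup>2"])
      thus ?thesis by simp
    qed
    finally show "cmod (cis (- (x \<bullet> (\<xi> + h))) * \<phi> x - cis (- (x \<bullet> \<xi>)) * \<phi> x - cis (- (x \<bullet> \<xi>)) * (- \<i> * of_real (x \<bullet> h) * \<phi> x))
      \<le> (norm h)\<^sup>2 * ((norm x)\<^sup>2 * cmod (\<phi> x))" by (simp add: mult_right_mono mult.assoc)
  qed auto
  finally show "cmod (fourier \<phi> (\<xi> + h) - fourier \<phi> \<xi> - ?L h) \<le> ((LINT x|lborel. (norm x)\<^sup>2 * cmod (\<phi> x)) / (2 * pi)) * (norm h)\<^sup>2"
    by (simp add: mult.commute)
qed

lemma partial_deriv_fourier:
  assumes "\<phi> \<in> schwartz"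
  shows "partial_deriv i (fourier \<phi>) = fourier (\<lambda>x. - \<i> * (of_real (x $ i) * \<phi> x))"
proof
  fix \<xi>
  show "partial_deriv i (fourier \<phi>) \<xi> = fourier (\<lambda>x. - \<i> * (of_real (x $ i) * \<phi> x)) \<xi>"
    using partial_deriv_eqI[OF fourier_has_derivative[OF assms], of i \<xi>] exhaust_2[of i]
    by (auto simp: sum_2 axis_def)
qed

lemma fourier_translate:
  assumes "\<phi> \<in> borel_measurable borel"
  shows "fourier (\<lambda>x. \<phi> (x + v)) \<xi> = cis (v \<bullet> \<xi>) * fourier \<phi> \<xi>"
proof -
  have "(LINT x|lborel. cis (- (x \<bullet> \<xi>)) * \<phi> (x + v)) = (LINT x|lborel. cis (v \<bullet> \<xi>) * (cis (- ((v + x) \<bullet> \<xi>)) * \<phi> (v + x)))"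
    by (intro Bochner_Integration.integral_cong) (auto simp: mult.assoc[symmetric] cis_mult inner_add_left add.commute)
  also have "\<dots> = cis (v \<bullet> \<xi>) * (LINT x|lborel. cis (- ((v + x) \<bullet> \<xi>)) * \<phi> (v + x))" by simp
  also have "(LINT x|lborel. cis (- ((v + x) \<bullet> \<xi>)) * \<phi> (v + x)) = (LINT x|lborel. cis (- (x \<bullet> \<xi>)) * \<phi> x)"
    by (rule lborel_integral_translate) (use assms in measurable)
  finally show ?thesis by (simp add: fourier_def)
qed

text \<open>A shift by at most 1 costs a factor 4 in 1 + |x|^2, hence 16 in its square. It provides
  one dominating function for all difference quotients with step at most 1.\<close>

lemma square_weight_shift:
  fixes x y :: "real^2"
  assumes "norm (x - y) \<le> 1"
  shows "1 / (1 + (norm y)\<^sup>2)\<^sup>2 \<le> 16 / (1 + (norm x)\<^sup>2)\<^sup>2"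
proof -
  have "norm x \<le> norm y + 1" using assms norm_triangle_ineq2[of x y] by linarith
  hence "(norm x)\<^sup>2 \<le> (norm y + 1)\<^sup>2" by (intro power_mono) auto
  also have "\<dots> \<le> 2 * (norm y)\<^sup>2 + 2" using sum_squares_ge_zero[of "norm y - 1" 0] by (simp add: power2_eq_square algebra_simps)
  finally have "1 + (norm x)\<^sup>2 \<le> 4 * (1 + (norm y)\<^sup>2)" using zero_le_power2[of "norm y"] unfolding distrib_left by linarith
  hence "(1 + (norm x)\<^sup>2)\<^sup>2 \<le> (4 * (1 + (norm y)\<^sup>2))\<^sup>2" by (intro power_mono) auto
  hence "(1 + (norm x)\<^sup>2)\<^sup>2 \<le> 16 * (1 + (norm y)\<^sup>2)\<^sup>2" by (simp only: power_mult_distrib) simp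
  moreover have "(1 + (norm x)\<^sup>2)\<^sup>2 > 0" "(1 + (norm y)\<^sup>2)\<^sup>2 > 0" by (intro zero_less_power add_pos_nonneg; simp)+
  ultimately show ?thesis by (simp add: field_simps)
qed

text \<open>Differentiates the translation formula at zero, which replaces an integration by parts.\<close>

lemma fourier_partial_deriv:
  assumes \<phi>: "\<phi> \<in> schwartz"
  shows "fourier (partial_deriv i \<phi>) \<xi> = \<i> * (of_real (\<xi> $ i) * fourier \<phi> \<xi>)"
proof -
  define \<tau> where "\<tau> = (\<lambda>n::nat. 1 / real (Suc n))"
  have \<tau>: "\<tau> n > 0" "\<tau> n \<le> 1" for n by (auto simp: \<tau>_def divide_simps)
  have \<tau>0: "\<tau> \<longlonglongrightarrow> 0" unfolding \<tau>_def using LIMSEQ_inverse_real_of_nat by (simp add: inverse_eq_divide)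
  let ?v = "\<lambda>n. \<tau> n *\<^sub>R axis i 1 :: real^2"
  define q where "q = (\<lambda>n x. (\<phi> (x + ?v n) - \<phi> x) /\<^sub>R \<tau> n)"
  obtain C where C: "C > 0" "\<And>x. cmod (partial_deriv i \<phi> x) \<le> C / (1 + (norm x)\<^sup>2) ^ 2"
    using rapidD[OF schwartz_rapid[OF schwartz_partial[OF \<phi>]]] by blast
  have D: "((\<lambda>s. \<phi> (x + s *\<^sub>R axis i 1)) has_vector_derivative partial_deriv i \<phi> (x + s *\<^sub>R axis i 1)) (at s within A)" for x s A
  proof -
    have "((\<lambda>s. x + s *\<^sub>R axis i 1 :: real^2) has_derivative (\<lambda>h. h *\<^sub>R axis i 1)) (at s)"
      by (auto intro!: derivative_eq_intros)
    from has_derivative_compose[OF this iffD1[OF frechet_derivative_works schwartz_differentiable[OF \<phi>]]]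
    have "((\<lambda>s. \<phi> (x + s *\<^sub>R axis i 1)) has_derivative (\<lambda>h. frechet_derivative \<phi> (at (x + s *\<^sub>R axis i 1)) (h *\<^sub>R axis i 1))) (at s)" .
    moreover have "frechet_derivative \<phi> (at y) (h *\<^sub>R axis i 1) = h *\<^sub>R partial_deriv i \<phi> y" for y h
      unfolding partial_deriv_def using schwartz_differentiable[OF \<phi>]
      by (intro linear_scale linear_frechet_derivative)
    ultimately show ?thesis
      unfolding has_vector_derivative_def by (auto intro: has_derivative_at_withinI)
  qed
  \<comment> \<open>The mean value inequality bounds the quotient by the derivative on a segment of
    length at most 1 starting at x, so one integrable function dominates every n.\<close>
  have qb: "cmod (q n x) \<le> C * 16 / (1 + (norm x)\<^sup>2) ^ 2" for n x
  proof -
    have "norm (\<phi> (x + \<tau> n *\<^sub>R axis i 1) - \<phi> (x + 0 *\<^sub>R axis i 1)) \<le> (C * 16 / (1 + (norm x)\<^sup>2) ^ 2) * norm (\<tau> n - 0)"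
    proof (rule differentiable_bound[of "{0..1}"])
      fix s :: real assume s: "s \<in> {0..1}"
      show "((\<lambda>s. \<phi> (x + s *\<^sub>R axis i 1)) has_derivative (\<lambda>h. h *\<^sub>R partial_deriv i \<phi> (x + s *\<^sub>R axis i 1))) (at s within {0..1})"
        using D unfolding has_vector_derivative_def .
      have "norm (x - (x + s *\<^sub>R axis i 1)) \<le> 1" using s by (simp add: norm_axis_1)
      from square_weight_shift[OF this]
      have "C * (1 / (1 + (norm (x + s *\<^sub>R axis i 1))\<^sup>2)\<^sup>2) \<le> C * (16 / (1 + (norm x)\<^sup>2)\<^sup>2)"
        using C(1) by (intro mult_left_mono) auto
      hence "cmod (partial_deriv i \<phi> (x + s *\<^sub>R axis i 1)) \<le> C * 16 / (1 + (norm x)\<^sup>2) ^ 2"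
        using C(2)[of "x + s *\<^sub>R axis i 1"] by simp
      thus "onorm (\<lambda>h. h *\<^sub>R partial_deriv i \<phi> (x + s *\<^sub>R axis i 1)) \<le> C * 16 / (1 + (norm x)\<^sup>2) ^ 2"
        by (intro onorm_le) (auto simp only: norm_scaleR real_norm_def mult.commute[of "C * 16 / _"] intro: mult_left_mono)
    qed (use \<tau>[of n] in auto)
    thus ?thesis using \<tau>[of n] by (simp add: q_def divide_le_eq inverse_eq_divide)
  qed
  have [measurable]: "\<phi> \<in> borel_measurable borel" "partial_deriv i \<phi> \<in> borel_measurable borel"
    using \<phi> schwartz_partial by auto
  have [measurable]: "q n \<in> borel_measurable borel" for n unfolding q_def by measurable
  have "(\<lambda>n. LINT x|lborel. cis (- (x \<bullet> \<xi>)) * q n x) \<longlonglongrightarrow> (LINT x|lborel. cis (- (x \<bullet> \<xi>)) * partial_deriv i \<phi> x)"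
  proof (rule integral_dominated_convergence)
    show "integrable lborel (\<lambda>x::real^2. (C * 16) * (1 / (1 + (norm x)\<^sup>2) ^ 2))"
      by (intro integrable_mult_right integrable_inverse_square_weight)
    show "AE x in lborel. norm (cis (- (x \<bullet> \<xi>)) * q n x) \<le> (C * 16) * (1 / (1 + (norm x)\<^sup>2) ^ 2)" for n
      using qb by (simp add: norm_mult)
    show "AE x in lborel. (\<lambda>n. cis (- (x \<bullet> \<xi>)) * q n x) \<longlonglongrightarrow> cis (- (x \<bullet> \<xi>)) * partial_deriv i \<phi> x"
    proof (intro AE_I2 tendsto_mult tendsto_const)
      fix x
      have lim: "((\<lambda>h. norm (\<phi> (x + (0 + h) *\<^sub>R axis i 1) - \<phi> (x + 0 *\<^sub>R axis i 1) - h *\<^sub>R partial_deriv i \<phi> (x + 0 *\<^sub>R axis i 1)) / norm h) \<longlongrightarrow> 0) (at 0)"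
        using D[of x 0 UNIV] unfolding has_vector_derivative_def has_derivative_at by blast
      have "filterlim \<tau> (at 0) sequentially"
        unfolding filterlim_at using \<tau>0 \<tau>(1) by (auto simp: less_imp_neq intro!: always_eventually) (metis less_irrefl)
      from filterlim_compose[OF lim this]
      have "(\<lambda>n. norm (\<phi> (x + ?v n) - \<phi> x - \<tau> n *\<^sub>R partial_deriv i \<phi> x) / norm (\<tau> n)) \<longlonglongrightarrow> 0" by simp
      moreover have "norm (\<phi> (x + ?v n) - \<phi> x - \<tau> n *\<^sub>R partial_deriv i \<phi> x) / norm (\<tau> n) = norm (q n x - partial_deriv i \<phi> x)" for n
      proof -
        have "q n x - partial_deriv i \<phi> x = (\<phi> (x + ?v n) - \<phi> x - \<tau> n *\<^sub>R partial_deriv i \<phi> x) /\<^sub>R \<tau> n"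
          using \<tau>(1)[of n] by (simp add: q_def scaleR_diff_right)
        thus ?thesis using \<tau>(1)[of n] by (simp add: divide_inverse mult.commute)
      qed
      ultimately have "(\<lambda>n. norm (q n x - partial_deriv i \<phi> x)) \<longlonglongrightarrow> 0" by simp
      thus "(\<lambda>n. q n x) \<longlonglongrightarrow> partial_deriv i \<phi> x"
        by (simp add: tendsto_norm_zero_iff LIM_zero_iff)
    qed
  qed simp_all
  moreover have "(LINT x|lborel. cis (- (x \<bullet> \<xi>)) * q n x) = of_real (2 * pi) * (((cis (\<tau> n * \<xi> $ i) - 1) / \<tau> n) * fourier \<phi> \<xi>)" for n
  proof -
    have "integrable lborel (\<lambda>x. \<phi> (?v n + 1 *\<^sub>R x))"
      by (rule lborel_integrable_affine[OF schwartz_integrable[OF \<phi>]]) simp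
    hence i1: "integrable lborel (\<lambda>x. cis (- (x \<bullet> \<xi>)) * \<phi> (x + ?v n))"
      by (intro integrable_cis_mult) (auto simp: add.commute)
    have "(LINT x|lborel. cis (- (x \<bullet> \<xi>)) * q n x)
       = (LINT x|lborel. (cis (- (x \<bullet> \<xi>)) * \<phi> (x + ?v n) - cis (- (x \<bullet> \<xi>)) * \<phi> x) /\<^sub>R \<tau> n)"
      by (intro Bochner_Integration.integral_cong) (auto simp: q_def algebra_simps)
    also have "\<dots> = (LINT x|lborel. cis (- (x \<bullet> \<xi>)) * \<phi> (x + ?v n) - cis (- (x \<bullet> \<xi>)) * \<phi> x) /\<^sub>R \<tau> n"
      by simp
    also have "(LINT x|lborel. cis (- (x \<bullet> \<xi>)) * \<phi> (x + ?v n) - cis (- (x \<bullet> \<xi>)) * \<phi> x)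
       = of_real (2 * pi) * fourier (\<lambda>x. \<phi> (x + ?v n)) \<xi> - of_real (2 * pi) * fourier \<phi> \<xi>"
      unfolding fourier_def by (simp add: Bochner_Integration.integral_diff[OF i1 schwartz_fourier_integrable[OF \<phi>]])
    also have "fourier (\<lambda>x. \<phi> (x + ?v n)) \<xi> = cis (\<tau> n * \<xi> $ i) * fourier \<phi> \<xi>"
      by (subst fourier_translate) (auto simp: inner_axis')
    finally show ?thesis using \<tau>(1)[of n] by (simp add: scaleR_conv_of_real divide_inverse algebra_simps)
  qed
  moreover have "(\<lambda>n. of_real (2 * pi) * (((cis (\<tau> n * \<xi> $ i) - 1) / \<tau> n) * fourier \<phi> \<xi>)) \<longlonglongrightarrow> of_real (2 * pi) * ((\<i> * \<xi> $ i) * fourier \<phi> \<xi>)"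
  proof (intro tendsto_mult tendsto_const)
    have "cmod ((cis (\<tau> n * \<xi> $ i) - 1) / \<tau> n - \<i> * \<xi> $ i) \<le> \<tau> n * (\<xi> $ i)\<^sup>2" for n
    proof -
      have "(cis (\<tau> n * \<xi> $ i) - 1) / \<tau> n - \<i> * \<xi> $ i = (cis (0 + \<tau> n * \<xi> $ i) - cis 0 - \<i> * of_real (\<tau> n * \<xi> $ i) * cis 0) / \<tau> n"
        using \<tau>(1)[of n] by (simp add: field_simps)
      hence "cmod ((cis (\<tau> n * \<xi> $ i) - 1) / \<tau> n - \<i> * \<xi> $ i) = cmod (cis (0 + \<tau> n * \<xi> $ i) - cis 0 - \<i> * of_real (\<tau> n * \<xi> $ i) * cis 0) / \<tau> n"
        using \<tau>(1)[of n] by (simp only: norm_divide norm_of_real abs_of_pos)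
      also have "\<dots> \<le> ((\<tau> n * \<xi> $ i)\<^sup>2 / 2) / \<tau> n"
        using \<tau>(1)[of n] by (intro divide_right_mono cis_taylor1) auto
      also have "\<dots> \<le> \<tau> n * (\<xi> $ i)\<^sup>2" using \<tau>(1)[of n] by (simp add: power2_eq_square field_simps)
      finally show ?thesis .
    qed
    moreover have "(\<lambda>n. \<tau> n * (\<xi> $ i)\<^sup>2) \<longlonglongrightarrow> 0" using tendsto_mult_left_zero[OF \<tau>0] .
    ultimately have "(\<lambda>n. (cis (\<tau> n * \<xi> $ i) - 1) / \<tau> n - \<i> * \<xi> $ i) \<longlonglongrightarrow> 0"
      by - (rule Lim_null_comparison[rotated], assumption, simp add: always_eventually)
    thus "(\<lambda>n. (cis (\<tau> n * \<xi> $ i) - 1) / \<tau> n) \<longlonglongrightarrow> \<i> * \<xi> $ i" by (simp add: LIM_zero_iff)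
  qed
  ultimately have "(LINT x|lborel. cis (- (x \<bullet> \<xi>)) * partial_deriv i \<phi> x) = of_real (2 * pi) * ((\<i> * \<xi> $ i) * fourier \<phi> \<xi>)"
    by (simp only: LIMSEQ_unique)
  thus ?thesis by (simp add: fourier_def[of "partial_deriv i \<phi>"])
qed

text \<open>(1 + |\<xi>|^2)^k times the transform of \<phi> is the transform of (1 - \<Delta>)^k
  \<phi>, again a Schwartz function, and transforms are bounded by the L^1 norm.\<close>

lemma rapid_fourier:
  assumes "\<phi> \<in> schwartz" shows "rapid (fourier \<phi>)"
proof (rule rapidI)
  have *: "\<exists>\<psi>\<in>schwartz. \<forall>\<xi>. (1 + (norm \<xi>)\<^sup>2) ^ k * fourier \<phi> \<xi> = fourier \<psi> \<xi>" for k
  proof (induction k)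
    case 0
    show ?case using assms by auto
  next
    case (Suc k)
    then obtain \<psi> where \<psi>: "\<psi> \<in> schwartz" "\<And>\<xi>. (1 + (norm \<xi>)\<^sup>2) ^ k * fourier \<phi> \<xi> = fourier \<psi> \<xi>" by blast
    let ?d = "\<lambda>i. partial_deriv i (partial_deriv i \<psi>)"
    let ?\<chi> = "\<lambda>x. \<psi> x + ((-1) * ?d 1 x + (-1) * ?d 2 x)"
    have d: "?d i \<in> schwartz" for i by (intro schwartz_partial \<psi>)
    have \<chi>: "?\<chi> \<in> schwartz" by (intro schwartz_add schwartz_cmult d \<psi>)
    have "fourier ?\<chi> \<xi> = fourier \<psi> \<xi> - fourier (?d 1) \<xi> - fourier (?d 2) \<xi>" for \<xi>
      using fourier_add[OF \<psi>(1) schwartz_add[OF schwartz_cmult schwartz_cmult, OF d d], of "-1" 1 "-1" 2 \<xi>]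
        fourier_add[OF schwartz_cmult schwartz_cmult, OF d d, of "-1" 1 "-1" 2 \<xi>]
      by (simp only: fourier_cmult) simp
    hence "fourier ?\<chi> \<xi> = of_real (1 + ((\<xi> $ 1)\<^sup>2 + (\<xi> $ 2)\<^sup>2)) * fourier \<psi> \<xi>" for \<xi>
      by (simp add: fourier_partial_deriv schwartz_partial \<psi> power2_eq_square algebra_simps)
    hence "fourier ?\<chi> \<xi> = (1 + (norm \<xi>)\<^sup>2) * fourier \<psi> \<xi>" for \<xi>
      by (simp only: norm_vec2 of_real_add of_real_1 of_real_power[symmetric])
    hence "(1 + (norm \<xi>)\<^sup>2) ^ Suc k * fourier \<phi> \<xi> = fourier ?\<chi> \<xi>" for \<xi>
      by (simp add: \<psi>(2)[symmetric] mult.assoc)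
    thus ?case using \<chi> by blast
  qed
  fix k
  obtain \<psi> where \<psi>: "\<psi> \<in> schwartz" "\<And>\<xi>. (1 + (norm \<xi>)\<^sup>2) ^ k * fourier \<phi> \<xi> = fourier \<psi> \<xi>" using *[of k] by blast
  have "(1 + (norm \<xi>)\<^sup>2) ^ k * cmod (fourier \<phi> \<xi>) \<le> (LINT x|lborel. cmod (\<psi> x)) / (2 * pi)" for \<xi>
  proof -
    have "(1 + (norm \<xi>)\<^sup>2) ^ k * cmod (fourier \<phi> \<xi>) = cmod (of_real ((1 + (norm \<xi>)\<^sup>2) ^ k) * fourier \<phi> \<xi>)"
      by (simp only: norm_mult norm_of_real) (simp add: add_nonneg_nonneg)
    also have "\<dots> = cmod (fourier \<psi> \<xi>)" using \<psi>(2)[of \<xi>] by simp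
    finally show ?thesis using fourier_bound[OF \<psi>(1), of \<xi>] by simp
  qed
  thus "\<exists>C. \<forall>\<xi>. (1 + (norm \<xi>)\<^sup>2) ^ k * cmod (fourier \<phi> \<xi>) \<le> C" by blast
qed

lemma schwartz_fourier:
  assumes "\<phi> \<in> schwartz" shows "fourier \<phi> \<in> schwartz"
proof (rule schwartz_coinduct)
  let ?S = "fourier ` schwartz"
  show "fourier \<phi> \<in> ?S" using assms by blast
  fix f assume "f \<in> ?S"
  then obtain \<psi> where f: "f = fourier \<psi>" and \<psi>: "\<psi> \<in> schwartz" by blast
  show "f differentiable (at x)" for x using fourier_has_derivative[OF \<psi>] differentiableI unfolding f by blast
  show "rapid f" unfolding f by (rule rapid_fourier[OF \<psi>])
  show "partial_deriv i f \<in> ?S" for i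
    unfolding f partial_deriv_fourier[OF \<psi>] by (intro imageI schwartz_cmult schwartz_coord_mult \<psi>)
qed

lemma inv_fourier_eq: "inv_fourier \<phi> x = fourier \<phi> (- x)"
  by (simp add: inv_fourier_def fourier_def inner_commute)

lemma schwartz_reflect: "\<phi> \<in> schwartz \<Longrightarrow> (\<lambda>x. \<phi> (- x)) \<in> schwartz"
  using schwartz_comp_orthogonal[of uminus \<phi>] by (simp add: orthogonal_transformation_neg comp_def orthogonal_transformation_def linear_iff)

lemma schwartz_inv_fourier: "\<phi> \<in> schwartz \<Longrightarrow> inv_fourier \<phi> \<in> schwartz"
  using schwartz_reflect[OF schwartz_fourier] by (simp add: inv_fourier_eq[abs_def])

lemma fourier_reflect:
  assumes [measurable]: "\<phi> \<in> borel_measurable borel"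
  shows "fourier (\<lambda>x. \<phi> (- x)) \<xi> = fourier \<phi> (- \<xi>)"
  using lborel_integral_reflect[of "\<lambda>x. cis (- (x \<bullet> - \<xi>)) * \<phi> x"]
  by (simp add: fourier_def)

lemma lborel_integrable_mult_pair:
  fixes f :: "'a::euclidean_space \<Rightarrow> 'c::{real_normed_field, banach, second_countable_topology}"
    and g :: "'b::euclidean_space \<Rightarrow> 'c"
  assumes f: "integrable lborel f" and g: "integrable lborel g"
  shows "integrable (lborel \<Otimes>\<^sub>M lborel) (\<lambda>(x, y). f x * g y)"
proof (rule lborel_pair.Fubini_integrable)
  show "(\<lambda>(x, y). f x * g y) \<in> borel_measurable (lborel \<Otimes>\<^sub>M lborel)"
    using f g by measurable
qed (use f g in \<open>auto simp: norm_mult\<close>)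

text \<open>The double integral behind the formula does not converge absolutely. The factor
  e^(-\<epsilon> |\<xi>|^2) makes Fubini applicable and turns the inner integral into a Gaussian
  kernel of width sqrt(\<epsilon>), an approximate identity as \<epsilon> tends to 0.\<close>

lemma fourier_inversion:
  assumes \<phi>: "\<phi> \<in> schwartz"
  shows "inv_fourier (fourier \<phi>) = \<phi>"
proof
  fix x :: "real^2"
  have m[measurable]: "\<phi> \<in> borel_measurable borel" "fourier \<phi> \<in> borel_measurable borel"
    using \<phi> schwartz_fourier by auto
  define \<epsilon> where "\<epsilon> = (\<lambda>n::nat. 1 / real (Suc n))"
  have \<epsilon>: "\<epsilon> n > 0" for n by (auto simp: \<epsilon>_def)
  have \<epsilon>0: "\<epsilon> \<longlonglongrightarrow> 0" unfolding \<epsilon>_def using LIMSEQ_inverse_real_of_nat by (simp add: inverse_eq_divide)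
  define g where "g = (\<lambda>n (\<xi>::real^2). complex_of_real (exp (- (\<epsilon> n * (norm \<xi>)\<^sup>2))))"
  define I where "I = (\<lambda>n. LINT \<xi>|lborel. g n \<xi> * (cis (x \<bullet> \<xi>) * fourier \<phi> \<xi>))"
  have lim1: "I \<longlonglongrightarrow> (LINT \<xi>|lborel. cis (x \<bullet> \<xi>) * fourier \<phi> \<xi>)"
    unfolding I_def
  proof (rule integral_dominated_convergence)
    show "integrable lborel (\<lambda>\<xi>. cmod (fourier \<phi> \<xi>))"
      by (intro integrable_norm schwartz_integrable schwartz_fourier \<phi>)
    show "AE \<xi> in lborel. norm (g n \<xi> * (cis (x \<bullet> \<xi>) * fourier \<phi> \<xi>)) \<le> cmod (fourier \<phi> \<xi>)" for n
      using \<epsilon>[of n] by (auto simp: g_def norm_mult mult_left_le_one_le)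
    show "AE \<xi> in lborel. (\<lambda>n. g n \<xi> * (cis (x \<bullet> \<xi>) * fourier \<phi> \<xi>)) \<longlonglongrightarrow> cis (x \<bullet> \<xi>) * fourier \<phi> \<xi>"
    proof (rule AE_I2)
      fix \<xi> :: "real^2"
      have "(\<lambda>n. g n \<xi>) \<longlonglongrightarrow> of_real (exp (- (0 * (norm \<xi>)\<^sup>2)))"
        unfolding g_def by (intro tendsto_intros \<epsilon>0)
      hence "(\<lambda>n. g n \<xi>) \<longlonglongrightarrow> 1" by simp
      from tendsto_mult[OF this tendsto_const[of "cis (x \<bullet> \<xi>) * fourier \<phi> \<xi>"]]
      show "(\<lambda>n. g n \<xi> * (cis (x \<bullet> \<xi>) * fourier \<phi> \<xi>)) \<longlonglongrightarrow> cis (x \<bullet> \<xi>) * fourier \<phi> \<xi>" by simp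
    qed
  qed (auto simp: g_def)
  have I_eq: "I n = 2 * (LINT z|lborel. of_real (exp (- (norm z)\<^sup>2)) * \<phi> (x + (2 * sqrt (\<epsilon> n)) *\<^sub>R z))" for n
  proof -
    let ?G = "\<lambda>(\<xi>, y). (g n \<xi> * cis (x \<bullet> \<xi>)) * (cis (- (y \<bullet> \<xi>)) * \<phi> y)"
    have gi: "integrable lborel (g n)"
      unfolding g_def complex_of_real_integrable_eq by (rule gauss_plane_real(1)[OF \<epsilon>])
    have int2: "integrable (lborel \<Otimes>\<^sub>M lborel) ?G"
    proof (rule Bochner_Integration.integrable_bound)
      show "integrable (lborel \<Otimes>\<^sub>M lborel) (\<lambda>(\<xi>, y). cmod (g n \<xi>) * cmod (\<phi> y))"
        by (rule lborel_integrable_mult_pair) (intro integrable_norm gi schwartz_integrable \<phi>)+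
    qed (auto simp: norm_mult g_def)
    have "I n = (LINT \<xi>|lborel. LINT y|lborel. (g n \<xi> * cis (x \<bullet> \<xi>)) * (cis (- (y \<bullet> \<xi>)) * \<phi> y)) / of_real (2 * pi)"
      unfolding I_def fourier_def by (simp add: mult.assoc)
    also have "(LINT \<xi>|lborel. LINT y|lborel. (g n \<xi> * cis (x \<bullet> \<xi>)) * (cis (- (y \<bullet> \<xi>)) * \<phi> y))
       = (LINT y|lborel. LINT \<xi>|lborel. (g n \<xi> * cis (x \<bullet> \<xi>)) * (cis (- (y \<bullet> \<xi>)) * \<phi> y))"
      using lborel_pair.Fubini_integral[OF int2] by simp
    also have "\<dots> = (LINT y|lborel. of_real (pi / \<epsilon> n * exp (- (norm (x - y))\<^sup>2 / (4 * \<epsilon> n))) * \<phi> y)"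
    proof (intro Bochner_Integration.integral_cong refl)
      fix y
      have "(LINT \<xi>|lborel. (g n \<xi> * cis (x \<bullet> \<xi>)) * (cis (- (y \<bullet> \<xi>)) * \<phi> y))
        = (LINT \<xi>|lborel. (cis (\<xi> \<bullet> (x - y)) * g n \<xi>) * \<phi> y)"
      proof (intro Bochner_Integration.integral_cong refl)
        fix \<xi>
        have "cis (\<xi> \<bullet> (x - y)) = cis (x \<bullet> \<xi>) * cis (- (y \<bullet> \<xi>))"
          by (simp add: cis_mult inner_diff_right inner_commute[of \<xi>])
        thus "(g n \<xi> * cis (x \<bullet> \<xi>)) * (cis (- (y \<bullet> \<xi>)) * \<phi> y) = (cis (\<xi> \<bullet> (x - y)) * g n \<xi>) * \<phi> y"
          by (simp only: mult_ac)
      qed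
      also have "\<dots> = (LINT \<xi>|lborel. cis (\<xi> \<bullet> (x - y)) * g n \<xi>) * \<phi> y" by simp
      finally show "(LINT \<xi>|lborel. (g n \<xi> * cis (x \<bullet> \<xi>)) * (cis (- (y \<bullet> \<xi>)) * \<phi> y))
        = of_real (pi / \<epsilon> n * exp (- (norm (x - y))\<^sup>2 / (4 * \<epsilon> n))) * \<phi> y"
        unfolding g_def by (simp only: gauss_plane(2)[OF \<epsilon>])
    qed
    \<comment> \<open>The substitution y = x + 2 sqrt(\<epsilon>) z turns the kernel into
      e^(-|z|^2). The Jacobian 4 \<epsilon> cancels 1 / \<epsilon>, and 4 \<pi> / (2 \<pi>) is the
      factor 2 in \<open>I_eq\<close>.\<close>
    also have "\<dots> = \<bar>2 * sqrt (\<epsilon> n)\<bar> ^ DIM(real^2) *\<^sub>R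
       (LINT z|lborel. of_real (pi / \<epsilon> n * exp (- (norm (x - (x + (2 * sqrt (\<epsilon> n)) *\<^sub>R z)))\<^sup>2 / (4 * \<epsilon> n))) * \<phi> (x + (2 * sqrt (\<epsilon> n)) *\<^sub>R z))"
      by (rule lborel_integral_affine) (use \<epsilon>[of n] in \<open>measurable, simp\<close>)
    also have "\<dots> = \<bar>2 * sqrt (\<epsilon> n)\<bar> ^ DIM(real^2) *\<^sub>R (LINT z|lborel. of_real (pi / \<epsilon> n) * (of_real (exp (- (norm z)\<^sup>2)) * \<phi> (x + (2 * sqrt (\<epsilon> n)) *\<^sub>R z)))"
      using \<epsilon>[of n] by (simp add: power_mult_distrib mult.assoc)
    also have "\<dots> = of_real (4 * pi) * (LINT z|lborel. of_real (exp (- (norm z)\<^sup>2)) * \<phi> (x + (2 * sqrt (\<epsilon> n)) *\<^sub>R z))"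
      using \<epsilon>[of n] by (simp add: power_mult_distrib scaleR_conv_of_real)
    finally show ?thesis by simp
  qed
  obtain C where C: "\<And>x. cmod (\<phi> x) \<le> C" using rapidD[OF schwartz_rapid[OF \<phi>], of 0] by auto
  have lim2: "(\<lambda>n. LINT z|lborel. of_real (exp (- (norm z)\<^sup>2)) * \<phi> (x + (2 * sqrt (\<epsilon> n)) *\<^sub>R z)) \<longlonglongrightarrow> (LINT z|lborel. of_real (exp (- (norm (z::real^2))\<^sup>2)) * \<phi> x)"
  proof (rule integral_dominated_convergence)
    show "integrable lborel (\<lambda>z::real^2. C * exp (- (norm z)\<^sup>2))"
      using gauss_plane_real(1)[of 1] by (intro integrable_mult_right) simp
    show "AE z in lborel. norm (of_real (exp (- (norm z)\<^sup>2)) * \<phi> (x + (2 * sqrt (\<epsilon> n)) *\<^sub>R z)) \<le> C * exp (- (norm z)\<^sup>2)" for n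
      by (auto simp: norm_mult mult.commute[of C] intro!: mult_left_mono C)
    show "AE z in lborel. (\<lambda>n. of_real (exp (- (norm z)\<^sup>2)) * \<phi> (x + (2 * sqrt (\<epsilon> n)) *\<^sub>R z)) \<longlonglongrightarrow> of_real (exp (- (norm z)\<^sup>2)) * \<phi> x"
    proof (intro AE_I2 tendsto_mult tendsto_const)
      fix z :: "real^2"
      have "(\<lambda>n. x + (2 * sqrt (\<epsilon> n)) *\<^sub>R z) \<longlonglongrightarrow> x + (2 * sqrt 0) *\<^sub>R z" by (intro tendsto_intros \<epsilon>0)
      hence "(\<lambda>n. x + (2 * sqrt (\<epsilon> n)) *\<^sub>R z) \<longlonglongrightarrow> x" by simp
      moreover have "isCont \<phi> x" using schwartz_continuous[OF \<phi>, of UNIV] by (simp add: continuous_on_eq_continuous_at)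
      ultimately show "(\<lambda>n. \<phi> (x + (2 * sqrt (\<epsilon> n)) *\<^sub>R z)) \<longlonglongrightarrow> \<phi> x" by (rule isCont_tendsto_compose[rotated])
    qed
  qed auto
  have "(LINT z|lborel. of_real (exp (- (norm (z::real^2))\<^sup>2)) * \<phi> x) = of_real pi * \<phi> x"
  proof -
    have "(LINT z|lborel. complex_of_real (exp (- (norm (z::real^2))\<^sup>2))) = of_real pi"
      using gauss_plane_real(2)[of 1] by (subst integral_complex_of_real) simp
    thus ?thesis by simp
  qed
  from tendsto_mult[OF tendsto_const[of 2] lim2[unfolded this]]
  have "I \<longlonglongrightarrow> 2 * (of_real pi * \<phi> x)" by (simp only: I_eq[abs_def])
  with lim1 have "(LINT \<xi>|lborel. cis (x \<bullet> \<xi>) * fourier \<phi> \<xi>) = 2 * (of_real pi * \<phi> x)"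
    by (rule LIMSEQ_unique)
  thus "inv_fourier (fourier \<phi>) x = \<phi> x" by (simp add: inv_fourier_def)
qed

lemma fourier_inv_fourier:
  assumes \<phi>: "\<phi> \<in> schwartz"
  shows "fourier (inv_fourier \<phi>) = \<phi>"
proof
  fix x
  have "fourier (inv_fourier \<phi>) x = fourier (\<lambda>\<xi>. fourier \<phi> (- \<xi>)) x" by (simp add: inv_fourier_eq[abs_def])
  also have "\<dots> = fourier (fourier \<phi>) (- x)"
    by (rule fourier_reflect) (use schwartz_fourier[OF \<phi>] in auto)
  also have "\<dots> = inv_fourier (fourier \<phi>) x" by (simp add: inv_fourier_eq)
  finally show "fourier (inv_fourier \<phi>) x = \<phi> x" by (simp add: fourier_inversion[OF \<phi>])
qed

section \<open>Distributions given by their Fourier transform\<close>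

lemma schwartz_box_bump:
  fixes c r :: "real^2"
  shows "(\<lambda>x. complex_of_real (exp (- ((norm x)\<^sup>2 + real n * (((x $ 1 - c $ 1) / r $ 1)\<^sup>2 ^ n + ((x $ 2 - c $ 2) / r $ 2)\<^sup>2 ^ n))))) \<in> schwartz"
proof (rule schwartz_exp_poly)
  have "(\<lambda>x. (complex_of_real (x $ 1) ^ 2 + complex_of_real (x $ 2) ^ 2) + of_nat n *
      (((of_real (1 / r $ 1) * (of_real (x $ 1) + of_real (- c $ 1)))\<^sup>2) ^ n + ((of_real (1 / r $ 2) * (of_real (x $ 2) + of_real (- c $ 2)))\<^sup>2) ^ n)) \<in> polys"
    by (intro polys.add polys.mult polys_power polys.const polys.coord)
  thus "(\<lambda>x. complex_of_real ((norm x)\<^sup>2 + real n * (((x $ 1 - c $ 1) / r $ 1)\<^sup>2 ^ n + ((x $ 2 - c $ 2) / r $ 2)\<^sup>2 ^ n))) \<in> polys"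
    by (simp only: norm_vec2) simp
next
  \<comment> \<open>The term |x|^2 supplies the decay; the even powers only make the function
    smaller.\<close>
  show "rapid (\<lambda>x. complex_of_real (exp (- ((norm x)\<^sup>2 + real n * (((x $ 1 - c $ 1) / r $ 1)\<^sup>2 ^ n + ((x $ 2 - c $ 2) / r $ 2)\<^sup>2 ^ n)))))"
  proof (rule rapid_dominated)
    show "rapid (\<lambda>x. complex_of_real (exp (- (1 * (norm x)\<^sup>2))))" by (rule rapid_gaussian) simp
    show "cmod (complex_of_real (exp (- ((norm x)\<^sup>2 + real n * (((x $ 1 - c $ 1) / r $ 1)\<^sup>2 ^ n + ((x $ 2 - c $ 2) / r $ 2)\<^sup>2 ^ n)))))
      \<le> 1 * (1 + (norm x)\<^sup>2) ^ 0 * cmod (complex_of_real (exp (- (1 * (norm x)\<^sup>2))))" for x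
      by (simp add: add_nonneg_nonneg)
  qed
qed

lemma exp_neg_power_limit:
  fixes y :: real
  shows "(\<lambda>n. exp (- (real n * (y\<^sup>2) ^ n))) \<longlonglongrightarrow> (if \<bar>y\<bar> < 1 then 1 else 0)"
proof (cases "\<bar>y\<bar> < 1")
  case True
  hence "norm (y\<^sup>2) < 1" by (simp add: abs_square_less_1)
  hence "(\<lambda>n. real n * (y\<^sup>2) ^ n) \<longlonglongrightarrow> 0" by (rule powser_times_n_limit_0)
  from tendsto_exp[OF tendsto_minus[OF this]] True show ?thesis by simp
next
  case False
  hence "1 \<le> y\<^sup>2" by (simp add: not_less abs_le_square_iff[of 1 y, simplified])
  hence "real n * (y\<^sup>2) ^ n \<ge> real n" for n by (simp add: mult_le_cancel_left1 one_le_power)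
  hence b: "exp (- (real n * (y\<^sup>2) ^ n)) \<le> exp (- real n)" for n by simp
  have "(\<lambda>n. exp (- real n)) \<longlonglongrightarrow> 0"
    by (rule filterlim_compose[OF exp_at_bot]) (simp add: filterlim_uminus_at_bot filterlim_real_sequentially)
  hence "(\<lambda>n. exp (- (real n * (y\<^sup>2) ^ n))) \<longlonglongrightarrow> 0"
    by (rule tendsto_sandwich[OF _ _ tendsto_const, rotated 2]) (use b in auto)
  thus ?thesis using False by simp
qed

text \<open>
  Since \<open>e^(- n y^(2n))\<close> tends to the indicator of \<open>|y| < 1\<close>, indicators of boxes are dominated
  limits of Schwartz functions, and no compactly supported bump functions are needed.
\<close>

lemma AE_zero_if_schwartz_integrals_zero:
  assumes d[measurable]: "d \<in> borel_measurable borel"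
    and int: "\<And>\<phi>. \<phi> \<in> schwartz \<Longrightarrow> integrable lborel (\<lambda>x. d x * \<phi> x)"
    and zero: "\<And>\<phi>. \<phi> \<in> schwartz \<Longrightarrow> (LINT x|lborel. d x * \<phi> x) = 0"
  shows "AE x in lborel. d x = (0::complex)"
proof -
  define e where "e = (\<lambda>x::real^2. complex_of_real (exp (- (norm x)\<^sup>2)))"
  \<comment> \<open>d itself need not be integrable. Its product with a Gaussian is, because
    Gaussians are Schwartz functions, and no information is lost, because they have no
    zeros.\<close>
  define h where "h = (\<lambda>x. d x * e x)"
  have e: "e \<in> schwartz" using schwartz_gaussian[of 1] by (simp add: e_def)
  have hi: "integrable lborel h" unfolding h_def by (rule int[OF e])
  have h0: "(LINT x|lborel. h x) = 0" unfolding h_def by (rule zero[OF e])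
  have hm[measurable]: "h \<in> borel_measurable borel" using hi by auto
  have si: "set_integrable lborel A h" if "A \<in> sets lborel" for A
    unfolding set_integrable_def using that hi by (rule integrable_mult_indicator)
  have box: "(LINT x:box a b|lborel. h x) = 0" for a b
  proof (cases "box a b = {}")
    case True thus ?thesis by (simp add: set_lebesgue_integral_def)
  next
    case False
    hence ab: "a $ i < b $ i" for i by (simp add: interval_ne_empty_cart)
    define c where "c = (1/2) *\<^sub>R (a + b)"
    define r where "r = (1/2) *\<^sub>R (b - a)"
    define k where "k = (\<lambda>n (x::real^2). exp (- (real n * (((x $ 1 - c $ 1) / r $ 1)\<^sup>2 ^ n))) * exp (- (real n * (((x $ 2 - c $ 2) / r $ 2)\<^sup>2 ^ n))))"
    have r: "r $ i > 0" for i using ab[of i] by (simp add: r_def)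
    have "(\<lambda>n. LINT x|lborel. h x * of_real (k n x)) \<longlonglongrightarrow> (LINT x|lborel. indicator (box a b) x *\<^sub>R h x)"
    proof (rule integral_dominated_convergence)
      show "integrable lborel (\<lambda>x. cmod (h x))" using hi by auto
      show "AE x in lborel. norm (h x * of_real (k n x)) \<le> cmod (h x)" for n
        by (auto simp: k_def norm_mult mult_left_le mult_le_one)
      show "AE x in lborel. (\<lambda>n. h x * of_real (k n x)) \<longlonglongrightarrow> indicator (box a b) x *\<^sub>R h x"
      proof (rule AE_I2)
        fix x
        have less: "\<bar>(x $ i - c $ i) / r $ i\<bar> < 1 \<longleftrightarrow> a $ i < x $ i \<and> x $ i < b $ i" for i
          using r[of i] by (auto simp: abs_less_iff divide_less_eq minus_less_iff less_divide_eq c_def r_def field_simps)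
        have "(\<lambda>n. k n x) \<longlonglongrightarrow> (if \<bar>(x $ 1 - c $ 1) / r $ 1\<bar> < 1 then 1 else 0) * (if \<bar>(x $ 2 - c $ 2) / r $ 2\<bar> < 1 then 1 else 0)"
          unfolding k_def by (intro tendsto_mult exp_neg_power_limit)
        also have "(if \<bar>(x $ 1 - c $ 1) / r $ 1\<bar> < 1 then 1 else 0) * (if \<bar>(x $ 2 - c $ 2) / r $ 2\<bar> < 1 then 1 else 0) = (indicator (box a b) x :: real)"
          unfolding less by (auto simp: indicator_def mem_box_cart forall_2)
        finally have "(\<lambda>n. h x * of_real (k n x)) \<longlonglongrightarrow> h x * of_real (indicator (box a b) x)"
          by (intro tendsto_intros)
        thus "(\<lambda>n. h x * of_real (k n x)) \<longlonglongrightarrow> indicator (box a b) x *\<^sub>R h x"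
          by (simp add: scaleR_conv_of_real mult.commute)
      qed
    qed (auto simp: k_def)
    moreover have "(LINT x|lborel. h x * of_real (k n x)) = 0" for n
    proof -
      \<comment> \<open>The Gaussian inside h and the two cutoff factors combine into one Schwartz
        function, against which d integrates to 0.\<close>
      have "h x * of_real (k n x) = d x * complex_of_real (exp (- ((norm x)\<^sup>2 + real n * (((x $ 1 - c $ 1) / r $ 1)\<^sup>2 ^ n + ((x $ 2 - c $ 2) / r $ 2)\<^sup>2 ^ n))))" for x
        by (simp add: h_def e_def k_def distrib_left exp_diff exp_add exp_minus field_simps del: power_divide)
      thus ?thesis by (simp only: zero[OF schwartz_box_bump])
    qed
    ultimately show ?thesis
      by (simp add: set_lebesgue_integral_def LIMSEQ_const_iff)
  qed
  \<comment> \<open>Boxes generate the Borel sets and are stable under intersection, so Dynkin's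
    argument applies; the case of complements uses that the total integral of h is 0.\<close>
  have all: "(LINT x:A|lborel. h x) = 0" if "A \<in> sets borel" for A
  proof -
    let ?E = "range (\<lambda>(a, b). box a b :: (real^2) set)"
    have A: "A \<in> sigma_sets UNIV ?E" using that unfolding borel_eq_box by simp
    have Int: "Int_stable ?E" by (auto simp: Int_stable_def box_Int_box)
    have sets: "sigma_sets UNIV ?E = sets lborel" by (simp add: borel_eq_box)
    show ?thesis
      using Int subset_UNIV[of ?E, folded Pow_UNIV] A
    proof (induction rule: sigma_sets_induct_disjoint)
      case (basic A) thus ?case using box by auto
    next
      case empty thus ?case by (simp add: set_lebesgue_integral_def)
    next
      case (compl A)
      hence A: "A \<in> sets lborel" using sets by simp
      have "(LINT x:A \<union> (UNIV - A)|lborel. h x) = (LINT x:A|lborel. h x) + (LINT x:UNIV - A|lborel. h x)"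
        using A by (intro set_integral_Un si) (auto intro: sets.Diff)
      thus ?case using compl.IH h0 by (simp add: Un_Diff_cancel set_lebesgue_integral_def)
    next
      case (union A)
      hence A: "A i \<in> sets lborel" for i using sets by (simp add: range_subsetD)
      have "(LINT x:(\<Union>i. A i)|lborel. h x) = (\<Sum>i. (LINT x:A i|lborel. h x))"
        using union A by (intro lebesgue_integral_countable_add si) (auto simp: disjoint_family_on_def)
      thus ?case using union by simp
    qed
  qed
  \<comment> \<open>Uniqueness of densities concerns real functions, so h is treated through bounded
    linear images; L will be \<open>Re\<close> and \<open>Im\<close>.\<close>
  have part: "AE x in lborel. L (h x) = (0::real)" if L: "bounded_linear L" for L
  proof (rule density_unique_real)
    show "integrable lborel (\<lambda>x. L (h x))" using integrable_bounded_linear[OF L hi] .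
    show "integrable lborel (\<lambda>x::real^2. 0::real)" by simp
    fix A :: "(real^2) set" assume A: "A \<in> sets lborel"
    have "(LINT x:A|lborel. L (h x)) = (LINT x|lborel. L (indicator A x *\<^sub>R h x))"
      by (simp add: set_lebesgue_integral_def linear_scale[OF bounded_linear.linear[OF L]])
    also have "\<dots> = L (LINT x:A|lborel. h x)"
      unfolding set_lebesgue_integral_def
      by (rule integral_bounded_linear[OF L]) (use si[OF A] in \<open>simp add: set_integrable_def\<close>)
    also have "\<dots> = 0" using all[of A] A linear_0[OF bounded_linear.linear[OF L]] by simp
    finally show "(LINT x:A|lborel. L (h x)) = (LINT x:A|lborel. 0)" by (simp add: set_lebesgue_integral_def)
  qed
  have "AE x in lborel. Re (h x) = 0" "AE x in lborel. Im (h x) = 0"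
    using part bounded_linear_Re bounded_linear_Im by blast+
  thus ?thesis
    by eventually_elim (auto simp: h_def e_def complex_eq_iff)
qed

lemma represents_unique:
  assumes v: "represents v f" and w: "represents w f"
  shows "AE x in lborel. v x = w x"
proof -
  have m: "v \<in> borel_measurable borel" "w \<in> borel_measurable borel"
    using v w by (auto simp: represents_def)
  have "AE x in lborel. v x - w x = 0"
  proof (rule AE_zero_if_schwartz_integrals_zero)
    show "(\<lambda>x. v x - w x) \<in> borel_measurable borel" using m by measurable
    fix \<phi> :: "real^2 \<Rightarrow> complex" assume \<phi>: "\<phi> \<in> schwartz"
    have i: "integrable lborel (\<lambda>x. v x * \<phi> x)" "integrable lborel (\<lambda>x. w x * \<phi> x)"
      using v w \<phi> by (auto simp: represents_def)
    show "integrable lborel (\<lambda>x. (v x - w x) * \<phi> x)"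
      using Bochner_Integration.integrable_diff[OF i] by (simp add: left_diff_distrib)
    have "regular_dist v \<phi> = regular_dist w \<phi>" using v w by (simp add: represents_def)
    hence "(LINT x|lborel. v x * \<phi> x) = (LINT x|lborel. w x * \<phi> x)" using \<phi> by (simp add: regular_dist_def)
    thus "(LINT x|lborel. (v x - w x) * \<phi> x) = 0"
      using Bochner_Integration.integral_diff[OF i] by (simp add: left_diff_distrib)
  qed
  thus ?thesis by eventually_elim simp
qed

lemma represents_fun_of: "represents v f \<Longrightarrow> represents (fun_of f) f"
  unfolding fun_of_def by (rule someI[where P = "\<lambda>v. represents v f"])

lemma fun_of_AE: "represents v f \<Longrightarrow> AE x in lborel. fun_of f x = v x"
  using represents_unique[OF represents_fun_of] .

lemma schwartz_bounded: "\<phi> \<in> schwartz \<Longrightarrow> \<exists>C. \<forall>x. cmod (\<phi> x) \<le> C"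
  using rapidD[OF schwartz_rapid, of \<phi> 0] by (metis div_by_1 power_0)

lemma integrable_mult_schwartz:
  assumes v: "integrable lborel v" and \<phi>: "\<phi> \<in> schwartz"
  shows "integrable lborel (\<lambda>x. v x * \<phi> x)"
proof -
  obtain C where C: "\<And>x. cmod (\<phi> x) \<le> C" using schwartz_bounded[OF \<phi>] by blast
  have "integrable lborel (\<lambda>x. \<phi> x * v x)"
    by (rule integrable_mult_bounded[OF v, of \<phi> C]) (use \<phi> C in auto)
  thus ?thesis by (simp only: mult.commute)
qed

section \<open>Integrable functions on the Fourier side and the distributions they define\<close>

lemma fourier_measurable [measurable]:
  assumes [measurable]: "v \<in> borel_measurable borel"
  shows "fourier v \<in> borel_measurable borel" "inv_fourier v \<in> borel_measurable borel"
  unfolding fourier_def[abs_def] inv_fourier_def[abs_def] by measurable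

lemma fourier_L1_bound:
  shows "cmod (fourier v x) \<le> (LINT x|lborel. cmod (v x)) / (2 * pi)"
    and "cmod (inv_fourier v x) \<le> (LINT x|lborel. cmod (v x)) / (2 * pi)"
  using integral_norm_bound[of lborel "\<lambda>y. cis (- (y \<bullet> x)) * v y"] integral_norm_bound[of lborel "\<lambda>y. cis (x \<bullet> y) * v y"]
  by (simp_all add: fourier_def inv_fourier_def norm_mult norm_divide divide_right_mono)

lemma fourier_multiplication_formula:
  assumes u: "integrable lborel u" and v: "integrable lborel v"
  shows "(LINT x|lborel. fourier u x * v x) = (LINT x|lborel. u x * fourier v x)"
proof -
  have [measurable]: "u \<in> borel_measurable borel" "v \<in> borel_measurable borel" using u v by auto
  have i: "integrable (lborel \<Otimes>\<^sub>M lborel) (\<lambda>(x, y). (cis (- (y \<bullet> x)) * u y) * v x)"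
  proof (rule Bochner_Integration.integrable_bound)
    show "integrable (lborel \<Otimes>\<^sub>M lborel) (\<lambda>(x, y). v x * u y)" by (rule lborel_integrable_mult_pair[OF v u])
  qed (auto simp: norm_mult)
  have "(LINT x|lborel. fourier u x * v x) = (LINT x|lborel. (LINT y|lborel. (cis (- (y \<bullet> x)) * u y) * v x)) / of_real (2 * pi)"
    by (simp add: fourier_def)
  also have "(LINT x|lborel. (LINT y|lborel. (cis (- (y \<bullet> x)) * u y) * v x)) = (LINT y|lborel. (LINT x|lborel. (cis (- (y \<bullet> x)) * u y) * v x))"
    using lborel_pair.Fubini_integral[OF i] by simp
  also have "\<dots> = (LINT y|lborel. u y * (LINT x|lborel. cis (- (x \<bullet> y)) * v x))"
  proof (intro Bochner_Integration.integral_cong refl)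
    fix y
    have "(LINT x|lborel. (cis (- (y \<bullet> x)) * u y) * v x) = (LINT x|lborel. u y * (cis (- (x \<bullet> y)) * v x))"
      by (intro Bochner_Integration.integral_cong refl) (simp add: inner_commute mult_ac)
    thus "(LINT x|lborel. (cis (- (y \<bullet> x)) * u y) * v x) = u y * (LINT x|lborel. cis (- (x \<bullet> y)) * v x)" by simp
  qed
  also have "\<dots> / of_real (2 * pi) = (LINT x|lborel. u x * fourier v x)" by (simp add: fourier_def)
  finally show ?thesis .
qed

lemma inv_fourier_multiplication_formula:
  assumes u: "integrable lborel u" and v: "integrable lborel v"
  shows "(LINT x|lborel. inv_fourier u x * v x) = (LINT x|lborel. u x * inv_fourier v x)"
proof -
  have [measurable]: "u \<in> borel_measurable borel" "v \<in> borel_measurable borel" using u v by auto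
  have "integrable lborel (\<lambda>x. v (0 + (-1) *\<^sub>R x))" by (rule lborel_integrable_affine[OF v]) simp
  hence v': "integrable lborel (\<lambda>x. v (- x))" by simp
  have "(LINT x|lborel. inv_fourier u x * v x) = (LINT x|lborel. (\<lambda>x. fourier u x * v (- x)) (- x))"
    by (simp add: inv_fourier_eq)
  also have "\<dots> = (LINT x|lborel. fourier u x * v (- x))"
    by (rule lborel_integral_reflect) measurable
  also have "\<dots> = (LINT x|lborel. u x * inv_fourier v x)"
    using fourier_multiplication_formula[OF u v'] by (simp add: fourier_reflect inv_fourier_eq)
  finally show ?thesis .
qed

text \<open>The inverse Fourier transform of v in the sense of distributions, defined by
  transposition. The data and the solutions constructed below all have this form.\<close>

definition dist_of :: "(real^2 \<Rightarrow> complex) \<Rightarrow> dist" where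
  "dist_of v = (\<lambda>\<phi>. if \<phi> \<in> schwartz then LINT \<xi>|lborel. v \<xi> * inv_fourier \<phi> \<xi> else 0)"

lemma represents_dist_of:
  assumes v: "integrable lborel v" shows "represents (inv_fourier v) (dist_of v)"
  unfolding represents_def
proof (intro conjI ballI)
  have [measurable]: "v \<in> borel_measurable borel" using v by auto
  show "inv_fourier v \<in> borel_measurable lborel" by measurable
  show "integrable lborel (\<lambda>x. inv_fourier v x * \<phi> x)" if "\<phi> \<in> schwartz" for \<phi>
    by (rule integrable_mult_bounded[OF schwartz_integrable[OF that] _ fourier_L1_bound(2)]) measurable
  show "dist_of v = regular_dist (inv_fourier v)"
    using inv_fourier_multiplication_formula[OF v schwartz_integrable]
    by (auto simp: dist_of_def regular_dist_def)
qed

text \<open>(1 + r^2)^2 \<le> 2 (1 + r^4) is why the powers 0 and 4, without derivatives, suffice.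
  They lead to N = 4 in the continuity estimate for \<open>dist_of v\<close>.\<close>

lemma schwartz_L1_seminorm:
  "\<exists>C\<ge>0. \<forall>\<phi>\<in>schwartz. (LINT x|lborel. cmod (\<phi> x)) \<le> C * (schwartz_seminorm 0 [] \<phi> + schwartz_seminorm 4 [] \<phi>)"
proof (intro exI conjI ballI)
  let ?W = "\<lambda>x::real^2. 1 / (1 + (norm x)\<^sup>2)\<^sup>2"
  let ?C = "2 * (LINT x|lborel. ?W x)"
  show "?C \<ge> 0" by simp
  fix \<phi> assume \<phi>: "\<phi> \<in> schwartz"
  let ?S = "schwartz_seminorm 0 [] \<phi> + schwartz_seminorm 4 [] \<phi>"
  have bdd: "bdd_above (range (\<lambda>x. norm x ^ k * cmod (\<phi> x)))" for k
    using \<phi>[unfolded schwartz_def mem_Collect_eq, THEN spec[of _ "[]"]] by simp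
  have le: "norm x ^ k * cmod (\<phi> x) \<le> schwartz_seminorm k [] \<phi>" for k x
    unfolding schwartz_seminorm_def partial_derivs.simps by (rule cSUP_upper[OF UNIV_I bdd])
  have pt: "cmod (\<phi> x) \<le> 2 * ?S * ?W x" for x
  proof -
    have p: "(1 + (norm x)\<^sup>2)\<^sup>2 > 0" by (intro zero_less_power add_pos_nonneg) auto
    have "(1 + (norm x)\<^sup>2)\<^sup>2 \<le> 2 * (1 + norm x ^ 4)"
      using sum_squares_ge_zero[of "(norm x)\<^sup>2 - 1" 0] by (simp add: power2_eq_square power4_eq_xxxx algebra_simps)
    hence "(1 + (norm x)\<^sup>2)\<^sup>2 * cmod (\<phi> x) \<le> 2 * (1 + norm x ^ 4) * cmod (\<phi> x)"
      by (intro mult_right_mono) auto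
    also have "\<dots> = 2 * (norm x ^ 0 * cmod (\<phi> x) + norm x ^ 4 * cmod (\<phi> x))" by (simp add: algebra_simps)
    also have "\<dots> \<le> 2 * ?S" by (intro mult_left_mono add_mono le) auto
    finally show ?thesis using p by (simp add: field_simps)
  qed
  have "(LINT x|lborel. cmod (\<phi> x)) \<le> (LINT x|lborel. 2 * ?S * ?W x)"
    by (intro integral_mono integrable_norm schwartz_integrable \<phi> integrable_mult_right integrable_inverse_square_weight pt)
  also have "\<dots> = 2 * ?S * (LINT x|lborel. ?W x)" by (rule integral_mult_right_zero)
  also have "\<dots> = ?C * ?S" by (simp only: mult_ac)
  finally show "(LINT x|lborel. cmod (\<phi> x)) \<le> ?C * ?S" .
qed

lemma schwartz_seminorm_nonneg: "\<phi> \<in> schwartz \<Longrightarrow> 0 \<le> schwartz_seminorm k is \<phi>"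
  unfolding schwartz_def schwartz_seminorm_def mem_Collect_eq
  by (rule order_trans[OF _ cSUP_upper[of 0]]) auto

lemma tempered_dist_of:
  assumes v: "integrable lborel v" shows "dist_of v \<in> tempered"
proof -
  have [measurable]: "v \<in> borel_measurable borel" using v by auto
  have i: "integrable lborel (\<lambda>\<xi>. v \<xi> * inv_fourier \<phi> \<xi>)" if "\<phi> \<in> schwartz" for \<phi>
    using v schwartz_inv_fourier[OF that] by (rule integrable_mult_schwartz)
  show ?thesis
    unfolding tempered_def mem_Collect_eq
  proof (intro conjI ballI allI impI)
    fix \<phi> \<psi> assume \<phi>: "\<phi> \<in> schwartz" "\<psi> \<in> schwartz"
    have "inv_fourier (\<lambda>x. \<phi> x + \<psi> x) \<xi> = inv_fourier \<phi> \<xi> + inv_fourier \<psi> \<xi>" for \<xi>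
      using \<phi> by (simp add: inv_fourier_eq fourier_add)
    thus "dist_of v (\<lambda>x. \<phi> x + \<psi> x) = dist_of v \<phi> + dist_of v \<psi>"
      using \<phi> by (simp add: dist_of_def schwartz_add distrib_left i)
  next
    fix c \<phi> assume \<phi>: "\<phi> \<in> schwartz"
    have "inv_fourier (\<lambda>x. c * \<phi> x) \<xi> = c * inv_fourier \<phi> \<xi>" for \<xi>
      by (simp add: inv_fourier_eq fourier_cmult)
    thus "dist_of v (\<lambda>x. c * \<phi> x) = c * dist_of v \<phi>"
      using \<phi> by (simp add: dist_of_def schwartz_cmult mult.left_commute)
  next
    show "dist_of v \<phi> = 0" if "\<phi> \<notin> schwartz" for \<phi> using that by (simp add: dist_of_def)
  next
    obtain C where C: "C \<ge> 0" "\<And>\<phi>. \<phi> \<in> schwartz \<Longrightarrow> (LINT x|lborel. cmod (\<phi> x)) \<le> C * (schwartz_seminorm 0 [] \<phi> + schwartz_seminorm 4 [] \<phi>)"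
      using schwartz_L1_seminorm by blast
    let ?D = "(LINT x|lborel. cmod (v x)) / (2 * pi)"
    have fin: "finite {is::2 list. length is \<le> 4}" using finite_lists_length_le[of "UNIV::2 set" 4] by simp
    show "\<exists>C N. \<forall>\<phi>\<in>schwartz. cmod (dist_of v \<phi>) \<le> C * (\<Sum>k\<le>N. \<Sum>is\<in>{is. length is \<le> N}. schwartz_seminorm k is \<phi>)"
    proof (intro exI ballI)
      fix \<phi> assume \<phi>: "\<phi> \<in> schwartz"
      let ?s = "\<lambda>k. \<Sum>is\<in>{is. length is \<le> 4}. schwartz_seminorm k is \<phi>"
      have "cmod (dist_of v \<phi>) \<le> (LINT x|lborel. cmod (inv_fourier v x * \<phi> x))"
        using represents_dist_of[OF v] \<phi> unfolding represents_def regular_dist_def by simp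
      also have "\<dots> \<le> (LINT x|lborel. ?D * cmod (\<phi> x))"
      proof (rule integral_mono)
        show "integrable lborel (\<lambda>x. cmod (inv_fourier v x * \<phi> x))"
          using represents_dist_of[OF v] \<phi> unfolding represents_def by auto
        show "integrable lborel (\<lambda>x. ?D * cmod (\<phi> x))" using schwartz_integrable[OF \<phi>] by auto
        show "cmod (inv_fourier v x * \<phi> x) \<le> ?D * cmod (\<phi> x)" for x
          unfolding norm_mult by (intro mult_right_mono fourier_L1_bound) auto
      qed
      also have "\<dots> = ?D * (LINT x|lborel. cmod (\<phi> x))" by simp
      also have "\<dots> \<le> ?D * (C * (schwartz_seminorm 0 [] \<phi> + schwartz_seminorm 4 [] \<phi>))"
        by (intro mult_left_mono C \<phi>) simp
      also have "\<dots> \<le> ?D * (C * (\<Sum>k\<le>4. ?s k))"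
      proof (intro mult_left_mono C)
        have "schwartz_seminorm k [] \<phi> \<le> ?s k" for k
          using fin \<phi> by (intro member_le_sum) (auto intro: schwartz_seminorm_nonneg)
        moreover have "0 \<le> ?s k" for k using \<phi> by (intro sum_nonneg schwartz_seminorm_nonneg)
        moreover have "{..4::nat} = {0,1,2,3,4}" by auto
        ultimately show "schwartz_seminorm 0 [] \<phi> + schwartz_seminorm 4 [] \<phi> \<le> (\<Sum>k\<le>4. ?s k)"
          by (simp add: add.assoc add_mono add_increasing)
      qed simp
      finally show "cmod (dist_of v \<phi>) \<le> (?D * C) * (\<Sum>k\<le>4. ?s k)" by (simp only: mult.assoc)
    qed
  qed
qed

lemma dist_fourier_dist_of: "dist_fourier (dist_of v) = regular_dist v"
  by (auto simp: dist_fourier_def dist_of_def regular_dist_def schwartz_fourier fourier_inversion)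

lemma represents_regular_dist:
  assumes v: "integrable lborel v" shows "represents v (regular_dist v)"
  unfolding represents_def
proof (intro conjI ballI refl)
  show "v \<in> borel_measurable lborel" using v by auto
qed (rule integrable_mult_schwartz[OF v])

section \<open>Sobolev norms on the Fourier side\<close>

definition weight :: "real \<Rightarrow> real^2 \<Rightarrow> real" where
  "weight s \<xi> = (1 + (norm \<xi>)\<^sup>2) powr s"

lemma weight_pos: "weight s \<xi> > 0"
  by (simp add: weight_def) (metis add_pos_nonneg less_irrefl zero_le_power2 zero_less_one)

lemma weight_measurable [measurable]: "weight s \<in> borel_measurable borel"
  unfolding weight_def[abs_def] by measurable

text \<open>\<open>fun_of\<close> picks an unspecified representative. Representatives agree almost
  everywhere, so the norm and the integrability condition can be computed from any known
  one.\<close>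

lemma sobolev_nrm_eq:
  assumes "represents v (dist_fourier f)"
  shows "nrm (sobolev s) f = sqrt (LINT \<xi>|lborel. weight s \<xi> * (cmod (v \<xi>))\<^sup>2)"
    and "integrable lborel (\<lambda>\<xi>. weight s \<xi> * (cmod (fun_of (dist_fourier f) \<xi>))\<^sup>2)
      \<longleftrightarrow> integrable lborel (\<lambda>\<xi>. weight s \<xi> * (cmod (v \<xi>))\<^sup>2)"
proof -
  have [measurable]: "v \<in> borel_measurable borel" "fun_of (dist_fourier f) \<in> borel_measurable borel"
    using assms represents_fun_of[OF assms] by (auto simp: represents_def)
  have ae: "AE \<xi> in lborel. weight s \<xi> * (cmod (fun_of (dist_fourier f) \<xi>))\<^sup>2 = weight s \<xi> * (cmod (v \<xi>))\<^sup>2"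
    using fun_of_AE[OF assms] by eventually_elim simp
  show "nrm (sobolev s) f = sqrt (LINT \<xi>|lborel. weight s \<xi> * (cmod (v \<xi>))\<^sup>2)"
    unfolding sobolev_def by (simp add: weight_def[symmetric]) (rule integral_cong_AE, use ae in auto)
  show "integrable lborel (\<lambda>\<xi>. weight s \<xi> * (cmod (fun_of (dist_fourier f) \<xi>))\<^sup>2)
      \<longleftrightarrow> integrable lborel (\<lambda>\<xi>. weight s \<xi> * (cmod (v \<xi>))\<^sup>2)"
    by (rule integrable_cong_AE) (use ae in auto)
qed

lemma dist_of_in_sobolev:
  assumes v: "integrable lborel v" and s: "integrable lborel (\<lambda>\<xi>. weight s \<xi> * (cmod (v \<xi>))\<^sup>2)"
  shows "dist_of v \<in> vecs (sobolev s)"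
proof -
  have r: "represents v (dist_fourier (dist_of v))"
    unfolding dist_fourier_dist_of by (rule represents_regular_dist[OF v])
  show ?thesis
    unfolding sobolev_def using tempered_dist_of[OF v] r s sobolev_nrm_eq(2)[OF r, of s]
    by (auto simp: weight_def[symmetric])
qed

section \<open>The free group and the nonlinearity on the Fourier side\<close>

lemma schwartz_schwartz_group: "\<phi> \<in> schwartz \<Longrightarrow> schwartz_group t \<phi> \<in> schwartz"
  unfolding schwartz_group_def by (intro schwartz_inv_fourier schwartz_mult_cis schwartz_fourier)

lemma inv_fourier_schwartz_group:
  assumes "\<phi> \<in> schwartz"
  shows "inv_fourier (schwartz_group t \<phi>) \<xi> = cis (t * (norm \<xi>)\<^sup>2) * inv_fourier \<phi> \<xi>"
proof -
  have "inv_fourier (schwartz_group t \<phi>) \<xi> = fourier (inv_fourier (\<lambda>\<xi>. cis (t * (norm \<xi>)\<^sup>2) * fourier \<phi> \<xi>)) (- \<xi>)"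
    by (simp only: inv_fourier_eq[of "schwartz_group t \<phi>"]) (simp only: schwartz_group_def)
  thus ?thesis
    by (simp add: fourier_inv_fourier schwartz_mult_cis schwartz_fourier assms inv_fourier_eq[of \<phi>])
qed

lemma schroedinger_group_dist_of:
  "\<phi> \<in> schwartz \<Longrightarrow> schroedinger_group t (dist_of v) \<phi> = (LINT \<xi>|lborel. v \<xi> * (cis (t * (norm \<xi>)\<^sup>2) * inv_fourier \<phi> \<xi>))"
  by (simp add: schroedinger_group_def dist_of_def schwartz_schwartz_group inv_fourier_schwartz_group)

lemma fourier_modulate: "fourier (\<lambda>x. cis (x \<bullet> \<eta>) * \<phi> x) \<xi> = fourier \<phi> (\<xi> - \<eta>)"
proof -
  have "cis (- (x \<bullet> \<xi>)) * (cis (x \<bullet> \<eta>) * \<phi> x) = cis (- (x \<bullet> (\<xi> - \<eta>))) * \<phi> x" for x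
    by (simp add: mult.assoc[symmetric] cis_mult inner_diff_right)
  thus ?thesis by (simp only: fourier_def)
qed

lemma borel_measurable_cnj [measurable (raw)]:
  "f \<in> borel_measurable M \<Longrightarrow> (\<lambda>x. cnj (f x)) \<in> borel_measurable M"
  by (rule measurable_compose[OF _ borel_measurable_continuous_onI])
     (auto intro: linear_continuous_on bounded_linear_cnj)

text \<open>With V the inverse transform of v, the multiplication formula moves the transform off V
  and then off its conjugate, so |V|^2 becomes the autocorrelation of v divided by 2 \<pi>.
  Boundedness of v makes the last exchange of integrals absolutely convergent.\<close>

lemma abs_square_dist_of:
  assumes v: "integrable lborel v" and vb: "\<And>\<xi>. cmod (v \<xi>) \<le> B" and \<phi>: "\<phi> \<in> schwartz"
  shows "abs_square (dist_of v) \<phi>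
    = (LINT \<xi>|lborel. (LINT \<zeta>|lborel. v (\<zeta> + \<xi>) * cnj (v \<zeta>)) * inv_fourier \<phi> \<xi>) / of_real (2 * pi)"
proof -
  let ?V = "inv_fourier v"
  have [measurable]: "v \<in> borel_measurable borel" "\<phi> \<in> borel_measurable borel" using v \<phi> by auto
  have cv: "integrable lborel (\<lambda>x. cnj (v x))" using v by simp
  have cnjV: "cnj (?V x) = fourier (\<lambda>x. cnj (v x)) x" for x
  proof -
    have "cnj (LINT \<xi>|lborel. cis (x \<bullet> \<xi>) * v \<xi>) = (LINT \<xi>|lborel. cnj (cis (x \<bullet> \<xi>) * v \<xi>))"
      by (rule Bochner_Integration.integral_cnj[symmetric])
    thus ?thesis by (simp add: inv_fourier_def fourier_def cis_cnj inner_commute)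
  qed
  have m: "fun_of (dist_of v) \<in> borel_measurable borel"
    using represents_fun_of[OF represents_dist_of[OF v]] by (simp add: represents_def)
  have V: "?V \<in> borel_measurable borel" by measurable
  have "(\<lambda>x. cnj (?V x)) \<in> borel_measurable borel" using V by simp
  hence V2: "(\<lambda>x. ?V x * (cnj (?V x) * \<phi> x)) \<in> borel_measurable lborel"
    using V \<phi> by (simp add: schwartz_measurable borel_measurable_times)
  have "abs_square (dist_of v) \<phi> = (LINT x|lborel. of_real ((cmod (fun_of (dist_of v) x))\<^sup>2) * \<phi> x)"
    using \<phi> by (simp add: abs_square_def regular_dist_def)
  also have "\<dots> = (LINT x|lborel. ?V x * (cnj (?V x) * \<phi> x))"
  proof (rule integral_cong_AE)
    show "AE x in lborel. of_real ((cmod (fun_of (dist_of v) x))\<^sup>2) * \<phi> x = ?V x * (cnj (?V x) * \<phi> x)"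
      using fun_of_AE[OF represents_dist_of[OF v]]
      by eventually_elim (simp only: complex_norm_square mult.assoc)
  qed (use m \<phi> V2 in \<open>simp_all\<close>)
  also have "\<dots> = (LINT \<xi>|lborel. v \<xi> * inv_fourier (\<lambda>x. cnj (?V x) * \<phi> x) \<xi>)"
  proof (rule inv_fourier_multiplication_formula[OF v])
    show "integrable lborel (\<lambda>x. cnj (?V x) * \<phi> x)"
      by (rule integrable_mult_bounded[OF schwartz_integrable[OF \<phi>], where C = "(LINT x|lborel. cmod (v x)) / (2 * pi)"])
         (auto intro: fourier_L1_bound)
  qed
  also have "\<dots> = (LINT \<xi>|lborel. (LINT \<zeta>|lborel. v \<xi> * (cnj (v \<zeta>) * inv_fourier \<phi> (\<xi> - \<zeta>)))) / of_real (2 * pi)"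
  proof -
    have "inv_fourier (\<lambda>x. cnj (?V x) * \<phi> x) \<xi> = (LINT \<zeta>|lborel. cnj (v \<zeta>) * inv_fourier \<phi> (\<xi> - \<zeta>)) / of_real (2 * pi)" for \<xi>
    proof -
      have "(LINT x|lborel. cis (\<xi> \<bullet> x) * (cnj (?V x) * \<phi> x)) = (LINT x|lborel. fourier (\<lambda>x. cnj (v x)) x * (cis (x \<bullet> \<xi>) * \<phi> x))"
        by (simp add: cnjV inner_commute mult_ac)
      also have "\<dots> = (LINT x|lborel. cnj (v x) * fourier (\<lambda>x. cis (x \<bullet> \<xi>) * \<phi> x) x)"
        by (rule fourier_multiplication_formula[OF cv]) (intro integrable_cis_mult schwartz_integrable \<phi>, auto)
      also have "\<dots> = (LINT \<zeta>|lborel. cnj (v \<zeta>) * inv_fourier \<phi> (\<xi> - \<zeta>))"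
        by (simp add: fourier_modulate inv_fourier_eq)
      finally show ?thesis by (simp add: inv_fourier_def)
    qed
    thus ?thesis by simp
  qed
  also have "(LINT \<xi>|lborel. (LINT \<zeta>|lborel. v \<xi> * (cnj (v \<zeta>) * inv_fourier \<phi> (\<xi> - \<zeta>))))
     = (LINT \<zeta>|lborel. (LINT \<xi>|lborel. v \<xi> * (cnj (v \<zeta>) * inv_fourier \<phi> (\<xi> - \<zeta>))))"
  proof -
    obtain C where C: "\<And>x. cmod (inv_fourier \<phi> x) \<le> C" using schwartz_bounded[OF schwartz_inv_fourier[OF \<phi>]] by blast
    have "integrable (lborel \<Otimes>\<^sub>M lborel) (\<lambda>z. inv_fourier \<phi> (fst z - snd z) * (case z of (\<xi>, \<zeta>) \<Rightarrow> v \<xi> * cnj (v \<zeta>)))"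
      by (rule integrable_mult_bounded[OF lborel_integrable_mult_pair[OF v cv] _ C]) measurable
    hence "integrable (lborel \<Otimes>\<^sub>M lborel) (\<lambda>(\<xi>, \<zeta>). v \<xi> * (cnj (v \<zeta>) * inv_fourier \<phi> (\<xi> - \<zeta>)))"
      by (simp add: case_prod_beta' mult_ac)
    from lborel_pair.Fubini_integral[OF this] show ?thesis by simp
  qed
  also have "\<dots> = (LINT \<zeta>|lborel. (LINT \<xi>|lborel. v (\<zeta> + \<xi>) * (cnj (v \<zeta>) * inv_fourier \<phi> \<xi>)))"
  proof (rule Bochner_Integration.integral_cong[OF refl])
    fix \<zeta>
    show "(LINT \<xi>|lborel. v \<xi> * (cnj (v \<zeta>) * inv_fourier \<phi> (\<xi> - \<zeta>))) = (LINT \<xi>|lborel. v (\<zeta> + \<xi>) * (cnj (v \<zeta>) * inv_fourier \<phi> \<xi>))"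
      by (subst lborel_integral_translate[symmetric, of _ \<zeta>]) simp_all
  qed
  also have "\<dots> = (LINT \<xi>|lborel. (LINT \<zeta>|lborel. v (\<zeta> + \<xi>) * (cnj (v \<zeta>) * inv_fourier \<phi> \<xi>)))"
  proof -
    have "integrable (lborel \<Otimes>\<^sub>M lborel) (\<lambda>z. v (fst z + snd z) * (case z of (\<zeta>, \<xi>) \<Rightarrow> cnj (v \<zeta>) * inv_fourier \<phi> \<xi>))"
      by (rule integrable_mult_bounded[OF lborel_integrable_mult_pair[OF cv schwartz_integrable[OF schwartz_inv_fourier[OF \<phi>]]] _ vb]) measurable
    hence "integrable (lborel \<Otimes>\<^sub>M lborel) (\<lambda>(\<zeta>, \<xi>). v (\<zeta> + \<xi>) * (cnj (v \<zeta>) * inv_fourier \<phi> \<xi>))"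
      by (simp add: case_prod_beta')
    from lborel_pair.Fubini_integral[OF this] show ?thesis by simp
  qed
  also have "\<dots> = (LINT \<xi>|lborel. (LINT \<zeta>|lborel. v (\<zeta> + \<xi>) * cnj (v \<zeta>)) * inv_fourier \<phi> \<xi>)"
    by (simp flip: mult.assoc)
  finally show ?thesis .
qed

lemma schroedinger_group_abs_square_dist_of:
  assumes v: "integrable lborel v" "\<And>\<xi>. cmod (v \<xi>) \<le> B" and \<phi>: "\<phi> \<in> schwartz"
  shows "schroedinger_group t (abs_square (dist_of v)) \<phi>
    = (LINT \<xi>|lborel. (LINT \<zeta>|lborel. v (\<zeta> + \<xi>) * cnj (v \<zeta>)) * (cis (t * (norm \<xi>)\<^sup>2) * inv_fourier \<phi> \<xi>)) / of_real (2 * pi)"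
  using \<phi> abs_square_dist_of[OF v schwartz_schwartz_group[OF \<phi>]]
  by (simp add: schroedinger_group_def inv_fourier_schwartz_group)

section \<open>The fixed point problem for profiles\<close>

text \<open>Contraction on the ball of radius 2 |g|. For the cubic error, v - g = Q(v, v) is already
  O(|g|^2), and Q(v, v) - Q(g, g) is linear in v - g with coefficients of size |g|.\<close>

lemma quadratic_fixed_point:
  fixes Q :: "'a::{real_normed_vector, complete_space} \<Rightarrow> 'a \<Rightarrow> 'a"
  assumes "bounded_bilinear Q"
  obtains \<delta> C where "\<delta> > 0"
    "\<And>g. norm g \<le> \<delta> \<Longrightarrow> \<exists>v. v = g + Q v v \<and> norm (v - g - Q g g) \<le> C * norm g ^ 3"
proof -
  interpret bounded_bilinear Q by fact
  obtain K where K: "K > 0" "\<And>a b. norm (Q a b) \<le> norm a * norm b * K" using pos_bounded by blast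
  have diff: "Q v v - Q u u = Q v (v - u) + Q (v - u) u" for u v
    by (simp add: diff_left diff_right)
  have sol: "\<exists>v. v = g + Q v v \<and> norm (v - g - Q g g) \<le> (12 * K\<^sup>2) * norm g ^ 3"
    if g: "norm g \<le> 1 / (8 * K)" for g
  proof -
    let ?S = "cball 0 (2 * norm g) :: 'a set" and ?F = "\<lambda>v. g + Q v v"
    \<comment> \<open>With K |g| \<le> 1/8 the ball is mapped into itself and the Lipschitz constant
      4 K |g| is at most 1/2.\<close>
    have gK: "K * norm g \<le> 1 / 8" using g K(1) by (simp add: field_simps)
    have QS: "norm (Q v v) \<le> 4 * K * (norm g)\<^sup>2" if "v \<in> ?S" for v
    proof -
      have "norm v * norm v * K \<le> (2 * norm g) * (2 * norm g) * K"
        using that K(1) by (intro mult_mono mult_right_mono) auto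
      hence "norm (Q v v) \<le> (2 * norm g) * (2 * norm g) * K" using K(2)[of v v] by linarith
      thus ?thesis by (simp add: power2_eq_square mult_ac)
    qed
    have "\<exists>!v\<in>?S. ?F v = v"
    proof (rule Banach_fix[where c = "1/2"])
      show "?F ` ?S \<subseteq> ?S"
      proof clarify
        fix v assume v: "v \<in> ?S"
        have "4 * K * (norm g)\<^sup>2 = 4 * (K * norm g) * norm g" by (simp add: power2_eq_square)
        also have "\<dots> \<le> 4 * (1 / 8) * norm g" using gK by (intro mult_right_mono) auto
        finally have "norm (Q v v) \<le> norm g" using QS[OF v] norm_ge_zero[of g] by linarith
        thus "?F v \<in> ?S" using norm_triangle_ineq[of g "Q v v"] by simp
      qed
      show "dist (?F v) (?F u) \<le> 1 / 2 * dist v u" if "v \<in> ?S" "u \<in> ?S" for v u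
      proof -
        have "norm v * norm (v - u) * K \<le> (2 * norm g) * norm (v - u) * K"
          using that K(1) by (intro mult_right_mono) auto
        moreover have "norm (v - u) * norm u * K \<le> norm (v - u) * (2 * norm g) * K"
          using that K(1) by (intro mult_right_mono mult_left_mono) auto
        ultimately have "norm (Q v v - Q u u) \<le> 4 * (K * norm g) * norm (v - u)"
          unfolding diff using K(2)[of v "v - u"] K(2)[of "v - u" u] norm_triangle_ineq[of "Q v (v - u)" "Q (v - u) u"]
          by (simp add: algebra_simps)
        also have "\<dots> \<le> 4 * (1 / 8) * norm (v - u)" using gK by (intro mult_right_mono) auto
        finally show ?thesis by (simp add: dist_norm)
      qed
    qed (auto simp: complete_eq_closed)
    then obtain v where v: "v \<in> ?S" "g + Q v v = v" by blast
    have vg: "v - g = Q v v" using v(2) by (simp add: algebra_simps)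
    have "v - g - Q g g = Q v v - Q g g" by (simp only: vg)
    also have "\<dots> = Q v (v - g) + Q (v - g) g" by (rule diff)
    finally have "norm (v - g - Q g g) \<le> norm (Q v (v - g)) + norm (Q (v - g) g)"
      using norm_triangle_ineq[of "Q v (v - g)" "Q (v - g) g"] by (simp only:)
    also have "\<dots> \<le> norm v * norm (v - g) * K + norm (v - g) * norm g * K" by (intro add_mono K)
    also have "\<dots> = K * norm (v - g) * (norm v + norm g)" by (simp add: algebra_simps)
    also have "\<dots> \<le> K * (4 * K * (norm g)\<^sup>2) * (2 * norm g + norm g)"
      using v(1) K(1) QS[OF v(1)] unfolding vg by (intro mult_mono add_mono mult_left_mono) auto
    also have "\<dots> = (12 * K\<^sup>2) * norm g ^ 3" by (simp add: power2_eq_square power3_eq_cube)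
    finally show ?thesis using v(2) by metis
  qed
  show thesis by (rule that[of "1 / (8 * K)" "12 * K\<^sup>2"]) (use K(1) sol in auto)
qed

text \<open>
  The exponential factor makes the weight decay faster than any power, so that a single fixed
  point gives a solution in all \<open>H^k\<close>; the polynomial factor makes its self-convolution
  bounded by a multiple of the weight itself.
\<close>

definition decay :: "real^2 \<Rightarrow> real" where
  "decay \<xi> = exp (- norm \<xi>) * (1 / (1 + (norm \<xi>)\<^sup>2)\<^sup>2)"

lemma one_plus_norm_pos: "0 < 1 + (norm (x::'a::real_normed_vector))\<^sup>2"
  by (simp add: add_pos_nonneg)

lemma decay_pos: "decay \<xi> > 0"
  using one_plus_norm_pos[of \<xi>] by (simp add: decay_def)

lemma decay_le_weight: "decay \<xi> \<le> 1 / (1 + (norm \<xi>)\<^sup>2)\<^sup>2"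
  using one_plus_norm_pos[of \<xi>] by (auto simp: decay_def mult_le_cancel_right1 divide_right_mono)

lemma decay_le_1: "decay \<xi> \<le> 1"
proof -
  have "1 \<le> (1 + (norm \<xi>)\<^sup>2)\<^sup>2" by (rule one_le_power) simp
  hence "1 / (1 + (norm \<xi>)\<^sup>2)\<^sup>2 \<le> 1" using one_plus_norm_pos[of \<xi>] by (simp add: divide_le_eq_1)
  thus ?thesis using decay_le_weight[of \<xi>] by linarith
qed

lemma continuous_on_decay [continuous_intros]:
  "continuous_on A f \<Longrightarrow> continuous_on A (\<lambda>x. decay (f x))"
  unfolding decay_def by (intro continuous_intros) (simp_all add: less_imp_neq[OF one_plus_norm_pos, symmetric])

lemma decay_measurable [measurable]: "decay \<in> borel_measurable borel"
  by (intro borel_measurable_continuous_onI continuous_on_decay continuous_on_id)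

lemma decay_abs [simp]: "\<bar>decay \<xi>\<bar> = decay \<xi>"
  using decay_pos[of \<xi>] by simp

lemma decay_nonneg [simp]: "0 \<le> decay \<xi>"
  using decay_pos[of \<xi>] by simp

lemma integrable_decay: "integrable lborel decay"
  by (rule integrable_square_weight_bound[where C = 1]) (simp_all add: decay_le_weight)

text \<open>The exponentials are handled by the triangle inequality. For the rational factors,
  |\<xi>| \<le> |\<zeta> + \<xi>| + |\<zeta>| gives P \<le> 8 (A + B); dividing by A B P leaves 1/P
  times the sum of 1/A and 1/B, each integrable in \<zeta>.\<close>

lemma decay_mult_le:
  "decay (\<zeta> + \<xi>) * decay \<zeta> \<le> 8 * decay \<xi> * (1 / (1 + (norm (\<zeta> + \<xi>))\<^sup>2)\<^sup>2 + 1 / (1 + (norm \<zeta>)\<^sup>2)\<^sup>2)"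
proof -
  define A where "A = (1 + (norm (\<zeta> + \<xi>))\<^sup>2)\<^sup>2"
  define B where "B = (1 + (norm \<zeta>)\<^sup>2)\<^sup>2"
  define P where "P = (1 + (norm \<xi>)\<^sup>2)\<^sup>2"
  have pos: "A > 0" "B > 0" "P > 0"
    unfolding A_def B_def P_def by (intro zero_less_power one_plus_norm_pos)+
  have tri: "norm \<xi> \<le> norm (\<zeta> + \<xi>) + norm \<zeta>" using norm_triangle_ineq4[of "\<zeta> + \<xi>" \<zeta>] by simp
  have "P \<le> 8 * (A + B)"
  proof -
    have "(norm \<xi>)\<^sup>2 \<le> (norm (\<zeta> + \<xi>) + norm \<zeta>)\<^sup>2" using tri by (intro power_mono) auto
    also have "\<dots> \<le> 2 * (norm (\<zeta> + \<xi>))\<^sup>2 + 2 * (norm \<zeta>)\<^sup>2"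
      using sum_squares_ge_zero[of "norm (\<zeta> + \<xi>) - norm \<zeta>" 0] by (simp add: power2_eq_square algebra_simps)
    finally have "1 + (norm \<xi>)\<^sup>2 \<le> 2 * (1 + (norm (\<zeta> + \<xi>))\<^sup>2) + 2 * (1 + (norm \<zeta>)\<^sup>2)" by simp
    hence "P \<le> (2 * (1 + (norm (\<zeta> + \<xi>))\<^sup>2) + 2 * (1 + (norm \<zeta>)\<^sup>2))\<^sup>2"
      unfolding P_def by (intro power_mono) auto
    also have "\<dots> \<le> 8 * (A + B)"
      using sum_squares_ge_zero[of "(1 + (norm (\<zeta> + \<xi>))\<^sup>2) - (1 + (norm \<zeta>)\<^sup>2)" 0]
      by (simp add: A_def B_def power2_eq_square algebra_simps)
    finally show ?thesis .
  qed
  hence "1 / (A * B) \<le> 8 / P * (1 / A + 1 / B)"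
    using pos by (simp add: field_simps)
  moreover have "exp (- norm (\<zeta> + \<xi>)) * exp (- norm \<zeta>) \<le> exp (- norm \<xi>)"
    using tri by (simp flip: exp_add)
  ultimately have "(exp (- norm (\<zeta> + \<xi>)) * exp (- norm \<zeta>)) * (1 / (A * B)) \<le> exp (- norm \<xi>) * (8 / P * (1 / A + 1 / B))"
    using pos by (intro mult_mono) auto
  thus ?thesis by (simp add: decay_def A_def[symmetric] B_def[symmetric] P_def[symmetric] mult_ac)
qed

text \<open>16 = 2 * 8: both terms in \<open>decay_mult_le\<close> have the same integral over
  \<zeta>.\<close>

definition decay_const :: real where
  "decay_const = 16 * (LINT x|lborel. 1 / (1 + (norm (x::real^2))\<^sup>2)\<^sup>2)"

lemma integrable_decay_mult: "integrable lborel (\<lambda>\<zeta>. decay (\<zeta> + \<xi>) * decay \<zeta>)"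
  by (rule Bochner_Integration.integrable_bound[OF integrable_decay])
     (simp_all add: abs_mult decay_le_1 mult_left_le_one_le)

lemma decay_convolution: "(LINT \<zeta>|lborel. decay (\<zeta> + \<xi>) * decay \<zeta>) \<le> decay_const * decay \<xi>"
proof -
  let ?q = "\<lambda>x::real^2. 1 / (1 + (norm x)\<^sup>2)\<^sup>2"
  have q: "integrable lborel ?q" by (rule integrable_inverse_square_weight)
  have q': "integrable lborel (\<lambda>\<zeta>. ?q (\<zeta> + \<xi>))"
    using lborel_integrable_affine[OF q, of 1 \<xi>] by (simp add: add.commute)
  have "(LINT \<zeta>|lborel. ?q (\<zeta> + \<xi>)) = (LINT \<zeta>|lborel. ?q \<zeta>)"
    using lborel_integral_translate[of ?q \<xi>] q by (simp add: add.commute)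
  hence eq: "(LINT \<zeta>|lborel. 8 * decay \<xi> * (?q (\<zeta> + \<xi>) + ?q \<zeta>)) = decay_const * decay \<xi>"
    using q q' by (simp add: decay_const_def)
  have "(LINT \<zeta>|lborel. decay (\<zeta> + \<xi>) * decay \<zeta>) \<le> (LINT \<zeta>|lborel. 8 * decay \<xi> * (?q (\<zeta> + \<xi>) + ?q \<zeta>))"
    by (intro integral_mono integrable_decay_mult integrable_mult_right Bochner_Integration.integrable_add q q' decay_mult_le)
  thus ?thesis by (simp only: eq)
qed

lemma decay_const_nonneg: "decay_const \<ge> 0"
  by (simp add: decay_const_def)

section \<open>Profiles and the Duhamel operator\<close>

type_synonym profile = "(real \<times> (real^2)) \<Rightarrow>\<^sub>C complex"

text \<open>
  A bounded continuous \<open>a\<close> encodes the profile \<open>e^(-i t |\<xi>|^2) (F u)(t, \<xi>) = decay \<xi> * a (t, \<xi>)\<close>.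
\<close>

definition prof :: "profile \<Rightarrow> real \<Rightarrow> real^2 \<Rightarrow> complex" where
  "prof a t \<xi> = decay \<xi> * apply_bcontfun a (t, \<xi>)"

lemma prof_bound: "cmod (prof a t \<xi>) \<le> norm a * decay \<xi>"
  using norm_bounded[of a "(t, \<xi>)"] decay_pos[of \<xi>] by (simp add: prof_def norm_mult mult.commute)

lemma continuous_on_prof [continuous_intros]:
  assumes "continuous_on A f" "continuous_on A g"
  shows "continuous_on A (\<lambda>x. prof a (f x) (g x))"
proof -
  have "continuous_on A (\<lambda>x. apply_bcontfun a (f x, g x))"
    by (rule continuous_on_compose2[OF continuous_on_apply_bcontfun[of UNIV]]) (auto intro!: continuous_intros assms)
  thus ?thesis unfolding prof_def by (intro continuous_intros assms)
qed

lemma prof_measurable [measurable]: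
  assumes f[measurable]: "f \<in> borel_measurable M" and g[measurable]: "g \<in> borel_measurable M"
  shows "(\<lambda>x. prof a (f x) (g x)) \<in> borel_measurable M"
proof -
  have "(\<lambda>p. prof a (fst p) (snd p)) \<in> borel_measurable borel"
    by (intro borel_measurable_continuous_onI continuous_intros)
  from measurable_compose[OF borel_measurable_Pair[OF f g] this] show ?thesis by simp
qed

text \<open>The phase of the interaction is \<open>|\<zeta> + \<xi>|^2 - |\<zeta>|^2 - |\<xi>|^2 = 2 \<zeta>.\<xi>\<close>.\<close>

definition interact :: "profile \<Rightarrow> profile \<Rightarrow> real^2 \<Rightarrow> real \<times> (real^2) \<Rightarrow> complex" where
  "interact a b \<xi> z = cis (2 * fst z * (snd z \<bullet> \<xi>)) * (prof a (fst z) (snd z + \<xi>) * cnj (prof b (fst z) (snd z)))"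

lemma interact_measurable [measurable]:
  assumes [measurable]: "f \<in> borel_measurable M" "g \<in> borel_measurable M"
  shows "(\<lambda>x. interact a b (f x) (g x)) \<in> borel_measurable M"
proof -
  have [measurable]: "(\<lambda>x. fst (g x)) \<in> borel_measurable M" "(\<lambda>x. snd (g x)) \<in> borel_measurable M"
    by (rule measurable_compose[OF assms(2) borel_measurable_continuous_onI], intro continuous_intros)+
  show ?thesis unfolding interact_def by measurable
qed

lemma interact_bound: "cmod (interact a b \<xi> z) \<le> norm a * norm b * (decay (snd z + \<xi>) * decay (snd z))"
proof -
  have "cmod (prof a (fst z) (snd z + \<xi>)) * cmod (prof b (fst z) (snd z)) \<le> (norm a * decay (snd z + \<xi>)) * (norm b * decay (snd z))"
    by (intro mult_mono prof_bound) auto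
  thus ?thesis by (simp add: interact_def norm_mult mult_ac)
qed

text \<open>The time is clamped to \<open>[0,T]\<close>, so that profiles are bounded functions on all of \<open>\<real>\<close>.\<close>

definition duhamel :: "real \<Rightarrow> profile \<Rightarrow> profile \<Rightarrow> real \<Rightarrow> real^2 \<Rightarrow> complex" where
  "duhamel T a b t \<xi> = (LINT z|lborel. indicator {0..max 0 (min t T)} (fst z) *\<^sub>R interact a b \<xi> z)"

lemma integrable_time_decay:
  assumes f: "integrable lborel (f :: real^2 \<Rightarrow> real)"
  shows "integrable lborel (\<lambda>z::real \<times> (real^2). indicator {0..T} (fst z) * f (snd z))"
    and "(LINT z|lborel. indicator {0..T} (fst (z::real \<times> (real^2))) * f (snd z)) = max 0 T * (LINT \<xi>|lborel. f \<xi>)"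
proof -
  have i: "integrable lborel (indicator {0..T} :: real \<Rightarrow> real)"
    by (simp add: integrable_indicator_iff emeasure_lborel_Icc_eq)
  show 1: "integrable lborel (\<lambda>z::real \<times> (real^2). indicator {0..T} (fst z) * f (snd z))"
    using lborel_integrable_mult_pair[OF i f] by (simp add: lborel_prod case_prod_beta')
  have "(LINT \<tau>|lborel. LINT \<xi>|lborel. indicator {0..T} \<tau> * f \<xi>) = max 0 T * (LINT \<xi>|lborel. f \<xi>)"
    by (simp add: measure_def emeasure_lborel_Icc_eq max_def)
  moreover have "(LINT \<tau>|lborel. LINT \<xi>|lborel. indicator {0..T} \<tau> * f \<xi>) = (LINT z|lborel. indicator {0..T} (fst (z::real \<times> (real^2))) * f (snd z))"
    using lborel_pair.integral_fst'[of "\<lambda>z::real \<times> (real^2). indicator {0..T} (fst z) * f (snd z)"] 1 by (simp add: lborel_prod)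
  ultimately show "(LINT z|lborel. indicator {0..T} (fst (z::real \<times> (real^2))) * f (snd z)) = max 0 T * (LINT \<xi>|lborel. f \<xi>)"
    by (simp only:)
qed

lemma integrable_interact:
  "integrable lborel (\<lambda>z. indicator {0..T} (fst z) *\<^sub>R interact a b \<xi> z)"
proof (rule Bochner_Integration.integrable_bound)
  show "integrable lborel (\<lambda>z::real \<times> (real^2). (norm a * norm b) * (indicator {0..T} (fst z) * (decay (snd z + \<xi>) * decay (snd z))))"
    by (intro integrable_mult_right integrable_time_decay(1) integrable_decay_mult)
  show "AE z in lborel. norm (indicator {0..T} (fst z) *\<^sub>R interact a b \<xi> z)
     \<le> norm ((norm a * norm b) * (indicator {0..T} (fst z) * (decay (snd z + \<xi>) * decay (snd z))))"
    using interact_bound[of a b \<xi>] by (auto simp: indicator_def abs_mult)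
  have [measurable]: "(\<lambda>z::real \<times> (real^2). fst z) \<in> borel_measurable borel"
    by (intro borel_measurable_continuous_onI continuous_intros)
  show "(\<lambda>z. indicator {0..T} (fst z) *\<^sub>R interact a b \<xi> z) \<in> borel_measurable lborel" by measurable
qed

lemma duhamel_bound:
  assumes T: "T \<ge> 0" shows "cmod (duhamel T a b t \<xi>) \<le> norm a * norm b * (T * decay_const) * decay \<xi>"
proof -
  let ?t = "max 0 (min t T)"
  have "cmod (duhamel T a b t \<xi>) \<le> (LINT z|lborel. (norm a * norm b) * (indicator {0..?t} (fst (z::real \<times> (real^2))) * (decay (snd z + \<xi>) * decay (snd z))))"
    unfolding duhamel_def
  proof (rule Bochner_Integration.integral_norm_bound_integral[OF integrable_interact])
    show "integrable lborel (\<lambda>z::real \<times> (real^2). (norm a * norm b) * (indicator {0..?t} (fst z) * (decay (snd z + \<xi>) * decay (snd z))))"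
      by (intro integrable_mult_right integrable_time_decay(1) integrable_decay_mult)
    show "norm (indicator {0..?t} (fst z) *\<^sub>R interact a b \<xi> z) \<le> (norm a * norm b) * (indicator {0..?t} (fst z) * (decay (snd z + \<xi>) * decay (snd z)))" for z
      using interact_bound[of a b \<xi> z] by (auto simp: indicator_def)
  qed
  also have "\<dots> = (norm a * norm b) * (?t * (LINT \<zeta>|lborel. decay (\<zeta> + \<xi>) * decay \<zeta>))"
    by (simp add: integrable_time_decay(2)[OF integrable_decay_mult])
  also have "\<dots> \<le> (norm a * norm b) * (T * (decay_const * decay \<xi>))"
    using T decay_const_nonneg decay_pos[of \<xi>]
    by (intro mult_left_mono mult_mono decay_convolution integral_nonneg_AE) auto
  finally show ?thesis by (simp only: mult.assoc)
qed

text \<open>As a function of t, the indicator of {0..t} jumps only at points whose time coordinate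
  is t. They form a null set, which dominated convergence in \<open>continuous_on_duhamel\<close>
  can ignore.\<close>

lemma AE_fst_neq: "AE z in (lborel :: (real \<times> (real^2)) measure). fst z \<noteq> c"
proof -
  have "emeasure (lborel \<Otimes>\<^sub>M lborel) ({c} \<times> (UNIV :: (real^2) set)) = 0"
    by (subst lborel.emeasure_pair_measure_Times) auto
  hence "{c} \<times> UNIV \<in> null_sets (lborel :: (real \<times> (real^2)) measure)"
    by (auto simp: lborel_prod null_sets_def intro!: borel_closed closed_Times)
  from AE_not_in[OF this] show ?thesis by eventually_elim auto
qed

lemma continuous_on_duhamel:
  "continuous_on UNIV (\<lambda>p. duhamel T a b (fst p) (snd p))"
proof (rule continuous_on_sequentiallyI)
  fix u :: "nat \<Rightarrow> real \<times> (real^2)" and p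
  assume u: "u \<longlonglongrightarrow> p"
  let ?c = "\<lambda>t::real. max 0 (min t T)"
  have c: "(\<lambda>n. ?c (fst (u n))) \<longlonglongrightarrow> ?c (fst p)"
    by (intro tendsto_intros u)
  have [measurable]: "(\<lambda>z::real \<times> (real^2). fst z) \<in> borel_measurable borel"
    by (intro borel_measurable_continuous_onI continuous_intros)
  show "(\<lambda>n. duhamel T a b (fst (u n)) (snd (u n))) \<longlonglongrightarrow> duhamel T a b (fst p) (snd p)"
    unfolding duhamel_def
  proof (rule integral_dominated_convergence)
    show "integrable lborel (\<lambda>z::real \<times> (real^2). (norm a * norm b) * (indicator {0..T} (fst z) * decay (snd z)))"
      by (intro integrable_mult_right integrable_time_decay(1) integrable_decay)
    \<comment> \<open>For T < 0 the clamped time is 0 and {0..0} is not contained in {0..T};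
      discarding the null set of points at time 0 covers this case.\<close>
    show "AE z in lborel. norm (indicator {0..?c (fst (u n))} (fst z) *\<^sub>R interact a b (snd (u n)) z)
        \<le> (norm a * norm b) * (indicator {0..T} (fst z) * decay (snd z))" for n
      using AE_fst_neq[of 0]
    proof eventually_elim
      fix z :: "real \<times> (real^2)" assume z: "fst z \<noteq> 0"
      show "norm (indicator {0..?c (fst (u n))} (fst z) *\<^sub>R interact a b (snd (u n)) z)
        \<le> (norm a * norm b) * (indicator {0..T} (fst z) * decay (snd z))"
      proof (cases "fst z \<in> {0..?c (fst (u n))}")
        case True
        hence "fst z \<in> {0..T}" using z by auto
        moreover have "cmod (interact a b (snd (u n)) z) \<le> norm a * norm b * decay (snd z)"
        proof (rule order_trans[OF interact_bound], rule mult_left_mono)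
          show "decay (snd z + snd (u n)) * decay (snd z) \<le> decay (snd z)"
            using decay_pos[of "snd z"] decay_le_1[of "snd z + snd (u n)"] by simp
        qed simp
        ultimately show ?thesis using True by simp
      next
        case False thus ?thesis by simp
      qed
    qed
    show "AE z in lborel. (\<lambda>n. indicator {0..?c (fst (u n))} (fst z) *\<^sub>R interact a b (snd (u n)) z)
       \<longlonglongrightarrow> indicator {0..?c (fst p)} (fst z) *\<^sub>R interact a b (snd p) z"
      using AE_fst_neq[of "?c (fst p)"]
    proof eventually_elim
      fix z :: "real \<times> (real^2)" assume z: "fst z \<noteq> ?c (fst p)"
      have "continuous_on UNIV (\<lambda>\<xi>. interact a b \<xi> z)"
        unfolding interact_def by (intro continuous_intros)
      hence 1: "(\<lambda>n. interact a b (snd (u n)) z) \<longlonglongrightarrow> interact a b (snd p) z"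
        using continuous_on_tendsto_compose[of UNIV "\<lambda>\<xi>. interact a b \<xi> z" "\<lambda>n. snd (u n)" "snd p" sequentially] tendsto_snd[OF u] by simp
      have "eventually (\<lambda>n. (indicator {0..?c (fst (u n))} (fst z) :: real) = indicator {0..?c (fst p)} (fst z)) sequentially"
      proof (cases "fst z < ?c (fst p)")
        case True
        from order_tendstoD(1)[OF c True] show ?thesis
          by eventually_elim (use True in \<open>auto simp: indicator_def\<close>)
      next
        case False
        hence lt: "?c (fst p) < fst z" using z by linarith
        from order_tendstoD(2)[OF c lt] show ?thesis
          by eventually_elim (use lt in \<open>auto simp: indicator_def\<close>)
      qed
      hence "(\<lambda>n. indicator {0..?c (fst (u n))} (fst z) :: real) \<longlonglongrightarrow> indicator {0..?c (fst p)} (fst z)"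
        by (rule tendsto_eventually)
      from tendsto_scaleR[OF this 1]
      show "(\<lambda>n. indicator {0..?c (fst (u n))} (fst z) *\<^sub>R interact a b (snd (u n)) z)
       \<longlonglongrightarrow> indicator {0..?c (fst p)} (fst z) *\<^sub>R interact a b (snd p) z" .
    qed
  qed measurable
qed

text \<open>The Duhamel term as a map of profiles: division by \<open>decay\<close> undoes the
  factor in \<open>prof\<close>, and 1 / (2 \<pi>) comes from the transform of a product. It is
  antilinear in b, hence bilinear over the reals only.\<close>

definition profile_bilinear :: "complex \<Rightarrow> real \<Rightarrow> profile \<Rightarrow> profile \<Rightarrow> profile" where
  "profile_bilinear \<eta> T a b = Bcontfun (\<lambda>p. - \<i> * \<eta> / of_real (2 * pi) * (duhamel T a b (fst p) (snd p) / of_real (decay (snd p))))"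

lemma profile_bilinear_apply:
  assumes T: "T \<ge> 0"
  shows "apply_bcontfun (profile_bilinear \<eta> T a b) p = - \<i> * \<eta> / of_real (2 * pi) * (duhamel T a b (fst p) (snd p) / of_real (decay (snd p)))"
    and "cmod (apply_bcontfun (profile_bilinear \<eta> T a b) p) \<le> norm a * norm b * (cmod \<eta> / (2 * pi) * (T * decay_const))"
proof -
  let ?f = "\<lambda>p. - \<i> * \<eta> / of_real (2 * pi) * (duhamel T a b (fst p) (snd p) / of_real (decay (snd p)))"
  have b: "cmod (?f p) \<le> norm a * norm b * (cmod \<eta> / (2 * pi) * (T * decay_const))" for p
  proof -
    have "cmod (duhamel T a b (fst p) (snd p)) / decay (snd p) \<le> norm a * norm b * (T * decay_const)"
      using duhamel_bound[OF T, of a b "fst p" "snd p"] decay_pos[of "snd p"] by (simp add: divide_le_eq)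
    hence "cmod \<eta> / (2 * pi) * (cmod (duhamel T a b (fst p) (snd p)) / decay (snd p)) \<le> cmod \<eta> / (2 * pi) * (norm a * norm b * (T * decay_const))"
      by (intro mult_left_mono) auto
    moreover have "cmod (?f p) = cmod \<eta> / (2 * pi) * (cmod (duhamel T a b (fst p) (snd p)) / decay (snd p))"
      using decay_pos[of "snd p"] by (simp add: norm_mult norm_divide)
    ultimately show ?thesis by (simp only: mult_ac)
  qed
  have "?f \<in> bcontfun"
  proof (rule bcontfun_normI[OF _ b])
    show "continuous_on UNIV ?f"
      using decay_pos by (intro continuous_intros continuous_on_duhamel) (auto simp: less_imp_neq[symmetric])
  qed
  thus eq: "apply_bcontfun (profile_bilinear \<eta> T a b) p = ?f p"
    unfolding profile_bilinear_def by (simp add: Bcontfun_inverse)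
  show "cmod (apply_bcontfun (profile_bilinear \<eta> T a b) p) \<le> norm a * norm b * (cmod \<eta> / (2 * pi) * (T * decay_const))"
    unfolding eq by (rule b)
qed

lemma duhamel_linear:
  "duhamel T (a + a') b t \<xi> = duhamel T a b t \<xi> + duhamel T a' b t \<xi>"
  "duhamel T a (b + b') t \<xi> = duhamel T a b t \<xi> + duhamel T a b' t \<xi>"
  "duhamel T (r *\<^sub>R a) b t \<xi> = r *\<^sub>R duhamel T a b t \<xi>"
  "duhamel T a (r *\<^sub>R b) t \<xi> = r *\<^sub>R duhamel T a b t \<xi>"
proof -
  have l: "interact (a + a') b \<xi> z = interact a b \<xi> z + interact a' b \<xi> z"
    "interact a (b + b') \<xi> z = interact a b \<xi> z + interact a b' \<xi> z"
    "interact (r *\<^sub>R a) b \<xi> z = r *\<^sub>R interact a b \<xi> z"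
    "interact a (r *\<^sub>R b) \<xi> z = r *\<^sub>R interact a b \<xi> z" for z
    by (simp_all add: interact_def prof_def scaleR_conv_of_real algebra_simps)
  show "duhamel T (a + a') b t \<xi> = duhamel T a b t \<xi> + duhamel T a' b t \<xi>"
    "duhamel T a (b + b') t \<xi> = duhamel T a b t \<xi> + duhamel T a b' t \<xi>"
    unfolding duhamel_def l scaleR_add_right by (rule Bochner_Integration.integral_add[OF integrable_interact integrable_interact])+
  show "duhamel T (r *\<^sub>R a) b t \<xi> = r *\<^sub>R duhamel T a b t \<xi>"
    "duhamel T a (r *\<^sub>R b) t \<xi> = r *\<^sub>R duhamel T a b t \<xi>"
    by (simp_all only: duhamel_def l scaleR_left_commute[of _ r] Bochner_Integration.integral_scaleR_right)
qed

lemma bounded_bilinear_profile: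
  assumes T: "T \<ge> 0" shows "bounded_bilinear (profile_bilinear \<eta> T)"
proof
  fix a a' b b' :: profile and r :: real
  show "profile_bilinear \<eta> T (a + a') b = profile_bilinear \<eta> T a b + profile_bilinear \<eta> T a' b"
    "profile_bilinear \<eta> T a (b + b') = profile_bilinear \<eta> T a b + profile_bilinear \<eta> T a b'"
    "profile_bilinear \<eta> T (r *\<^sub>R a) b = r *\<^sub>R profile_bilinear \<eta> T a b"
    "profile_bilinear \<eta> T a (r *\<^sub>R b) = r *\<^sub>R profile_bilinear \<eta> T a b"
    by (rule bcontfun_eqI; simp only: profile_bilinear_apply(1)[OF T] duhamel_linear plus_bcontfun.rep_eq scaleR_bcontfun.rep_eq
      add_divide_distrib distrib_left scaleR_conv_of_real mult_ac times_divide_eq_right times_divide_eq_left)+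
  show "\<exists>K. \<forall>a b. norm (profile_bilinear \<eta> T a b) \<le> norm a * norm b * K"
    using norm_bound profile_bilinear_apply(2)[OF T] by blast
qed

section \<open>Smooth solutions for small data\<close>

lemma weight_decay_bound: "\<exists>C. \<forall>\<xi>. weight s \<xi> * decay \<xi> \<le> C"
proof -
  define n where "n = nat \<lceil>s\<rceil>"
  have n: "s \<le> real n" unfolding n_def by linarith
  have "weight s \<xi> * decay \<xi> \<le> 2 ^ n * (1 + fact (2 * n))" for \<xi>
  proof -
    let ?r = "norm \<xi>"
    have "weight s \<xi> \<le> (1 + ?r\<^sup>2) powr real n"
      unfolding weight_def using n by (intro powr_mono) auto
    also have "\<dots> = (1 + ?r\<^sup>2) ^ n" using one_plus_norm_pos[of \<xi>] by (rule powr_realpow)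
    also have "\<dots> \<le> 2 ^ n * (1 + ?r ^ (2 * n))" by (rule one_plus_square_power_le)
    finally have w: "weight s \<xi> \<le> 2 ^ n * (1 + ?r ^ (2 * n))" .
    have "?r ^ (2 * n) / fact (2 * n) \<le> exp ?r" by (rule power_fact_le_exp) simp
    hence "?r ^ (2 * n) \<le> exp ?r * fact (2 * n)" by (simp only: pos_divide_le_eq[OF fact_gt_zero])
    moreover have "1 \<le> exp ?r" by simp
    ultimately have e: "1 + ?r ^ (2 * n) \<le> exp ?r * (1 + fact (2 * n))"
      unfolding distrib_left mult_1_right by (rule add_mono[rotated])
    have d: "decay \<xi> \<le> exp (- ?r)"
    proof -
      have "1 \<le> (1 + ?r\<^sup>2)\<^sup>2" by (rule one_le_power) simp
      hence "1 / (1 + ?r\<^sup>2)\<^sup>2 \<le> 1" using one_plus_norm_pos[of \<xi>] by (simp add: divide_le_eq_1)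
      from mult_left_mono[OF this, of "exp (- ?r)"] show ?thesis unfolding decay_def by simp
    qed
    have "weight s \<xi> * decay \<xi> \<le> (2 ^ n * (exp ?r * (1 + fact (2 * n)))) * exp (- ?r)"
      by (rule mult_mono[OF order_trans[OF w] d]) (auto intro!: mult_left_mono e)
    also have "\<dots> = 2 ^ n * (1 + fact (2 * n))" by (simp add: exp_minus field_simps)
    finally show ?thesis .
  qed
  thus ?thesis by blast
qed

text \<open>One factor \<open>decay\<close> absorbs the Sobolev weight and the other is integrable.
  The third claim supplies the dominating function for continuity in time.\<close>

lemma integrable_weight_decay:
  fixes f :: "real^2 \<Rightarrow> complex"
  assumes [measurable]: "f \<in> borel_measurable borel" and f: "\<And>\<xi>. cmod (f \<xi>) \<le> B * decay \<xi>"
  shows "integrable lborel f" "integrable lborel (\<lambda>\<xi>. weight s \<xi> * (cmod (f \<xi>))\<^sup>2)"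
    "integrable lborel (\<lambda>\<xi>. weight s \<xi> * (B * decay \<xi>)\<^sup>2)"
proof -
  obtain C where C: "\<And>\<xi>. weight s \<xi> * decay \<xi> \<le> C" using weight_decay_bound by blast
  show "integrable lborel f"
  proof (rule Bochner_Integration.integrable_bound)
    show "integrable lborel (\<lambda>\<xi>. B * decay \<xi>)" by (intro integrable_mult_right integrable_decay)
    show "AE \<xi> in lborel. norm (f \<xi>) \<le> norm (B * decay \<xi>)" using f by (auto intro: order_trans[OF _ abs_ge_self])
  qed auto
  show 2: "integrable lborel (\<lambda>\<xi>. weight s \<xi> * (B * decay \<xi>)\<^sup>2)"
  proof (rule Bochner_Integration.integrable_bound)
    show "integrable lborel (\<lambda>\<xi>. (B\<^sup>2 * C) * decay \<xi>)" by (intro integrable_mult_right integrable_decay)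
    show "AE \<xi> in lborel. norm (weight s \<xi> * (B * decay \<xi>)\<^sup>2) \<le> norm ((B\<^sup>2 * C) * decay \<xi>)"
    proof (rule AE_I2)
      fix \<xi>
      have "weight s \<xi> * (B * decay \<xi>)\<^sup>2 = B\<^sup>2 * (weight s \<xi> * decay \<xi>) * decay \<xi>" by (simp add: power2_eq_square)
      also have "\<dots> \<le> B\<^sup>2 * C * decay \<xi>" by (intro mult_right_mono mult_left_mono C) auto
      finally show "norm (weight s \<xi> * (B * decay \<xi>)\<^sup>2) \<le> norm ((B\<^sup>2 * C) * decay \<xi>)"
        using weight_pos[of s \<xi>] by (simp add: less_imp_le)
    qed
  qed auto
  show "integrable lborel (\<lambda>\<xi>. weight s \<xi> * (cmod (f \<xi>))\<^sup>2)"
  proof (rule Bochner_Integration.integrable_bound[OF 2])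
    have "weight s \<xi> * (cmod (f \<xi>))\<^sup>2 \<le> weight s \<xi> * (B * decay \<xi>)\<^sup>2" for \<xi>
      using weight_pos[of s \<xi>] f by (intro mult_left_mono power_mono) auto
    thus "AE \<xi> in lborel. norm (weight s \<xi> * (cmod (f \<xi>))\<^sup>2) \<le> norm (weight s \<xi> * (B * decay \<xi>)\<^sup>2)"
      using weight_pos[of s] by (simp add: abs_mult less_imp_le)
  qed auto
qed

lemma dist_of_diff:
  assumes "integrable lborel a" "integrable lborel b"
  shows "dist_of a - dist_of b = dist_of (\<lambda>\<xi>. a \<xi> - b \<xi>)"
proof
  fix \<phi>
  show "(dist_of a - dist_of b) \<phi> = dist_of (\<lambda>\<xi>. a \<xi> - b \<xi>) \<phi>"
    by (cases "\<phi> \<in> schwartz")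
       (simp_all add: dist_of_def left_diff_distrib integrable_mult_schwartz assms schwartz_inv_fourier)
qed

lemma sobolev_nrm_dist_of:
  assumes "integrable lborel v"
  shows "nrm (sobolev s) (dist_of v) = sqrt (LINT \<xi>|lborel. weight s \<xi> * (cmod (v \<xi>))\<^sup>2)"
  by (rule sobolev_nrm_eq(1)) (simp add: dist_fourier_dist_of represents_regular_dist assms)

text \<open>The Fourier transform of u(t): the phase removed in passing to profiles is put
  back.\<close>

definition evolve :: "profile \<Rightarrow> real \<Rightarrow> real^2 \<Rightarrow> complex" where
  "evolve v t \<xi> = cis (t * (norm \<xi>)\<^sup>2) * prof v t \<xi>"

lemma evolve_bound: "cmod (evolve v t \<xi>) \<le> norm v * decay \<xi>"
  using prof_bound by (simp add: evolve_def norm_mult)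

lemma evolve_measurable [measurable]: "evolve v t \<in> borel_measurable borel"
  unfolding evolve_def[abs_def] by measurable

lemma integrable_evolve: "integrable lborel (evolve v t)"
  by (rule integrable_weight_decay(1)[OF evolve_measurable evolve_bound])

text \<open>Dominated convergence: the profile is continuous in time, and the weight times the
  square of 2 |v| \<open>decay\<close> is integrable for every s, so a single profile is continuous
  into all H^k.\<close>

lemma continuous_into_evolve: "continuous_into T (sobolev s) (\<lambda>t. dist_of (evolve v t))"
  unfolding continuous_into_def
proof (intro ballI conjI)
  fix t
  show "dist_of (evolve v t) \<in> vecs (sobolev s)"
    by (intro dist_of_in_sobolev integrable_evolve integrable_weight_decay(2)[OF evolve_measurable evolve_bound])
  have eq: "nrm (sobolev s) (dist_of (evolve v t') - dist_of (evolve v t))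
     = sqrt (LINT \<xi>|lborel. weight s \<xi> * (cmod (evolve v t' \<xi> - evolve v t \<xi>))\<^sup>2)" for t'
    by (simp add: dist_of_diff integrable_evolve sobolev_nrm_dist_of)
  have b: "cmod (evolve v t' \<xi> - evolve v t \<xi>) \<le> (2 * norm v) * decay \<xi>" for t' \<xi>
    using norm_triangle_ineq4[of "evolve v t' \<xi>" "evolve v t \<xi>"] evolve_bound[of v t' \<xi>] evolve_bound[of v t \<xi>] by simp
  have "((\<lambda>t'. sqrt (LINT \<xi>|lborel. weight s \<xi> * (cmod (evolve v t' \<xi> - evolve v t \<xi>))\<^sup>2)) \<longlongrightarrow> sqrt 0) (at t within {0..T})"
  proof (rule tendsto_real_sqrt, unfold tendsto_at_iff_sequentially comp_def, intro allI impI)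
    fix X assume X: "X \<longlonglongrightarrow> t"
    have "(\<lambda>n. LINT \<xi>|lborel. weight s \<xi> * (cmod (evolve v (X n) \<xi> - evolve v t \<xi>))\<^sup>2) \<longlonglongrightarrow> (LINT \<xi>::real^2|lborel. 0)"
    proof (rule integral_dominated_convergence)
      show "integrable lborel (\<lambda>\<xi>. weight s \<xi> * ((2 * norm v) * decay \<xi>)\<^sup>2)"
        by (rule integrable_weight_decay(3)[where f = "\<lambda>\<xi>. evolve v 0 \<xi> - evolve v t \<xi>"]) (auto intro: b)
      show "AE \<xi> in lborel. norm (weight s \<xi> * (cmod (evolve v (X n) \<xi> - evolve v t \<xi>))\<^sup>2) \<le> weight s \<xi> * ((2 * norm v) * decay \<xi>)\<^sup>2" for n
        using weight_pos[of s] b by (auto simp: abs_mult less_imp_le intro!: mult_left_mono power_mono)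
      show "AE \<xi> in lborel. (\<lambda>n. weight s \<xi> * (cmod (evolve v (X n) \<xi> - evolve v t \<xi>))\<^sup>2) \<longlonglongrightarrow> 0"
      proof (rule AE_I2)
        fix \<xi>
        have "continuous_on UNIV (\<lambda>t. evolve v t \<xi>)" unfolding evolve_def by (intro continuous_intros)
        hence "(\<lambda>n. evolve v (X n) \<xi>) \<longlonglongrightarrow> evolve v t \<xi>"
          using X continuous_on_tendsto_compose[of UNIV "\<lambda>t. evolve v t \<xi>" X t sequentially] by simp
        hence "(\<lambda>n. weight s \<xi> * (cmod (evolve v (X n) \<xi> - evolve v t \<xi>))\<^sup>2) \<longlonglongrightarrow> weight s \<xi> * (cmod (evolve v t \<xi> - evolve v t \<xi>))\<^sup>2"
          by (intro tendsto_intros)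
        thus "(\<lambda>n. weight s \<xi> * (cmod (evolve v (X n) \<xi> - evolve v t \<xi>))\<^sup>2) \<longlonglongrightarrow> 0" by simp
      qed
    qed auto
    thus "(\<lambda>n. LINT \<xi>|lborel. weight s \<xi> * (cmod (evolve v (X n) \<xi> - evolve v t \<xi>))\<^sup>2) \<longlonglongrightarrow> 0" by simp
  qed
  thus "((\<lambda>t'. nrm (sobolev s) (dist_of (evolve v t') - dist_of (evolve v t))) \<longlongrightarrow> 0) (at t within {0..T})"
    unfolding eq by simp
qed

lemma evolve_product:
  "evolve v t (\<zeta> + \<xi>) * cnj (evolve v t \<zeta>) = cis (t * (norm \<xi>)\<^sup>2) * interact v v \<xi> (t, \<zeta>)"
proof -
  have "cis (t * (norm (\<zeta> + \<xi>))\<^sup>2) * cnj (cis (t * (norm \<zeta>)\<^sup>2)) = cis (t * (norm \<xi>)\<^sup>2) * cis (2 * t * (\<zeta> \<bullet> \<xi>))"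
    unfolding power2_norm_eq_inner cis_cnj cis_mult
    by (simp add: inner_add_left inner_add_right inner_commute algebra_simps)
  thus ?thesis by (simp add: evolve_def interact_def)
qed

definition slice :: "profile \<Rightarrow> real \<Rightarrow> real^2 \<Rightarrow> complex" where
  "slice v \<tau> \<xi> = (LINT \<zeta>|lborel. interact v v \<xi> (\<tau>, \<zeta>))"

lemma integrable_interact_slice: "integrable lborel (\<lambda>\<zeta>. interact v v \<xi> (\<tau>, \<zeta>))"
proof (rule Bochner_Integration.integrable_bound)
  show "integrable lborel (\<lambda>\<zeta>. (norm v * norm v) * (decay (\<zeta> + \<xi>) * decay \<zeta>))"
    by (intro integrable_mult_right integrable_decay_mult)
  show "AE \<zeta> in lborel. norm (interact v v \<xi> (\<tau>, \<zeta>)) \<le> norm ((norm v * norm v) * (decay (\<zeta> + \<xi>) * decay \<zeta>))"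
    using interact_bound[of v v \<xi>] by (force simp: abs_mult)
qed measurable

lemma slice_bound: "cmod (slice v \<tau> \<xi>) \<le> norm v * norm v * decay_const"
proof -
  have "cmod (slice v \<tau> \<xi>) \<le> (LINT \<zeta>|lborel. (norm v * norm v) * (decay (\<zeta> + \<xi>) * decay \<zeta>))"
    unfolding slice_def
  proof (rule Bochner_Integration.integral_norm_bound_integral[OF integrable_interact_slice])
    show "integrable lborel (\<lambda>\<zeta>. (norm v * norm v) * (decay (\<zeta> + \<xi>) * decay \<zeta>))"
      by (intro integrable_mult_right integrable_decay_mult)
    show "norm (interact v v \<xi> (\<tau>, \<zeta>)) \<le> (norm v * norm v) * (decay (\<zeta> + \<xi>) * decay \<zeta>)" for \<zeta>
      using interact_bound[of v v \<xi> "(\<tau>, \<zeta>)"] by simp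
  qed
  also have "\<dots> = (norm v * norm v) * (LINT \<zeta>|lborel. decay (\<zeta> + \<xi>) * decay \<zeta>)" by simp
  also have "\<dots> \<le> (norm v * norm v) * (decay_const * 1)"
    using order_trans[OF decay_convolution[of \<xi>] mult_left_mono[OF decay_le_1[of \<xi>] decay_const_nonneg]]
    by (intro mult_left_mono) auto
  finally show ?thesis by simp
qed

lemma slice_measurable [measurable]:
  assumes [measurable]: "f \<in> borel_measurable M" "g \<in> borel_measurable M"
  shows "(\<lambda>x. slice v (f x) (g x)) \<in> borel_measurable M"
  unfolding slice_def by measurable

lemma duhamel_slice:
  assumes "t \<in> {0..T}"
  shows "duhamel T v v t \<xi> = (LINT \<tau>|lborel. indicator {0..t} \<tau> *\<^sub>R slice v \<tau> \<xi>)"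
proof -
  have "max 0 (min t T) = t" using assms by auto
  hence "duhamel T v v t \<xi> = (LINT z|(lborel \<Otimes>\<^sub>M lborel). indicator {0..t} (fst z) *\<^sub>R interact v v \<xi> z)"
    by (simp add: duhamel_def lborel_prod)
  also have "\<dots> = (LINT \<tau>|lborel. LINT \<zeta>|lborel. indicator {0..t} \<tau> *\<^sub>R interact v v \<xi> (\<tau>, \<zeta>))"
    using lborel_pair.integral_fst'[of "\<lambda>z. indicator {0..t} (fst z) *\<^sub>R interact v v \<xi> z"] integrable_interact[of t v v \<xi>]
    by (simp add: lborel_prod)
  finally show ?thesis by (simp add: slice_def)
qed

text \<open>On the Fourier side the group over time t - \<tau> contributes e^(i (t - \<tau>)
  |\<xi>|^2) and \<open>evolve_product\<close> contributes e^(i \<tau> |\<xi>|^2). Their product is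
  independent of \<tau> and is absorbed into h, so Fubini turns the time integral of pairings into
  the pairing of h with \<open>duhamel\<close>.\<close>

lemma smooth_solution_evolve:
  assumes T: "T > 0" and g: "integrable lborel g"
    and eq: "\<And>t \<xi>. t \<in> {0..T} \<Longrightarrow> prof v t \<xi> = g \<xi> - \<i> * \<eta> / of_real (2 * pi) * duhamel T v v t \<xi>"
  shows "smooth_solution \<eta> T (dist_of g) (\<lambda>t. dist_of (evolve v t))"
  unfolding smooth_solution_def
proof (intro conjI allI ballI)
  show "continuous_into T (sobolev (real k)) (\<lambda>t. dist_of (evolve v t))" for k
    by (rule continuous_into_evolve)
  fix t \<phi> assume t: "t \<in> {0..T}" and \<phi>: "\<phi> \<in> schwartz"
  let ?\<psi> = "inv_fourier \<phi>"
  let ?F = "\<lambda>t'. schroedinger_group (t - t') (abs_square (dist_of (evolve v t'))) \<phi>"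
  define h where "h = (\<lambda>\<xi>. cis (t * (norm \<xi>)\<^sup>2) * ?\<psi> \<xi>)"
  have \<psi>: "?\<psi> \<in> schwartz" by (rule schwartz_inv_fourier[OF \<phi>])
  have hs: "h \<in> schwartz" unfolding h_def by (rule schwartz_mult_cis[OF \<psi>])
  have [measurable]: "h \<in> borel_measurable borel" using hs by simp
  have F: "?F \<tau> = (LINT \<xi>|lborel. h \<xi> * slice v \<tau> \<xi>) / of_real (2 * pi)" for \<tau>
  proof -
    have "(LINT \<zeta>|lborel. evolve v \<tau> (\<zeta> + \<xi>) * cnj (evolve v \<tau> \<zeta>)) * (cis ((t - \<tau>) * (norm \<xi>)\<^sup>2) * ?\<psi> \<xi>) = h \<xi> * slice v \<tau> \<xi>" for \<xi>
    proof -
      have "cis (\<tau> * (norm \<xi>)\<^sup>2) * cis ((t - \<tau>) * (norm \<xi>)\<^sup>2) = cis (t * (norm \<xi>)\<^sup>2)"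
        unfolding cis_mult by (simp add: algebra_simps)
      thus ?thesis unfolding evolve_product h_def slice_def by (simp add: mult_ac)
    qed
    moreover have "cmod (evolve v \<tau> \<xi>) \<le> norm v" for \<xi>
      using evolve_bound[of v \<tau> \<xi>] mult_left_le[OF decay_le_1[of \<xi>] norm_ge_zero[of v]] by linarith
    ultimately show ?thesis
      using schroedinger_group_abs_square_dist_of[OF integrable_evolve _ \<phi>, of v \<tau> "norm v" "t - \<tau>"] by simp
  qed
  have G: "integrable (lborel \<Otimes>\<^sub>M lborel) (\<lambda>(\<tau>, \<xi>). indicator {0..t} \<tau> *\<^sub>R (h \<xi> * slice v \<tau> \<xi>))"
  proof -
    have "integrable lborel (\<lambda>\<tau>. complex_of_real (indicator {0..t} \<tau>))"
      unfolding complex_of_real_integrable_eq by (simp add: integrable_indicator_iff emeasure_lborel_Icc_eq)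
    from lborel_integrable_mult_pair[OF this schwartz_integrable[OF hs]]
    have "integrable (lborel \<Otimes>\<^sub>M lborel) (\<lambda>z. slice v (fst z) (snd z) * (case z of (\<tau>, \<xi>) \<Rightarrow> of_real (indicator {0..t} \<tau>) * h \<xi>))"
      by (rule integrable_mult_bounded[OF _ _ slice_bound]) measurable
    thus ?thesis by (simp add: case_prod_beta' scaleR_conv_of_real mult_ac)
  qed
  have FG: "indicator {0..t} \<tau> *\<^sub>R ?F \<tau> = (LINT \<xi>|lborel. indicator {0..t} \<tau> *\<^sub>R (h \<xi> * slice v \<tau> \<xi>)) / of_real (2 * pi)" for \<tau>
    unfolding F by (simp add: scaleR_conv_of_real)
  have "integrable lborel (\<lambda>\<tau>. (LINT \<xi>|lborel. indicator {0..t} \<tau> *\<^sub>R (h \<xi> * slice v \<tau> \<xi>)) / of_real (2 * pi))"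
    using lborel_pair.integrable_fst'[OF G] by simp
  hence si: "set_integrable lborel {0..t} ?F" unfolding set_integrable_def FG .
  have "integral {0..t} ?F = (LINT \<tau>:{0..t}|lborel. ?F \<tau>)"
    using set_borel_integral_eq_integral(2)[OF si] by simp
  also have "\<dots> = (LINT \<tau>|lborel. LINT \<xi>|lborel. indicator {0..t} \<tau> *\<^sub>R (h \<xi> * slice v \<tau> \<xi>)) / of_real (2 * pi)"
    unfolding set_lebesgue_integral_def FG by simp
  also have "(LINT \<tau>|lborel. LINT \<xi>|lborel. indicator {0..t} \<tau> *\<^sub>R (h \<xi> * slice v \<tau> \<xi>))
     = (LINT \<xi>|lborel. LINT \<tau>|lborel. indicator {0..t} \<tau> *\<^sub>R (h \<xi> * slice v \<tau> \<xi>))"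
    using lborel_pair.Fubini_integral[OF G] by simp
  also have "\<dots> = (LINT \<xi>|lborel. h \<xi> * duhamel T v v t \<xi>)"
    unfolding duhamel_slice[OF t] by (simp flip: mult_scaleR_right)
  finally have I: "integral {0..t} ?F = (LINT \<xi>|lborel. h \<xi> * duhamel T v v t \<xi>) / of_real (2 * pi)" .
  have hd: "integrable lborel (\<lambda>\<xi>. h \<xi> * duhamel T v v t \<xi>)"
  proof -
    have "integrable lborel (duhamel T v v t)"
    proof (rule integrable_weight_decay(1))
      have "continuous_on UNIV (\<lambda>\<xi>. duhamel T v v (fst (t, \<xi>)) (snd (t, \<xi>)))"
        by (rule continuous_on_compose2[OF continuous_on_duhamel]) (auto intro!: continuous_intros)
      thus "duhamel T v v t \<in> borel_measurable borel" by (simp add: borel_measurable_continuous_onI)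
      show "cmod (duhamel T v v t \<xi>) \<le> (norm v * norm v * (T * decay_const)) * decay \<xi>" for \<xi>
        using duhamel_bound[of T] T by simp
    qed
    from integrable_mult_schwartz[OF this hs] show ?thesis by (simp add: mult.commute)
  qed
  have gh: "integrable lborel (\<lambda>\<xi>. g \<xi> * h \<xi>)" by (rule integrable_mult_schwartz[OF g hs])
  have "dist_of (evolve v t) \<phi> = (LINT \<xi>|lborel. g \<xi> * h \<xi> - \<i> * \<eta> / of_real (2 * pi) * (h \<xi> * duhamel T v v t \<xi>))"
    using \<phi> by (simp add: dist_of_def evolve_def eq[OF t] h_def algebra_simps)
  also have "\<dots> = (LINT \<xi>|lborel. g \<xi> * h \<xi>) - \<i> * \<eta> / of_real (2 * pi) * (LINT \<xi>|lborel. h \<xi> * duhamel T v v t \<xi>)"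
    using gh hd by simp
  also have "\<dots> = schroedinger_group t (dist_of g) \<phi> - \<i> * \<eta> * integral {0..t} ?F"
    unfolding I schroedinger_group_dist_of[OF \<phi>] h_def by simp
  finally show "dist_of (evolve v t) \<phi> = schroedinger_group t (dist_of g) \<phi> - \<i> * \<eta> * integral {0..t} ?F" .
  show "?F integrable_on {0..t}" by (rule set_borel_integral_eq_integral(1)[OF si])
qed

text \<open>The Duhamel term of the free evolution of g at time T, in profile variables and without
  the constant - i \<eta> / (2 \<pi>).\<close>

definition second_iterate :: "real \<Rightarrow> (real^2 \<Rightarrow> complex) \<Rightarrow> real^2 \<Rightarrow> complex" where
  "second_iterate T g \<xi> = (LINT \<tau>|lborel. indicator {0..T} \<tau> *\<^sub>R (LINT \<zeta>|lborel. cis (2 * \<tau> * (\<zeta> \<bullet> \<xi>)) * (g (\<zeta> + \<xi>) * cnj (g \<zeta>))))"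

text \<open>The free evolution of g has the profile g / \<open>decay\<close>, constant in time. The
  fixed point for \<epsilon> times this profile has a cubic error in the supremum norm, and pairing
  with \<psi> costs only the integral of \<open>decay\<close> |\<psi>|.\<close>

lemma smooth_solution_expansion:
  assumes T: "T > 0" and g: "continuous_on UNIV g" and gB: "\<And>\<xi>. cmod (g \<xi>) \<le> B * decay \<xi>"
  shows "\<exists>r>0. \<exists>C u. \<forall>\<epsilon>. 0 \<le> \<epsilon> \<and> \<epsilon> < r \<longrightarrow>
    smooth_solution \<eta> T (dist_of (\<lambda>\<xi>. of_real \<epsilon> * g \<xi>)) (u \<epsilon>) \<and>
    (\<forall>\<psi>\<in>schwartz. cmod (u \<epsilon> T (fourier \<psi>)
        - of_real \<epsilon> * (LINT \<xi>|lborel. cis (T * (norm \<xi>)\<^sup>2) * g \<xi> * \<psi> \<xi>)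
        - of_real \<epsilon> ^ 2 * (- \<i> * \<eta> / of_real (2 * pi) * (LINT \<xi>|lborel. cis (T * (norm \<xi>)\<^sup>2) * second_iterate T g \<xi> * \<psi> \<xi>)))
      \<le> C * \<epsilon> ^ 3 * (LINT \<xi>|lborel. decay \<xi> * cmod (\<psi> \<xi>)))"
proof -
  have gm[measurable]: "g \<in> borel_measurable borel" using g by (rule borel_measurable_continuous_onI)
  define \<gamma> :: profile where "\<gamma> = Bcontfun (\<lambda>p. g (snd p) / of_real (decay (snd p)))"
  have "(\<lambda>p::real \<times> (real^2). g (snd p) / of_real (decay (snd p))) \<in> bcontfun"
  proof (rule bcontfun_normI)
    show "continuous_on UNIV (\<lambda>p::real \<times> (real^2). g (snd p) / of_real (decay (snd p)))"
      using decay_pos by (intro continuous_intros continuous_on_compose2[OF g]) (auto simp: less_imp_neq[symmetric])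
    show "cmod (g (snd p) / of_real (decay (snd p))) \<le> B" for p :: "real \<times> (real^2)"
      using gB[of "snd p"] decay_pos[of "snd p"] by (simp add: norm_divide divide_le_eq)
  qed
  hence \<gamma>: "apply_bcontfun \<gamma> p = g (snd p) / of_real (decay (snd p))" for p
    by (simp add: \<gamma>_def Bcontfun_inverse)
  have prof_\<gamma>: "prof \<gamma> t \<xi> = g \<xi>" for t \<xi>
    using decay_pos[of \<xi>] by (simp add: prof_def \<gamma>)
  have D: "duhamel T \<gamma> \<gamma> T \<xi> = second_iterate T g \<xi>" for \<xi>
    using T by (subst duhamel_slice) (simp_all add: second_iterate_def slice_def interact_def prof_\<gamma>)
  let ?Q = "profile_bilinear \<eta> T"
  have Q: "of_real (decay \<xi>) * apply_bcontfun (?Q a a) (t, \<xi>) = - \<i> * \<eta> / of_real (2 * pi) * duhamel T a a t \<xi>" for a t \<xi>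
    using decay_pos[of \<xi>] T by (simp add: profile_bilinear_apply(1))
  obtain \<delta> C where \<delta>: "\<delta> > 0"
    and sol: "\<And>g. norm g \<le> \<delta> \<Longrightarrow> \<exists>v. v = g + ?Q v v \<and> norm (v - g - ?Q g g) \<le> C * norm g ^ 3"
    using quadratic_fixed_point[OF bounded_bilinear_profile[OF less_imp_le[OF T], of \<eta>]] by metis
  \<comment> \<open>The summand 1 covers the case \<gamma> = 0.\<close>
  define r where "r = \<delta> / (norm \<gamma> + 1)"
  have r: "r > 0" using \<delta> by (simp add: r_def add_nonneg_pos)
  have "\<forall>\<epsilon>. \<exists>v. 0 \<le> \<epsilon> \<and> \<epsilon> < r \<longrightarrow> v = \<epsilon> *\<^sub>R \<gamma> + ?Q v v \<and> norm (v - \<epsilon> *\<^sub>R \<gamma> - ?Q (\<epsilon> *\<^sub>R \<gamma>) (\<epsilon> *\<^sub>R \<gamma>)) \<le> C * norm (\<epsilon> *\<^sub>R \<gamma>) ^ 3"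
  proof
    fix \<epsilon>
    have "norm (\<epsilon> *\<^sub>R \<gamma>) \<le> \<delta>" if "0 \<le> \<epsilon>" "\<epsilon> < r"
    proof -
      have "\<epsilon> * norm \<gamma> \<le> r * (norm \<gamma> + 1)" using that r by (intro mult_mono) auto
      also have "\<dots> = \<delta>" using norm_ge_zero[of \<gamma>] unfolding r_def by (simp add: add_nonneg_eq_0_iff)
      finally show ?thesis using that by simp
    qed
    thus "\<exists>v. 0 \<le> \<epsilon> \<and> \<epsilon> < r \<longrightarrow> v = \<epsilon> *\<^sub>R \<gamma> + ?Q v v \<and> norm (v - \<epsilon> *\<^sub>R \<gamma> - ?Q (\<epsilon> *\<^sub>R \<gamma>) (\<epsilon> *\<^sub>R \<gamma>)) \<le> C * norm (\<epsilon> *\<^sub>R \<gamma>) ^ 3"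
      using sol by blast
  qed
  then obtain v where v: "\<And>\<epsilon>. 0 \<le> \<epsilon> \<Longrightarrow> \<epsilon> < r \<Longrightarrow> v \<epsilon> = \<epsilon> *\<^sub>R \<gamma> + ?Q (v \<epsilon>) (v \<epsilon>)"
    "\<And>\<epsilon>. 0 \<le> \<epsilon> \<Longrightarrow> \<epsilon> < r \<Longrightarrow> norm (v \<epsilon> - \<epsilon> *\<^sub>R \<gamma> - ?Q (\<epsilon> *\<^sub>R \<gamma>) (\<epsilon> *\<^sub>R \<gamma>)) \<le> C * norm (\<epsilon> *\<^sub>R \<gamma>) ^ 3"
    by metis
  have gi: "integrable lborel g" by (rule integrable_weight_decay(1)[OF gm gB])
  show ?thesis
  proof (intro exI conjI allI impI ballI; (elim conjE)?)
    show "r > 0" by fact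
    fix \<epsilon> :: real assume \<epsilon>: "0 \<le> \<epsilon>" "\<epsilon> < r"
    note v1 = v(1)[OF \<epsilon>] and v2 = v(2)[OF \<epsilon>]
    show "smooth_solution \<eta> T (dist_of (\<lambda>\<xi>. of_real \<epsilon> * g \<xi>)) ((\<lambda>\<epsilon> t. dist_of (evolve (v \<epsilon>) t)) \<epsilon>)"
    proof (rule smooth_solution_evolve[OF T])
      show "integrable lborel (\<lambda>\<xi>. of_real \<epsilon> * g \<xi>)" using gi by simp
      fix t \<xi>
      have "prof (v \<epsilon>) t \<xi> = of_real (decay \<xi>) * apply_bcontfun (\<epsilon> *\<^sub>R \<gamma> + ?Q (v \<epsilon>) (v \<epsilon>)) (t, \<xi>)"
        unfolding prof_def v1[symmetric] ..
      also have "\<dots> = of_real \<epsilon> * prof \<gamma> t \<xi> + of_real (decay \<xi>) * apply_bcontfun (?Q (v \<epsilon>) (v \<epsilon>)) (t, \<xi>)"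
        by (simp add: prof_def distrib_left scaleR_conv_of_real)
      finally show "prof (v \<epsilon>) t \<xi> = of_real \<epsilon> * g \<xi> - \<i> * \<eta> / of_real (2 * pi) * duhamel T (v \<epsilon>) (v \<epsilon>) t \<xi>"
        by (simp only: Q prof_\<gamma>) simp
    qed
    fix \<psi> assume \<psi>: "\<psi> \<in> schwartz"
    let ?E = "v \<epsilon> - \<epsilon> *\<^sub>R \<gamma> - ?Q (\<epsilon> *\<^sub>R \<gamma>) (\<epsilon> *\<^sub>R \<gamma>)"
    let ?c = "\<lambda>\<xi>::real^2. cis (T * (norm \<xi>)\<^sup>2)"
    have pw: "evolve (v \<epsilon>) T \<xi> * \<psi> \<xi> = of_real \<epsilon> * (?c \<xi> * g \<xi> * \<psi> \<xi>)
       + of_real \<epsilon> ^ 2 * (- \<i> * \<eta> / of_real (2 * pi) * (?c \<xi> * second_iterate T g \<xi> * \<psi> \<xi>)) + evolve ?E T \<xi> * \<psi> \<xi>" for \<xi>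
    proof -
      have dd: "duhamel T (\<epsilon> *\<^sub>R \<gamma>) (\<epsilon> *\<^sub>R \<gamma>) T \<xi> = of_real \<epsilon> ^ 2 * second_iterate T g \<xi>"
        by (simp add: duhamel_linear D scaleR_conv_of_real power2_eq_square)
      have "prof ?E T \<xi> = prof (v \<epsilon>) T \<xi> - of_real \<epsilon> * prof \<gamma> T \<xi> - of_real (decay \<xi>) * apply_bcontfun (?Q (\<epsilon> *\<^sub>R \<gamma>) (\<epsilon> *\<^sub>R \<gamma>)) (T, \<xi>)"
        by (simp add: prof_def right_diff_distrib scaleR_conv_of_real)
      hence "prof (v \<epsilon>) T \<xi> = of_real \<epsilon> * g \<xi> + (- \<i> * \<eta> / of_real (2 * pi)) * (of_real \<epsilon> ^ 2 * second_iterate T g \<xi>) + prof ?E T \<xi>"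
        by (simp only: Q dd prof_\<gamma>) simp
      thus ?thesis unfolding evolve_def by (simp only:) (simp add: algebra_simps)
    qed
    have i1: "integrable lborel (\<lambda>\<xi>. ?c \<xi> * g \<xi> * \<psi> \<xi>)"
      by (intro integrable_mult_schwartz[OF _ \<psi>] integrable_cis_mult gi) measurable
    have i3: "integrable lborel (\<lambda>\<xi>. evolve ?E T \<xi> * \<psi> \<xi>)"
      by (intro integrable_mult_schwartz[OF _ \<psi>] integrable_evolve)
    have i2: "integrable lborel (\<lambda>\<xi>. ?c \<xi> * second_iterate T g \<xi> * \<psi> \<xi>)"
    proof (intro integrable_mult_schwartz[OF _ \<psi>] integrable_cis_mult)
      show "integrable lborel (second_iterate T g)"
      proof (rule integrable_weight_decay(1))
        have "continuous_on UNIV (\<lambda>\<xi>. duhamel T \<gamma> \<gamma> (fst (T, \<xi>)) (snd (T, \<xi>)))"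
          by (rule continuous_on_compose2[OF continuous_on_duhamel]) (auto intro!: continuous_intros)
        thus "second_iterate T g \<in> borel_measurable borel" by (simp add: borel_measurable_continuous_onI D)
        show "cmod (second_iterate T g \<xi>) \<le> (norm \<gamma> * norm \<gamma> * (T * decay_const)) * decay \<xi>" for \<xi>
          using duhamel_bound[of T \<gamma> \<gamma> T \<xi>] T by (simp add: D)
      qed
    qed measurable
    \<comment> \<open>By inversion, evaluation at \<open>fourier \<psi>\<close> is the pairing of
      \<psi> with the Fourier transform of the solution.\<close>
    have "dist_of (evolve (v \<epsilon>) T) (fourier \<psi>) = (LINT \<xi>|lborel. evolve (v \<epsilon>) T \<xi> * \<psi> \<xi>)"
      using \<psi> by (simp add: dist_of_def schwartz_fourier fourier_inversion)
    also have "\<dots> = of_real \<epsilon> * (LINT \<xi>|lborel. ?c \<xi> * g \<xi> * \<psi> \<xi>)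
       + of_real \<epsilon> ^ 2 * (- \<i> * \<eta> / of_real (2 * pi) * (LINT \<xi>|lborel. ?c \<xi> * second_iterate T g \<xi> * \<psi> \<xi>))
       + (LINT \<xi>|lborel. evolve ?E T \<xi> * \<psi> \<xi>)"
      unfolding pw
      by (subst Bochner_Integration.integral_add, use i1 i2 i3 in simp, use i3 in simp,
          subst Bochner_Integration.integral_add, use i1 in simp, use i2 in simp) (simp only: integral_mult_right_zero)
    finally have "dist_of (evolve (v \<epsilon>) T) (fourier \<psi>)
        - of_real \<epsilon> * (LINT \<xi>|lborel. ?c \<xi> * g \<xi> * \<psi> \<xi>)
        - of_real \<epsilon> ^ 2 * (- \<i> * \<eta> / of_real (2 * pi) * (LINT \<xi>|lborel. ?c \<xi> * second_iterate T g \<xi> * \<psi> \<xi>))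
      = (LINT \<xi>|lborel. evolve ?E T \<xi> * \<psi> \<xi>)" by simp
    moreover have "cmod (LINT \<xi>|lborel. evolve ?E T \<xi> * \<psi> \<xi>) \<le> (LINT \<xi>|lborel. norm ?E * (decay \<xi> * cmod (\<psi> \<xi>)))"
    proof (rule Bochner_Integration.integral_norm_bound_integral[OF i3])
      have "integrable lborel (\<lambda>\<xi>. complex_of_real (decay \<xi>))" using integrable_decay by simp
      from integrable_norm[OF integrable_mult_schwartz[OF this \<psi>]]
      show "integrable lborel (\<lambda>\<xi>. norm ?E * (decay \<xi> * cmod (\<psi> \<xi>)))" by (simp add: norm_mult)
      show "norm (evolve ?E T \<xi> * \<psi> \<xi>) \<le> norm ?E * (decay \<xi> * cmod (\<psi> \<xi>))" for \<xi>
        unfolding norm_mult mult.assoc[symmetric] by (intro mult_right_mono evolve_bound) simp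
    qed
    moreover have "(LINT \<xi>|lborel. norm ?E * (decay \<xi> * cmod (\<psi> \<xi>))) \<le> (C * norm \<gamma> ^ 3) * \<epsilon> ^ 3 * (LINT \<xi>|lborel. decay \<xi> * cmod (\<psi> \<xi>))"
    proof -
      have "norm ?E \<le> (C * norm \<gamma> ^ 3) * \<epsilon> ^ 3" using v2 \<epsilon>(1) by (simp add: power_mult_distrib mult_ac)
      moreover have "0 \<le> (LINT \<xi>|lborel. decay \<xi> * cmod (\<psi> \<xi>))" by (intro integral_nonneg_AE) auto
      ultimately show ?thesis by (simp add: mult_right_mono)
    qed
    ultimately show "cmod ((\<lambda>\<epsilon> t. dist_of (evolve (v \<epsilon>) t)) \<epsilon> T (fourier \<psi>)
        - of_real \<epsilon> * (LINT \<xi>|lborel. ?c \<xi> * g \<xi> * \<psi> \<xi>)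
        - of_real \<epsilon> ^ 2 * (- \<i> * \<eta> / of_real (2 * pi) * (LINT \<xi>|lborel. ?c \<xi> * second_iterate T g \<xi> * \<psi> \<xi>)))
      \<le> (C * norm \<gamma> ^ 3) * \<epsilon> ^ 3 * (LINT \<xi>|lborel. decay \<xi> * cmod (\<psi> \<xi>))" by simp
  qed
qed

section \<open>The second derivative at the origin\<close>

lemma nonpos_if_le_small_multiples:
  fixes c K d :: real
  assumes "d > 0" and le: "\<And>\<epsilon>. 0 < \<epsilon> \<Longrightarrow> \<epsilon> < d \<Longrightarrow> c \<le> \<epsilon> * K"
  shows "c \<le> 0"
proof (rule ccontr)
  assume "\<not> c \<le> 0"
  hence c: "c > 0" by simp
  let ?e = "min (d / 2) (c / (2 * (\<bar>K\<bar> + 1)))"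
  have e: "?e > 0" using assms(1) c by (simp add: add_nonneg_pos)
  moreover have "?e < d" using assms(1) by linarith
  ultimately have "c \<le> ?e * K" by (rule le)
  also have "\<dots> \<le> ?e * (\<bar>K\<bar> + 1)" using e by (intro mult_left_mono) auto
  also have "\<dots> \<le> c / (2 * (\<bar>K\<bar> + 1)) * (\<bar>K\<bar> + 1)" by (intro mult_right_mono) auto
  also have "\<dots> = c / 2"
  proof -
    have "\<bar>K\<bar> + 1 \<noteq> 0" by linarith
    thus ?thesis by (simp add: field_simps)
  qed
  finally show False using c by simp
qed

text \<open>G' is differentiable at 0 with derivative \<beta>, so G has the Taylor polynomial
  \<epsilon> G'(0) + \<epsilon>^2 \<beta> / 2 with error o(\<epsilon>^2). The given expansion is
  one-sided, as the solutions are constructed for \<epsilon> \<ge> 0, but that already determines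
  both coefficients.\<close>

lemma second_order_coefficient:
  fixes G G' :: "real \<Rightarrow> complex"
  assumes r: "r > 0"
    and G: "\<And>\<epsilon>. \<bar>\<epsilon>\<bar> < r \<Longrightarrow> (G has_vector_derivative G' \<epsilon>) (at \<epsilon>)"
    and G': "\<And>\<kappa>. \<kappa> > 0 \<Longrightarrow> \<exists>d>0. \<forall>\<epsilon>. \<bar>\<epsilon>\<bar> < d \<longrightarrow> cmod (G' \<epsilon> - G' 0 - of_real \<epsilon> * \<beta>) \<le> \<kappa> * \<bar>\<epsilon>\<bar>"
    and ex: "\<And>\<epsilon>. 0 \<le> \<epsilon> \<Longrightarrow> \<epsilon> < r \<Longrightarrow> cmod (G \<epsilon> - of_real \<epsilon> * a - of_real \<epsilon> ^ 2 * b) \<le> M * \<epsilon> ^ 3"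
  shows "\<beta> = 2 * b"
proof -
  have G0: "G 0 = 0" using ex[of 0] r by simp
  define p where "p = a - G' 0"
  define q where "q = b - \<beta> / 2"
  have key: "\<exists>d>0. \<forall>\<epsilon>. 0 < \<epsilon> \<longrightarrow> \<epsilon> < d \<longrightarrow> cmod (p + of_real \<epsilon> * q) \<le> \<epsilon> * (\<kappa> + \<bar>M\<bar> * \<epsilon>)" if \<kappa>: "\<kappa> > 0" for \<kappa>
  proof -
    obtain d where d: "d > 0" "\<And>\<epsilon>. \<bar>\<epsilon>\<bar> < d \<Longrightarrow> cmod (G' \<epsilon> - G' 0 - of_real \<epsilon> * \<beta>) \<le> \<kappa> * \<bar>\<epsilon>\<bar>"
      using G'[OF \<kappa>] by blast
    have "cmod (p + of_real \<epsilon> * q) \<le> \<epsilon> * (\<kappa> + \<bar>M\<bar> * \<epsilon>)" if \<epsilon>: "0 < \<epsilon>" "\<epsilon> < min d r" for \<epsilon>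
    proof -
      let ?H = "\<lambda>x. G x - of_real x * G' 0 - of_real x ^ 2 * (\<beta> / 2)"
      \<comment> \<open>Mean value inequality for G minus its Taylor polynomial, whose derivative is
        at most \<kappa> \<epsilon> on {0..\<epsilon>}. It yields an error \<kappa> \<epsilon>^2
        although the second derivative exists only at 0.\<close>
      have "norm (?H \<epsilon> - ?H 0) \<le> (\<kappa> * \<epsilon>) * norm (\<epsilon> - 0)"
      proof (rule differentiable_bound[of "{0..\<epsilon>}"])
        fix x assume x: "x \<in> {0..\<epsilon>}"
        have D: "(G has_derivative (\<lambda>h. h *\<^sub>R G' x)) (at x within {0..\<epsilon>})"
          using G[of x] x \<epsilon> unfolding has_vector_derivative_def by (auto intro: has_derivative_at_withinI)
        show "(?H has_derivative (\<lambda>h. h *\<^sub>R (G' x - G' 0 - of_real x * \<beta>))) (at x within {0..\<epsilon>})"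
          by (rule D derivative_eq_intros refl)+
             (simp add: scaleR_conv_of_real fun_eq_iff algebra_simps)
        have "\<kappa> * \<bar>x\<bar> \<le> \<kappa> * \<epsilon>" using x \<kappa> by (intro mult_left_mono) auto
        with d(2)[of x] x \<epsilon> have "cmod (G' x - G' 0 - of_real x * \<beta>) \<le> \<kappa> * \<epsilon>" by auto
        thus "onorm (\<lambda>h. h *\<^sub>R (G' x - G' 0 - of_real x * \<beta>)) \<le> \<kappa> * \<epsilon>"
          by (intro onorm_le) (auto simp only: norm_scaleR real_norm_def mult.commute[of "\<kappa> * _"] intro: mult_left_mono)
      qed (use \<epsilon> in auto)
      hence H: "cmod (?H \<epsilon>) \<le> \<kappa> * \<epsilon> * \<epsilon>" using \<epsilon> by (simp add: G0)
      have E: "cmod (G \<epsilon> - of_real \<epsilon> * a - of_real \<epsilon> ^ 2 * b) \<le> \<bar>M\<bar> * \<epsilon> ^ 3"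
        by (rule order_trans[OF ex mult_right_mono]) (use \<epsilon> in auto)
      have "of_real \<epsilon> * (p + of_real \<epsilon> * q) = ?H \<epsilon> - (G \<epsilon> - of_real \<epsilon> * a - of_real \<epsilon> ^ 2 * b)"
        by (simp add: p_def q_def power2_eq_square algebra_simps)
      hence "cmod (of_real \<epsilon> * (p + of_real \<epsilon> * q)) = cmod (?H \<epsilon> - (G \<epsilon> - of_real \<epsilon> * a - of_real \<epsilon> ^ 2 * b))"
        by (rule arg_cong)
      also have "\<dots> \<le> cmod (?H \<epsilon>) + cmod (G \<epsilon> - of_real \<epsilon> * a - of_real \<epsilon> ^ 2 * b)"
        by (rule norm_triangle_ineq4)
      also have "\<dots> \<le> \<kappa> * \<epsilon> * \<epsilon> + \<bar>M\<bar> * \<epsilon> ^ 3" by (rule add_mono[OF H E])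
      finally have "cmod (of_real \<epsilon> * (p + of_real \<epsilon> * q)) \<le> \<kappa> * \<epsilon> * \<epsilon> + \<bar>M\<bar> * \<epsilon> ^ 3" .
      moreover have "cmod (of_real \<epsilon> * (p + of_real \<epsilon> * q)) = \<epsilon> * cmod (p + of_real \<epsilon> * q)"
        using \<epsilon> by (simp only: norm_mult norm_of_real abs_of_pos)
      moreover have "\<kappa> * \<epsilon> * \<epsilon> + \<bar>M\<bar> * \<epsilon> ^ 3 = \<epsilon> * (\<epsilon> * (\<kappa> + \<bar>M\<bar> * \<epsilon>))"
        by (simp add: power3_eq_cube algebra_simps)
      ultimately have "\<epsilon> * cmod (p + of_real \<epsilon> * q) \<le> \<epsilon> * (\<epsilon> * (\<kappa> + \<bar>M\<bar> * \<epsilon>))"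
        by (simp only:)
      thus ?thesis using \<epsilon> by simp
    qed
    moreover have "min d r > 0" using d(1) r by simp
    ultimately show ?thesis by blast
  qed
  \<comment> \<open>Letting \<epsilon> tend to 0 in \<open>key\<close> removes p; only then can a
    factor \<epsilon> be cancelled to remove q.\<close>
  have "cmod p \<le> 0"
  proof -
    obtain d where d: "d > 0" "\<And>\<epsilon>. 0 < \<epsilon> \<Longrightarrow> \<epsilon> < d \<Longrightarrow> cmod (p + of_real \<epsilon> * q) \<le> \<epsilon> * (1 + \<bar>M\<bar> * \<epsilon>)"
      using key[of 1] by auto
    show ?thesis
    proof (rule nonpos_if_le_small_multiples[of "min d 1"])
      fix \<epsilon> :: real assume \<epsilon>: "0 < \<epsilon>" "\<epsilon> < min d 1"
      have "p = (p + of_real \<epsilon> * q) - of_real \<epsilon> * q" by simp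
      hence "cmod p \<le> cmod (p + of_real \<epsilon> * q) + cmod (of_real \<epsilon> * q)"
        using norm_triangle_ineq4[of "p + of_real \<epsilon> * q" "of_real \<epsilon> * q"] by simp
      also have "\<dots> \<le> \<epsilon> * (1 + \<bar>M\<bar> * \<epsilon>) + \<epsilon> * cmod q" using d(2)[of \<epsilon>] \<epsilon> by (simp add: norm_mult)
      also have "\<dots> \<le> \<epsilon> * (1 + \<bar>M\<bar> * 1) + \<epsilon> * cmod q"
        using \<epsilon> by (intro add_mono mult_left_mono) auto
      finally show "cmod p \<le> \<epsilon> * (1 + \<bar>M\<bar> + cmod q)" by (simp add: distrib_left)
    qed (use d in auto)
  qed
  hence p: "p = 0" by simp
  have "cmod q \<le> 0"
  proof (rule field_le_epsilon)
    fix \<kappa> :: real assume \<kappa>: "\<kappa> > 0"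
    obtain d where d: "d > 0" "\<And>\<epsilon>. 0 < \<epsilon> \<Longrightarrow> \<epsilon> < d \<Longrightarrow> cmod (p + of_real \<epsilon> * q) \<le> \<epsilon> * (\<kappa> + \<bar>M\<bar> * \<epsilon>)"
      using key[OF \<kappa>] by auto
    have "cmod q - \<kappa> \<le> 0"
    proof (rule nonpos_if_le_small_multiples[OF d(1)])
      fix \<epsilon> :: real assume \<epsilon>: "0 < \<epsilon>" "\<epsilon> < d"
      have "\<epsilon> * cmod q \<le> \<epsilon> * (\<kappa> + \<bar>M\<bar> * \<epsilon>)" using d(2)[OF \<epsilon>] \<epsilon> by (simp add: p norm_mult)
      thus "cmod q - \<kappa> \<le> \<epsilon> * \<bar>M\<bar>" using \<epsilon> by (simp add: mult.commute)
    qed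
    thus "cmod q \<le> 0 + \<kappa>" by simp
  qed
  thus ?thesis by (auto simp: q_def)
qed

lemma lin_mapsD:
  assumes "L \<in> vecs (lin_maps X Y)"
  shows "\<And>x. x \<in> vecs X \<Longrightarrow> L x \<in> vecs Y"
    and "\<And>c x. x \<in> vecs X \<Longrightarrow> L (c *\<^sub>R x) = c *\<^sub>R L x"
    and "\<exists>K. \<forall>x\<in>vecs X. nrm Y (L x) \<le> K * nrm X x"
  using assms by (auto simp: lin_maps_def)

text \<open>The operator norm is a \<open>SUP\<close> of reals and dominates its terms only when
  these are bounded, which K guarantees. The form with an explicit K also fits differences of
  operators.\<close>

lemma lin_maps_nrm_ge:
  assumes K: "\<forall>x\<in>vecs X. nrm Y (L x) \<le> K * nrm X x" and pos: "\<And>x. x \<in> vecs X \<Longrightarrow> 0 \<le> nrm X x"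
    and x: "x \<in> vecs X" "nrm X x \<le> 1"
  shows "nrm Y (L x) \<le> nrm (lin_maps X Y) L"
proof -
  have "nrm Y (L y) \<le> \<bar>K\<bar>" if y: "y \<in> vecs X" "nrm X y \<le> 1" for y
  proof -
    have "nrm Y (L y) \<le> K * nrm X y" using K y by blast
    also have "\<dots> \<le> \<bar>K\<bar> * nrm X y" using pos[OF y(1)] by (intro mult_right_mono) auto
    also have "\<dots> \<le> \<bar>K\<bar> * 1" using y by (intro mult_left_mono) auto
    finally show ?thesis by simp
  qed
  hence "bdd_above ((\<lambda>x. nrm Y (L x)) ` {x \<in> vecs X. nrm X x \<le> 1})" by (auto intro!: bdd_aboveI)
  thus ?thesis unfolding lin_maps_def using x by (auto intro!: cSUP_upper)
qed

text \<open>
  The set \<open>D\<close> replaces the target space in the estimates: it is only required to be closed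
  under differences, and the norm need only be finite on it.
\<close>

lemma C2_at_second_coefficient_bound:
  fixes X :: "'a::real_vector nspace" and Y :: "'b::real_vector nspace"
  assumes C2: "C2_at X Y f 0"
    and X0: "0 \<in> vecs X" "nrm X 0 = 0" and Xpos: "\<And>x. x \<in> vecs X \<Longrightarrow> 0 \<le> nrm X x"
    and f: "\<And>x. x \<in> vecs X \<Longrightarrow> nrm X x < 1 \<Longrightarrow> f x \<in> vecs Y"
    and D: "vecs Y \<subseteq> D" "\<And>F G. F \<in> D \<Longrightarrow> G \<in> D \<Longrightarrow> F - G \<in> D"
    and Dnrm: "\<And>F G. F \<in> D \<Longrightarrow> G \<in> D \<Longrightarrow> nrm Y (F - G) \<le> nrm Y F + nrm Y G"
  obtains K where "K \<ge> 0"
    "\<And>e \<l> C a b M r. \<lbrakk>\<And>c. c *\<^sub>R e \<in> vecs X; \<And>c. nrm X (c *\<^sub>R e) = \<bar>c\<bar> * nrm X e; nrm X e \<le> 1;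
       \<And>F G. F \<in> D \<Longrightarrow> G \<in> D \<Longrightarrow> \<l> (F - G) = (\<l> F - \<l> G :: complex);
       \<And>F c. F \<in> D \<Longrightarrow> \<l> (c *\<^sub>R F) = of_real c * \<l> F;
       \<And>F. F \<in> D \<Longrightarrow> cmod (\<l> F) \<le> C * nrm Y F; C \<ge> 0; r > 0;
       \<And>\<epsilon>. 0 \<le> \<epsilon> \<Longrightarrow> \<epsilon> < r \<Longrightarrow> cmod (\<l> (f (\<epsilon> *\<^sub>R e)) - of_real \<epsilon> * a - of_real \<epsilon> ^ 2 * b) \<le> M * \<epsilon> ^ 3\<rbrakk>
     \<Longrightarrow> cmod b \<le> C * K"
proof -
  obtain \<rho> f' f'' where \<rho>: "\<rho> > 0"
    and d1: "\<And>y. y \<in> vecs X \<Longrightarrow> nrm X y < \<rho> \<Longrightarrow> has_frechet_deriv X Y f (f' y) y"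
    and d2: "\<And>y. y \<in> vecs X \<Longrightarrow> nrm X y < \<rho> \<Longrightarrow> has_frechet_deriv X (lin_maps X Y) f' (f'' y) y"
    using C2 unfolding C2_at_def by (metis diff_zero)
  define B where "B = f'' 0"
  have Bd: "has_frechet_deriv X (lin_maps X Y) f' B 0" unfolding B_def by (rule d2) (use X0 \<rho> in auto)
  hence B: "B \<in> vecs (lin_maps X (lin_maps X Y))" by (simp add: has_frechet_deriv_def)
  \<comment> \<open>K is fixed by the second derivative alone, before e and \<l> are chosen; this
    uniformity is what the family of Gaussians will contradict.\<close>
  then obtain K where K: "\<And>x. x \<in> vecs X \<Longrightarrow> nrm (lin_maps X Y) (B x) \<le> K * nrm X x" using lin_mapsD(3) by blast
  show thesis
  proof (rule that[of "\<bar>K\<bar>"])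
    fix e and \<l> :: "'b \<Rightarrow> complex" and C a b M r
    assume e: "\<And>c. c *\<^sub>R e \<in> vecs X" "\<And>c. nrm X (c *\<^sub>R e) = \<bar>c\<bar> * nrm X e" "nrm X e \<le> 1"
      and l: "\<And>F G. F \<in> D \<Longrightarrow> G \<in> D \<Longrightarrow> \<l> (F - G) = \<l> F - \<l> G"
        "\<And>F c. F \<in> D \<Longrightarrow> \<l> (c *\<^sub>R F) = of_real c * \<l> F"
        "\<And>F. F \<in> D \<Longrightarrow> cmod (\<l> F) \<le> C * nrm Y F" "C \<ge> 0"
      and r: "r > 0"
      and ex: "\<And>\<epsilon>. 0 \<le> \<epsilon> \<Longrightarrow> \<epsilon> < r \<Longrightarrow> cmod (\<l> (f (\<epsilon> *\<^sub>R e)) - of_real \<epsilon> * a - of_real \<epsilon> ^ 2 * b) \<le> M * \<epsilon> ^ 3"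
    have eX: "e \<in> vecs X" using e(1)[of 1] by simp
    define R where "R = min r (min \<rho> 1)"
    have R: "R > 0" using r \<rho> by (simp add: R_def)
    have small: "nrm X (c *\<^sub>R e) \<le> \<bar>c\<bar>" for c
      using e(2,3) mult_left_le[of "nrm X e" "\<bar>c\<bar>"] by simp
    have line: "nrm X (\<epsilon> *\<^sub>R e) < \<rho>" "nrm X (\<epsilon> *\<^sub>R e) < 1" if "\<bar>\<epsilon>\<bar> < R" for \<epsilon>
      using small[of \<epsilon>] that by (auto simp: R_def)
    have f'L: "f' (\<epsilon> *\<^sub>R e) \<in> vecs (lin_maps X Y)" if "\<bar>\<epsilon>\<bar> < R" for \<epsilon>
      using d1[OF e(1) line(1)[OF that]] by (simp add: has_frechet_deriv_def)
    have YD: "F \<in> vecs Y \<Longrightarrow> F \<in> D" for F using D(1) by blast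
    have BeL: "B (c *\<^sub>R e) \<in> vecs (lin_maps X Y)" for c using lin_mapsD(1)[OF B e(1)] .
    define \<beta> where "\<beta> = \<l> (B e e)"
    have "\<beta> = 2 * b"
    proof (rule second_order_coefficient[OF R])
      fix \<epsilon> :: real assume \<epsilon>: "\<bar>\<epsilon>\<bar> < R"
      show "((\<lambda>\<epsilon>. \<l> (f (\<epsilon> *\<^sub>R e))) has_vector_derivative \<l> (f' (\<epsilon> *\<^sub>R e) e)) (at \<epsilon>)"
        unfolding has_vector_derivative_def has_derivative_at_alt
      proof (intro conjI allI impI)
        show "bounded_linear (\<lambda>x. x *\<^sub>R \<l> (f' (\<epsilon> *\<^sub>R e) e))" by (rule bounded_linear_scaleR_left)
        fix \<kappa> :: real assume \<kappa>: "\<kappa> > 0"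
        \<comment> \<open>C may be 0, hence the denominator C + 1.\<close>
        have C1: "\<kappa> / (C + 1) > 0" using \<kappa> l(4) by simp
        then obtain d where d: "d > 0" and db: "\<And>h. h \<in> vecs X \<Longrightarrow> nrm X h < d \<Longrightarrow>
            nrm Y (f (\<epsilon> *\<^sub>R e + h) - f (\<epsilon> *\<^sub>R e) - f' (\<epsilon> *\<^sub>R e) h) \<le> \<kappa> / (C + 1) * nrm X h"
          using d1[OF e(1) line(1)[OF \<epsilon>]] unfolding has_frechet_deriv_def by blast
        show "\<exists>d>0. \<forall>y. norm (y - \<epsilon>) < d \<longrightarrow>
          norm (\<l> (f (y *\<^sub>R e)) - \<l> (f (\<epsilon> *\<^sub>R e)) - (y - \<epsilon>) *\<^sub>R \<l> (f' (\<epsilon> *\<^sub>R e) e)) \<le> \<kappa> * norm (y - \<epsilon>)"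
        proof (intro exI[of _ "min d (R - \<bar>\<epsilon>\<bar>)"] conjI allI impI)
          show "min d (R - \<bar>\<epsilon>\<bar>) > 0" using d \<epsilon> by simp
          fix y assume y: "norm (y - \<epsilon>) < min d (R - \<bar>\<epsilon>\<bar>)"
          hence yR: "\<bar>y\<bar> < R" by auto
          let ?h = "(y - \<epsilon>) *\<^sub>R e"
          have h: "\<epsilon> *\<^sub>R e + ?h = y *\<^sub>R e" by (simp flip: scaleR_add_left)
          have hb: "nrm X ?h \<le> \<bar>y - \<epsilon>\<bar>" by (rule small)
          let ?F = "f (y *\<^sub>R e) - f (\<epsilon> *\<^sub>R e) - f' (\<epsilon> *\<^sub>R e) ?h"
          have mem: "f (y *\<^sub>R e) \<in> D" "f (\<epsilon> *\<^sub>R e) \<in> D" "f' (\<epsilon> *\<^sub>R e) ?h \<in> D" "f' (\<epsilon> *\<^sub>R e) e \<in> D"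
            using f[OF e(1) line(2)[OF yR]] f[OF e(1) line(2)[OF \<epsilon>]]
              lin_mapsD(1)[OF f'L[OF \<epsilon>] e(1)] lin_mapsD(1)[OF f'L[OF \<epsilon>] eX] YD by auto
          have "\<l> (f' (\<epsilon> *\<^sub>R e) ?h) = (y - \<epsilon>) *\<^sub>R \<l> (f' (\<epsilon> *\<^sub>R e) e)"
            using lin_mapsD(2)[OF f'L[OF \<epsilon>] eX] l(2)[OF mem(4)] by (simp add: scaleR_conv_of_real)
          hence "\<l> (f (y *\<^sub>R e)) - \<l> (f (\<epsilon> *\<^sub>R e)) - (y - \<epsilon>) *\<^sub>R \<l> (f' (\<epsilon> *\<^sub>R e) e) = \<l> ?F"
            using mem by (simp add: l(1) D(2))
          also have "cmod \<dots> \<le> C * nrm Y ?F" using mem by (intro l(3) D(2))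
          also have "\<dots> \<le> C * (\<kappa> / (C + 1) * nrm X ?h)"
            using db[OF e(1), of "y - \<epsilon>"] hb y h l(4) by (intro mult_left_mono) auto
          also have "\<dots> \<le> (C + 1) * (\<kappa> / (C + 1) * \<bar>y - \<epsilon>\<bar>)"
            by (intro mult_mono mult_left_mono mult_nonneg_nonneg less_imp_le[OF C1] hb Xpos[OF e(1)]) (use l(4) in auto)
          also have "\<dots> = \<kappa> * norm (y - \<epsilon>)" using l(4) by simp
          finally show "norm (\<l> (f (y *\<^sub>R e)) - \<l> (f (\<epsilon> *\<^sub>R e)) - (y - \<epsilon>) *\<^sub>R \<l> (f' (\<epsilon> *\<^sub>R e) e)) \<le> \<kappa> * norm (y - \<epsilon>)" .
        qed
      qed
    next
      fix \<kappa> :: real assume \<kappa>: "\<kappa> > 0"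
      have C1: "\<kappa> / (C + 1) > 0" using \<kappa> l(4) by simp
      then obtain d where d: "d > 0" and db: "\<And>h. h \<in> vecs X \<Longrightarrow> nrm X h < d \<Longrightarrow>
          nrm (lin_maps X Y) (f' (0 + h) - f' 0 - B h) \<le> \<kappa> / (C + 1) * nrm X h"
        using Bd unfolding has_frechet_deriv_def by blast
      show "\<exists>d>0. \<forall>\<epsilon>. \<bar>\<epsilon>\<bar> < d \<longrightarrow> cmod (\<l> (f' (\<epsilon> *\<^sub>R e) e) - \<l> (f' (0 *\<^sub>R e) e) - of_real \<epsilon> * \<beta>) \<le> \<kappa> * \<bar>\<epsilon>\<bar>"
      proof (intro exI[of _ "min d R"] conjI allI impI)
        show "min d R > 0" using d R by simp
        fix \<epsilon> :: real assume \<epsilon>: "\<bar>\<epsilon>\<bar> < min d R"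
        hence \<epsilon>R: "\<bar>\<epsilon>\<bar> < R" by simp
        let ?h = "\<epsilon> *\<^sub>R e"
        let ?A = "f' (0 + ?h) - f' 0 - B ?h"
        have L: "f' ?h \<in> vecs (lin_maps X Y)" "f' 0 \<in> vecs (lin_maps X Y)" "B ?h \<in> vecs (lin_maps X Y)"
          using f'L[OF \<epsilon>R] f'L[of 0] R BeL by auto
        obtain K1 K2 K3 where Ks: "\<forall>x\<in>vecs X. nrm Y (f' ?h x) \<le> K1 * nrm X x"
          "\<forall>x\<in>vecs X. nrm Y (f' 0 x) \<le> K2 * nrm X x" "\<forall>x\<in>vecs X. nrm Y (B ?h x) \<le> K3 * nrm X x"
          using lin_mapsD(3)[OF L(1)] lin_mapsD(3)[OF L(2)] lin_mapsD(3)[OF L(3)] by blast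
        \<comment> \<open>Differentiability of f' is an estimate in operator norm. Evaluating it at
          e requires that the difference of the three operators be bounded, which the triangle
          inequality on D gives.\<close>
        have AK: "\<forall>x\<in>vecs X. nrm Y (?A x) \<le> (K1 + K2 + K3) * nrm X x"
        proof
          fix x assume x: "x \<in> vecs X"
          have mem: "f' ?h x \<in> D" "f' 0 x \<in> D" "B ?h x \<in> D"
            using lin_mapsD(1)[OF L(1) x] lin_mapsD(1)[OF L(2) x] lin_mapsD(1)[OF L(3) x] YD by auto
          have "nrm Y (?A x) \<le> nrm Y (f' ?h x - f' 0 x) + nrm Y (B ?h x)"
            using Dnrm[OF D(2)[OF mem(1,2)] mem(3)] by simp
          also have "\<dots> \<le> nrm Y (f' ?h x) + nrm Y (f' 0 x) + nrm Y (B ?h x)"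
            using Dnrm[OF mem(1,2)] by simp
          also have "\<dots> \<le> (K1 + K2 + K3) * nrm X x" using Ks x by (simp add: distrib_right add_mono)
          finally show "nrm Y (?A x) \<le> (K1 + K2 + K3) * nrm X x" .
        qed
        have mem: "f' ?h e \<in> D" "f' 0 e \<in> D" "B ?h e \<in> D" "B e e \<in> D"
          using lin_mapsD(1)[OF L(1) eX] lin_mapsD(1)[OF L(2) eX] lin_mapsD(1)[OF L(3) eX]
            lin_mapsD(1)[OF BeL[of 1] eX] YD by auto
        have "B ?h e = \<epsilon> *\<^sub>R B e e" using lin_mapsD(2)[OF B eX] by (simp add: scaleR_fun_def)
        hence "\<l> (f' ?h e) - \<l> (f' (0 *\<^sub>R e) e) - of_real \<epsilon> * \<beta> = \<l> (?A e)"
          using mem l(2)[OF mem(4)] by (simp add: l(1) D(2) \<beta>_def)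
        also have "cmod \<dots> \<le> C * nrm Y (?A e)" using mem by (intro l(3)) (auto intro!: D(2))
        also have "\<dots> \<le> C * (\<kappa> / (C + 1) * nrm X ?h)"
        proof (rule mult_left_mono[OF order_trans l(4)])
          show "nrm Y (?A e) \<le> nrm (lin_maps X Y) ?A" by (rule lin_maps_nrm_ge[OF AK Xpos eX e(3)])
          show "nrm (lin_maps X Y) ?A \<le> \<kappa> / (C + 1) * nrm X ?h"
            by (rule db[OF e(1)]) (use small[of \<epsilon>] \<epsilon> in auto)
        qed
        also have "\<dots> \<le> (C + 1) * (\<kappa> / (C + 1) * \<bar>\<epsilon>\<bar>)"
          by (intro mult_mono mult_left_mono mult_nonneg_nonneg less_imp_le[OF C1] small Xpos[OF e(1)]) (use l(4) in auto)
        also have "\<dots> = \<kappa> * \<bar>\<epsilon>\<bar>" using l(4) by simp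
        finally show "cmod (\<l> (f' ?h e) - \<l> (f' (0 *\<^sub>R e) e) - of_real \<epsilon> * \<beta>) \<le> \<kappa> * \<bar>\<epsilon>\<bar>" .
      qed
    next
      show "cmod (\<l> (f (\<epsilon> *\<^sub>R e)) - of_real \<epsilon> * a - of_real \<epsilon> ^ 2 * b) \<le> M * \<epsilon> ^ 3" if "0 \<le> \<epsilon>" "\<epsilon> < R" for \<epsilon>
        using that by (intro ex) (auto simp: R_def)
    qed
    have Be: "B e \<in> vecs (lin_maps X Y)" using BeL[of 1] by simp
    obtain K' where K': "\<forall>x\<in>vecs X. nrm Y (B e x) \<le> K' * nrm X x" using lin_mapsD(3)[OF Be] by blast
    have "cmod \<beta> \<le> C * nrm Y (B e e)" unfolding \<beta>_def using lin_mapsD(1)[OF Be eX] YD by (intro l(3)) auto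
    also have "\<dots> \<le> C * (K * nrm X e)"
      using lin_maps_nrm_ge[OF K' Xpos eX e(3)] K[OF eX] l(4) by (intro mult_left_mono) auto
    also have "\<dots> \<le> C * \<bar>K\<bar>"
    proof (intro mult_left_mono l(4))
      have "K * nrm X e \<le> \<bar>K\<bar> * nrm X e" using Xpos[OF eX] by (intro mult_right_mono) auto
      also have "\<dots> \<le> \<bar>K\<bar> * 1" using e(3) by (intro mult_left_mono) auto
      finally show "K * nrm X e \<le> \<bar>K\<bar>" by simp
    qed
    finally have "2 * cmod b \<le> C * \<bar>K\<bar>" using \<open>\<beta> = 2 * b\<close> by (simp add: norm_mult)
    thus "cmod b \<le> C * \<bar>K\<bar>" using norm_ge_zero[of b] by linarith
  qed simp
qed

section \<open>Norms on Sobolev spaces\<close>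

text \<open>The integral of (y f - g)^2 is a nonnegative quadratic polynomial in y; its value at the
  minimum y = P / A gives the inequality.\<close>

lemma integral_Cauchy_Schwarz:
  fixes f g :: "'a \<Rightarrow> real"
  assumes [measurable]: "f \<in> borel_measurable M" "g \<in> borel_measurable M"
    and f: "integrable M (\<lambda>x. (f x)\<^sup>2)" and g: "integrable M (\<lambda>x. (g x)\<^sup>2)"
  shows "integrable M (\<lambda>x. f x * g x)"
    and "(LINT x|M. f x * g x) \<le> sqrt (LINT x|M. (f x)\<^sup>2) * sqrt (LINT x|M. (g x)\<^sup>2)"
proof -
  have bound: "\<bar>a * b\<bar> \<le> a\<^sup>2 + b\<^sup>2" for a b :: real
  proof -
    have "2 * (\<bar>a\<bar> * \<bar>b\<bar>) \<le> a\<^sup>2 + b\<^sup>2" using sum_squares_bound[of "\<bar>a\<bar>" "\<bar>b\<bar>"] by (simp add: mult.assoc)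
    moreover have "0 \<le> \<bar>a\<bar> * \<bar>b\<bar>" by simp
    ultimately show ?thesis unfolding abs_mult by linarith
  qed
  show i: "integrable M (\<lambda>x. f x * g x)"
    by (rule Bochner_Integration.integrable_bound[OF Bochner_Integration.integrable_add[OF f g]]) (use bound in auto)
  define A where "A = (LINT x|M. (f x)\<^sup>2)"
  define B where "B = (LINT x|M. (g x)\<^sup>2)"
  define P where "P = (LINT x|M. f x * g x)"
  have AB: "A \<ge> 0" "B \<ge> 0" by (auto simp: A_def B_def)
  have quad: "0 \<le> y\<^sup>2 * A - 2 * y * P + B" for y
  proof -
    have "0 \<le> (LINT x|M. (y * f x - g x)\<^sup>2)" by simp
    also have "\<dots> = (LINT x|M. y\<^sup>2 * (f x)\<^sup>2 - 2 * y * (f x * g x) + (g x)\<^sup>2)"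
      by (intro Bochner_Integration.integral_cong) (auto simp: power2_eq_square algebra_simps)
    also have "\<dots> = y\<^sup>2 * A - 2 * y * P + B"
      using f g i by (simp add: A_def B_def P_def)
    finally show ?thesis .
  qed
  have "P \<le> sqrt (A * B)"
  proof (cases "A = 0")
    case True
    \<comment> \<open>For A = 0 the polynomial is affine, and P > 0 would make it negative at y = (B
      + 1) / P.\<close>
    have "P \<le> 0"
    proof (rule ccontr)
      assume P: "\<not> P \<le> 0"
      hence "2 * ((B + 1) / P) * P = 2 * (B + 1)" by simp
      thus False using quad[of "(B + 1) / P"] True AB by simp
    qed
    thus ?thesis using True by simp
  next
    case False
    hence A: "A > 0" using AB by simp
    have "0 \<le> (P / A)\<^sup>2 * A - 2 * (P / A) * P + B" by (rule quad)
    hence "P\<^sup>2 / A \<le> B" using A by (simp add: power2_eq_square field_simps)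
    hence "P\<^sup>2 \<le> A * B" using A by (simp add: field_simps)
    thus ?thesis by (rule real_le_rsqrt)
  qed
  thus "(LINT x|M. f x * g x) \<le> sqrt (LINT x|M. (f x)\<^sup>2) * sqrt (LINT x|M. (g x)\<^sup>2)"
    by (simp add: A_def B_def P_def real_sqrt_mult)
qed

lemma weight_split:
  "weight (s / 2) \<xi> ^ 2 = weight s \<xi>" "weight (s / 2) \<xi> * weight (- s / 2) \<xi> = 1"
  using one_plus_norm_pos[of \<xi>]
  by (simp_all add: weight_def power2_eq_square flip: powr_add)

text \<open>Minkowski's inequality for the density \<open>weight s\<close>; the weight is split into
  two factors of exponent s / 2 so that Cauchy-Schwarz bounds the cross term.\<close>

lemma weighted_L2_triangle:
  fixes v w :: "real^2 \<Rightarrow> complex"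
  assumes [measurable]: "v \<in> borel_measurable borel" "w \<in> borel_measurable borel"
    and v: "integrable lborel (\<lambda>\<xi>. weight s \<xi> * (cmod (v \<xi>))\<^sup>2)" and w: "integrable lborel (\<lambda>\<xi>. weight s \<xi> * (cmod (w \<xi>))\<^sup>2)"
  shows "integrable lborel (\<lambda>\<xi>. weight s \<xi> * (cmod (v \<xi> + w \<xi>))\<^sup>2)"
    and "sqrt (LINT \<xi>|lborel. weight s \<xi> * (cmod (v \<xi> + w \<xi>))\<^sup>2)
      \<le> sqrt (LINT \<xi>|lborel. weight s \<xi> * (cmod (v \<xi>))\<^sup>2) + sqrt (LINT \<xi>|lborel. weight s \<xi> * (cmod (w \<xi>))\<^sup>2)"
proof -
  let ?f = "\<lambda>\<xi>. weight (s / 2) \<xi> * cmod (v \<xi>)" and ?g = "\<lambda>\<xi>. weight (s / 2) \<xi> * cmod (w \<xi>)"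
  have sq: "(weight (s / 2) \<xi> * c)\<^sup>2 = weight s \<xi> * c\<^sup>2" for \<xi> c
    by (simp add: power_mult_distrib weight_split)
  have CS: "integrable lborel (\<lambda>\<xi>. ?f \<xi> * ?g \<xi>)"
    "(LINT \<xi>|lborel. ?f \<xi> * ?g \<xi>) \<le> sqrt (LINT \<xi>|lborel. weight s \<xi> * (cmod (v \<xi>))\<^sup>2) * sqrt (LINT \<xi>|lborel. weight s \<xi> * (cmod (w \<xi>))\<^sup>2)"
    using integral_Cauchy_Schwarz[of ?f lborel ?g] v w by (simp_all add: sq)
  have pw: "weight s \<xi> * (cmod (v \<xi> + w \<xi>))\<^sup>2 \<le> weight s \<xi> * (cmod (v \<xi>))\<^sup>2 + 2 * (?f \<xi> * ?g \<xi>) + weight s \<xi> * (cmod (w \<xi>))\<^sup>2" for \<xi>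
  proof -
    have "(weight (s / 2) \<xi> * cmod (v \<xi> + w \<xi>))\<^sup>2 \<le> (?f \<xi> + ?g \<xi>)\<^sup>2"
      unfolding distrib_left[symmetric] using weight_pos[of "s/2" \<xi>]
      by (intro power_mono mult_left_mono norm_triangle_ineq) auto
    also have "\<dots> = ?f \<xi> ^ 2 + 2 * (?f \<xi> * ?g \<xi>) + ?g \<xi> ^ 2" by (simp add: power2_sum)
    finally show ?thesis by (simp only: sq)
  qed
  have i: "integrable lborel (\<lambda>\<xi>. weight s \<xi> * (cmod (v \<xi>))\<^sup>2 + 2 * (?f \<xi> * ?g \<xi>) + weight s \<xi> * (cmod (w \<xi>))\<^sup>2)"
    by (intro Bochner_Integration.integrable_add v w integrable_mult_right CS(1))
  show i2: "integrable lborel (\<lambda>\<xi>. weight s \<xi> * (cmod (v \<xi> + w \<xi>))\<^sup>2)"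
    by (rule Bochner_Integration.integrable_bound[OF i])
       (use pw weight_pos[of s] in \<open>auto simp: abs_mult less_imp_le intro!: AE_I2 order_trans[OF _ abs_ge_self]\<close>)
  define A where "A = (LINT \<xi>|lborel. weight s \<xi> * (cmod (v \<xi>))\<^sup>2)"
  define B where "B = (LINT \<xi>|lborel. weight s \<xi> * (cmod (w \<xi>))\<^sup>2)"
  have AB: "A \<ge> 0" "B \<ge> 0"
    unfolding A_def B_def using weight_pos[of s] by (auto intro!: integral_nonneg_AE mult_nonneg_nonneg simp: less_imp_le)
  have "(LINT \<xi>|lborel. weight s \<xi> * (cmod (v \<xi> + w \<xi>))\<^sup>2) \<le> (LINT \<xi>|lborel. weight s \<xi> * (cmod (v \<xi>))\<^sup>2 + 2 * (?f \<xi> * ?g \<xi>) + weight s \<xi> * (cmod (w \<xi>))\<^sup>2)"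
    by (rule integral_mono[OF i2 i pw])
  also have "\<dots> = A + 2 * (LINT \<xi>|lborel. ?f \<xi> * ?g \<xi>) + B"
    using v w CS(1) by (simp add: A_def B_def)
  also have "\<dots> \<le> A + 2 * (sqrt A * sqrt B) + B" using CS(2) by (simp add: A_def B_def)
  also have "\<dots> = (sqrt A + sqrt B)\<^sup>2" using AB by (simp add: power2_sum)
  finally show "sqrt (LINT \<xi>|lborel. weight s \<xi> * (cmod (v \<xi> + w \<xi>))\<^sup>2)
      \<le> sqrt (LINT \<xi>|lborel. weight s \<xi> * (cmod (v \<xi>))\<^sup>2) + sqrt (LINT \<xi>|lborel. weight s \<xi> * (cmod (w \<xi>))\<^sup>2)"
    unfolding A_def[symmetric] B_def[symmetric] using AB by (intro real_le_lsqrt) auto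
qed

text \<open>The part of membership in H^s on which the norm depends. Without temperedness, closure
  under differences follows from the representing functions alone.\<close>

definition sobolev_fn :: "real \<Rightarrow> dist \<Rightarrow> bool" where
  "sobolev_fn s f \<longleftrightarrow> (\<exists>v. represents v (dist_fourier f) \<and> integrable lborel (\<lambda>\<xi>. weight s \<xi> * (cmod (v \<xi>))\<^sup>2))"

lemma sobolev_fnI: "f \<in> vecs (sobolev s) \<Longrightarrow> sobolev_fn s f"
  unfolding sobolev_fn_def sobolev_def weight_def by (auto dest: represents_fun_of)

lemma represents_dist_fourier_diff:
  assumes v: "represents v (dist_fourier f)" and w: "represents w (dist_fourier g)"
  shows "represents (\<lambda>\<xi>. v \<xi> - w \<xi>) (dist_fourier (f - g))"
proof -
  have i: "integrable lborel (\<lambda>\<xi>. v \<xi> * \<phi> \<xi>)" "integrable lborel (\<lambda>\<xi>. w \<xi> * \<phi> \<xi>)" if "\<phi> \<in> schwartz" for \<phi>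
    using v w that by (auto simp: represents_def)
  have "dist_fourier (f - g) = (\<lambda>\<phi>. dist_fourier f \<phi> - dist_fourier g \<phi>)"
    by (auto simp: dist_fourier_def)
  also have "\<dots> = regular_dist (\<lambda>\<xi>. v \<xi> - w \<xi>)"
    using v w i unfolding represents_def by (auto simp: regular_dist_def left_diff_distrib)
  finally show ?thesis using v w i by (auto simp: represents_def left_diff_distrib)
qed

lemma sobolev_fn_diff:
  assumes f: "sobolev_fn s f" and g: "sobolev_fn s g"
  shows "sobolev_fn s (f - g)"
    and "nrm (sobolev s) (f - g) \<le> nrm (sobolev s) f + nrm (sobolev s) g"
    and "nrm (sobolev s) f \<le> nrm (sobolev s) (f - g) + nrm (sobolev s) g"
    and "nrm (sobolev s) (f - g) = nrm (sobolev s) (g - f)"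
proof -
  obtain v w where v: "represents v (dist_fourier f)" "integrable lborel (\<lambda>\<xi>. weight s \<xi> * (cmod (v \<xi>))\<^sup>2)"
    and w: "represents w (dist_fourier g)" "integrable lborel (\<lambda>\<xi>. weight s \<xi> * (cmod (w \<xi>))\<^sup>2)"
    using f g unfolding sobolev_fn_def by blast
  have [measurable]: "v \<in> borel_measurable borel" "w \<in> borel_measurable borel"
    using v(1) w(1) by (auto simp: represents_def)
  note vw = represents_dist_fourier_diff[OF v(1) w(1)] and wv = represents_dist_fourier_diff[OF w(1) v(1)]
  have w': "integrable lborel (\<lambda>\<xi>. weight s \<xi> * (cmod (- w \<xi>))\<^sup>2)" using w(2) by simp
  have m: "(\<lambda>\<xi>. - w \<xi>) \<in> borel_measurable borel" by measurable
  have i: "integrable lborel (\<lambda>\<xi>. weight s \<xi> * (cmod (v \<xi> - w \<xi>))\<^sup>2)"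
    using weighted_L2_triangle(1)[OF _ m v(2) w'] by simp
  thus "sobolev_fn s (f - g)" unfolding sobolev_fn_def using vw by blast
  show "nrm (sobolev s) (f - g) \<le> nrm (sobolev s) f + nrm (sobolev s) g"
    unfolding sobolev_nrm_eq(1)[OF vw] sobolev_nrm_eq(1)[OF v(1)] sobolev_nrm_eq(1)[OF w(1)]
    using weighted_L2_triangle(2)[OF _ m v(2) w'] by simp
  show "nrm (sobolev s) f \<le> nrm (sobolev s) (f - g) + nrm (sobolev s) g"
    unfolding sobolev_nrm_eq(1)[OF vw] sobolev_nrm_eq(1)[OF v(1)] sobolev_nrm_eq(1)[OF w(1)]
    using weighted_L2_triangle(2)[OF _ _ i w(2)] by simp
  show "nrm (sobolev s) (f - g) = nrm (sobolev s) (g - f)"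
    unfolding sobolev_nrm_eq(1)[OF vw] sobolev_nrm_eq(1)[OF wv] by (simp add: norm_minus_commute)
qed

lemma integrable_weight_schwartz:
  assumes \<psi>: "\<psi> \<in> schwartz"
  shows "integrable lborel (\<lambda>\<xi>. weight s \<xi> * (cmod (\<psi> \<xi>))\<^sup>2)"
proof -
  define n where "n = nat \<lceil>s\<rceil>"
  have n: "s \<le> real n" unfolding n_def by linarith
  have [measurable]: "\<psi> \<in> borel_measurable borel" using \<psi> by simp
  obtain C where C: "C > 0" "\<And>\<xi>. cmod (\<psi> \<xi>) \<le> C / (1 + (norm \<xi>)\<^sup>2) ^ n" using rapidD[OF schwartz_rapid[OF \<psi>]] by blast
  have "weight s \<xi> * (cmod (\<psi> \<xi>))\<^sup>2 \<le> C * cmod (\<psi> \<xi>)" for \<xi>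
  proof -
    have "weight s \<xi> \<le> (1 + (norm \<xi>)\<^sup>2) powr real n" unfolding weight_def using n by (intro powr_mono) auto
    also have "\<dots> = (1 + (norm \<xi>)\<^sup>2) ^ n" using one_plus_norm_pos[of \<xi>] by (rule powr_realpow)
    finally have "weight s \<xi> * cmod (\<psi> \<xi>) \<le> (1 + (norm \<xi>)\<^sup>2) ^ n * cmod (\<psi> \<xi>)" by (rule mult_right_mono) simp
    also have "\<dots> \<le> C" using C(2)[of \<xi>] zero_less_power[OF one_plus_norm_pos[of \<xi>], of n] by (simp add: field_simps)
    finally have "weight s \<xi> * cmod (\<psi> \<xi>) * cmod (\<psi> \<xi>) \<le> C * cmod (\<psi> \<xi>)" by (rule mult_right_mono) simp
    thus ?thesis by (simp add: power2_eq_square mult.assoc)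
  qed
  moreover have "norm (weight s \<xi> * (cmod (\<psi> \<xi>))\<^sup>2) = weight s \<xi> * (cmod (\<psi> \<xi>))\<^sup>2" for \<xi>
    using weight_pos[of s \<xi>] by simp
  ultimately have "norm (weight s \<xi> * (cmod (\<psi> \<xi>))\<^sup>2) \<le> norm (C * cmod (\<psi> \<xi>))" for \<xi>
    using abs_ge_self order_trans by (metis real_norm_def)
  thus ?thesis
    by (intro Bochner_Integration.integrable_bound[OF integrable_mult_right[OF integrable_norm[OF schwartz_integrable[OF \<psi>]], of C]] AE_I2) simp_all
qed

text \<open>Duality of H^s and H^(-s): the weights of exponents s / 2 and - s / 2 cancel in the
  pairing, and Cauchy-Schwarz applies.\<close>

lemma sobolev_fn_eval_bound:
  assumes f: "sobolev_fn s f" and \<psi>: "\<psi> \<in> schwartz"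
  shows "cmod (f (fourier \<psi>)) \<le> sqrt (LINT \<xi>|lborel. weight (- s) \<xi> * (cmod (\<psi> \<xi>))\<^sup>2) * nrm (sobolev s) f"
proof -
  obtain v where v: "represents v (dist_fourier f)" "integrable lborel (\<lambda>\<xi>. weight s \<xi> * (cmod (v \<xi>))\<^sup>2)"
    using f unfolding sobolev_fn_def by blast
  have [measurable]: "v \<in> borel_measurable borel" "\<psi> \<in> borel_measurable borel"
    using v(1) \<psi> by (auto simp: represents_def)
  let ?f = "\<lambda>\<xi>. weight (s / 2) \<xi> * cmod (v \<xi>)" and ?g = "\<lambda>\<xi>. weight (- s / 2) \<xi> * cmod (\<psi> \<xi>)"
  have sq: "(weight (s / 2) \<xi> * c)\<^sup>2 = weight s \<xi> * c\<^sup>2" for s \<xi> c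
    by (simp add: power_mult_distrib weight_split)
  have fg: "?f \<xi> * ?g \<xi> = cmod (v \<xi> * \<psi> \<xi>)" for \<xi>
    using weight_split(2)[of s \<xi>] by (simp add: norm_mult mult_ac)
  have "f (fourier \<psi>) = dist_fourier f \<psi>" using \<psi> by (simp add: dist_fourier_def)
  also have "\<dots> = (LINT \<xi>|lborel. v \<xi> * \<psi> \<xi>)" using v(1) \<psi> unfolding represents_def by (simp add: regular_dist_def)
  also have "cmod \<dots> \<le> (LINT \<xi>|lborel. ?f \<xi> * ?g \<xi>)" unfolding fg by simp
  also have "\<dots> \<le> sqrt (LINT \<xi>|lborel. (?f \<xi>)\<^sup>2) * sqrt (LINT \<xi>|lborel. (?g \<xi>)\<^sup>2)"
    by (rule integral_Cauchy_Schwarz(2)) (use v(2) integrable_weight_schwartz[OF \<psi>, of "- s"] in \<open>simp_all only: sq, measurable\<close>)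
  also have "\<dots> = sqrt (LINT \<xi>|lborel. weight s \<xi> * (cmod (v \<xi>))\<^sup>2) * sqrt (LINT \<xi>|lborel. weight (- s) \<xi> * (cmod (\<psi> \<xi>))\<^sup>2)"
    by (simp only: sq)
  finally show ?thesis by (simp only: sobolev_nrm_eq(1)[OF v(1)] mult.commute)
qed

text \<open>The reverse triangle inequality makes the norm of u(t) continuous on a compact interval.
  Boundedness is what gives the \<open>SUP\<close> in the norm of \<open>C_space\<close> its
  meaning.\<close>

lemma C_space_bdd_above:
  assumes T: "T \<ge> 0" and u: "u \<in> vecs (C_space T (sobolev_rad s))"
  shows "\<And>t. t \<in> {0..T} \<Longrightarrow> sobolev_fn s (u t)" "bdd_above ((\<lambda>t. nrm (sobolev s) (u t)) ` {0..T})"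
proof -
  have c: "continuous_into T (sobolev_rad s) u" using u by (simp add: C_space_def)
  show fn: "sobolev_fn s (u t)" if "t \<in> {0..T}" for t
    using c that by (auto simp: continuous_into_def sobolev_rad_def intro: sobolev_fnI)
  have "continuous_on {0..T} (\<lambda>t. nrm (sobolev s) (u t))"
    unfolding continuous_on_def
  proof
    fix t assume t: "t \<in> {0..T}"
    have lim: "((\<lambda>t'. nrm (sobolev s) (u t' - u t)) \<longlongrightarrow> 0) (at t within {0..T})"
      using c t by (simp add: continuous_into_def sobolev_rad_def)
    have "\<forall>\<^sub>F t' in at t within {0..T}. norm (nrm (sobolev s) (u t') - nrm (sobolev s) (u t)) \<le> nrm (sobolev s) (u t' - u t)"
      unfolding eventually_at_filter
    proof (intro always_eventually allI impI)
      fix t' assume t': "t' \<in> {0..T}"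
      show "norm (nrm (sobolev s) (u t') - nrm (sobolev s) (u t)) \<le> nrm (sobolev s) (u t' - u t)"
        using sobolev_fn_diff(3)[OF fn[OF t'] fn[OF t]] sobolev_fn_diff(3)[OF fn[OF t] fn[OF t']]
          sobolev_fn_diff(4)[OF fn[OF t] fn[OF t']] by simp
    qed
    from Lim_null_comparison[OF this lim]
    show "((\<lambda>t. nrm (sobolev s) (u t)) \<longlongrightarrow> nrm (sobolev s) (u t)) (at t within {0..T})" by (rule LIM_zero_cancel)
  qed
  from compact_continuous_image[OF this compact_Icc]
  show "bdd_above ((\<lambda>t. nrm (sobolev s) (u t)) ` {0..T})" by (intro bounded_imp_bdd_above compact_imp_bounded)
qed

section \<open>Gaussian data\<close>

lemma lborel_integral_orthogonal:
  fixes f :: "real^2 \<Rightarrow> 'b::{banach, second_countable_topology}" and R :: "real^2 \<Rightarrow> real^2"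
  assumes R: "orthogonal_transformation R" and [measurable]: "f \<in> borel_measurable borel"
  shows "(LINT x|lborel. f (R x)) = (LINT x|lborel. f x)"
proof -
  have [measurable]: "R \<in> borel_measurable borel"
    using orthogonal_transformation_linear[OF R]
    by (intro borel_measurable_continuous_onI linear_continuous_on) (simp add: linear_conv_bounded_linear)
  have "(LINT x|lborel. f x) = (LINT x|distr lborel borel R. f x)" by (simp only: lborel_distr_orthogonal[OF R])
  also have "\<dots> = (LINT x|lborel. f (R x))" by (subst integral_distr) auto
  finally show ?thesis ..
qed

lemma dist_of_radial:
  assumes v: "integrable lborel v" and rad: "\<And>R \<xi>. orthogonal_transformation R \<Longrightarrow> v (R \<xi>) = v \<xi>"
  shows "dist_of v \<in> radial"
  unfolding radial_def mem_Collect_eq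
proof (intro allI impI ballI)
  fix R :: "real^2 \<Rightarrow> real^2" and \<phi> :: "real^2 \<Rightarrow> complex" assume R: "orthogonal_transformation R" and \<phi>: "\<phi> \<in> schwartz"
  have [measurable]: "\<phi> \<in> borel_measurable borel" "v \<in> borel_measurable borel" using \<phi> v by auto
  have inner: "R x \<bullet> R y = x \<bullet> y" for x y using R by (simp add: orthogonal_transformation_def)
  have "inv_fourier (\<phi> \<circ> R) \<xi> = inv_fourier \<phi> (R \<xi>)" for \<xi>
    using lborel_integral_orthogonal[OF R, of "\<lambda>x. cis (R \<xi> \<bullet> x) * \<phi> x"] by (simp add: inv_fourier_def inner)
  hence "dist_of v (\<phi> \<circ> R) = (LINT \<xi>|lborel. v (R \<xi>) * inv_fourier \<phi> (R \<xi>))"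
    using schwartz_comp_orthogonal[OF R \<phi>] by (simp add: dist_of_def rad[OF R])
  also have "\<dots> = (LINT \<xi>|lborel. v \<xi> * inv_fourier \<phi> \<xi>)"
    by (rule lborel_integral_orthogonal[OF R]) measurable
  finally show "dist_of v (\<phi> \<circ> R) = dist_of v \<phi>" using \<phi> by (simp add: dist_of_def)
qed

section \<open>Gaussians: Sobolev norm, oscillation and self-interaction\<close>

definition gauss :: "real \<Rightarrow> real^2 \<Rightarrow> real" where
  "gauss a \<xi> = exp (- (a * (norm \<xi>)\<^sup>2))"

lemma continuous_on_gauss [continuous_intros]:
  "continuous_on A f \<Longrightarrow> continuous_on A (\<lambda>x. gauss a (f x))"
  unfolding gauss_def by (intro continuous_intros)

lemma gauss_measurable [measurable]: "gauss a \<in> borel_measurable borel"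
  by (intro borel_measurable_continuous_onI continuous_on_gauss continuous_on_id)

lemma gauss_pos [simp]: "0 < gauss a \<xi>" "0 \<le> gauss a \<xi>" "gauss a \<xi> \<noteq> 0"
  by (auto simp: gauss_def)

lemma gauss_mult: "gauss a \<xi> * gauss b \<xi> = gauss (a + b) \<xi>"
  by (simp add: gauss_def algebra_simps flip: exp_add)

lemma gauss_integral: "a > 0 \<Longrightarrow> integrable lborel (gauss a)" "a > 0 \<Longrightarrow> (LINT \<xi>|lborel. gauss a \<xi>) = pi / a"
  unfolding gauss_def[abs_def] by (rule gauss_plane_real; assumption)+

lemma gauss_decay_bound:
  assumes a: "a > 0" shows "\<exists>B. \<forall>\<xi>. gauss a \<xi> \<le> B * decay \<xi>"
proof -
  obtain C where C: "\<And>\<xi>. cmod (complex_of_real (exp (- (a / 2 * (norm \<xi>)\<^sup>2)))) \<le> C / (1 + (norm (\<xi>::real^2))\<^sup>2) ^ 2"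
    using rapidD[OF rapid_gaussian[of "a / 2"]] a by (metis half_gt_zero)
  have "gauss a \<xi> \<le> (exp (1 / (2 * a)) * C) * decay \<xi>" for \<xi>
  proof -
    let ?r = "norm \<xi>"
    \<comment> \<open>This spends half of the Gaussian on the factor e^(-r) of \<open>decay\<close>;
      the other half absorbs the rational factor.\<close>
    have "2 * a * ?r \<le> (a * ?r)\<^sup>2 + 1"
      using sum_squares_bound[of "a * ?r" 1] by simp
    hence "?r \<le> ((a * ?r)\<^sup>2 + 1) / (2 * a)" using a by (simp add: pos_le_divide_eq mult_ac)
    also have "\<dots> = a / 2 * ?r\<^sup>2 + 1 / (2 * a)" using a by (simp add: power2_eq_square field_simps)
    finally have "- (a * ?r\<^sup>2) \<le> 1 / (2 * a) + - ?r + - (a / 2 * ?r\<^sup>2)" by (simp add: field_simps)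
    hence "gauss a \<xi> \<le> exp (1 / (2 * a) + - ?r + - (a / 2 * ?r\<^sup>2))" unfolding gauss_def by simp
    also have "\<dots> = exp (1 / (2 * a)) * exp (- ?r) * exp (- (a / 2 * ?r\<^sup>2))" by (simp only: exp_add)
    also have "\<dots> \<le> exp (1 / (2 * a)) * exp (- ?r) * (C / (1 + ?r\<^sup>2) ^ 2)"
      using C[of \<xi>] by (intro mult_left_mono) auto
    also have "\<dots> = (exp (1 / (2 * a)) * C) * decay \<xi>" by (simp add: decay_def)
    finally show ?thesis .
  qed
  thus ?thesis by blast
qed

text \<open>
  The singularity of the weight is written as a superposition of Gaussians:
  \<open>(1 + |\<xi>|^2)^(-1/2) \<le> e \<integral>_0^1 e^(- \<tau>^2 |\<xi>|^2) d\<tau>\<close>.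
\<close>

lemma weight_le_superposition:
  assumes s: "s \<le> - 1 / 2"
  shows "weight s \<xi> \<le> exp 1 * (LINT \<tau>|lborel. indicator {0..1} \<tau> * exp (- (\<tau>\<^sup>2 * (norm \<xi>)\<^sup>2)))"
proof -
  let ?r = "norm \<xi>"
  \<comment> \<open>For \<tau> \<le> \<delta> the exponent \<tau>^2 |\<xi>|^2 is at most 1, so the
    integral over \<tau> is at least \<delta> / e.\<close>
  define \<delta> where "\<delta> = (1 + ?r\<^sup>2) powr (- 1 / 2)"
  have \<delta>s: "\<delta> = 1 / sqrt (1 + ?r\<^sup>2)"
    using one_plus_norm_pos[of \<xi>] by (simp add: \<delta>_def powr_minus powr_half_sqrt inverse_eq_divide)
  have \<delta>: "0 < \<delta>" "\<delta> \<le> 1" using one_plus_norm_pos[of \<xi>] by (auto simp: \<delta>s)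
  have w: "weight s \<xi> \<le> \<delta>" unfolding weight_def \<delta>_def using s by (intro powr_mono) auto
  have i1: "integrable lborel (\<lambda>\<tau>::real. indicator {0..\<delta>} \<tau> * exp (- 1 :: real))"
    by (auto simp: integrable_indicator_iff emeasure_lborel_Icc_eq)
  have i2: "integrable lborel (\<lambda>\<tau>::real. indicator {0..1} \<tau> * exp (- (\<tau>\<^sup>2 * ?r\<^sup>2)))"
    by (rule Bochner_Integration.integrable_bound[of _ "indicator {0..1} :: real \<Rightarrow> real"])
       (auto simp: integrable_indicator_iff emeasure_lborel_Icc_eq indicator_def)
  have "\<delta> * exp (- 1) = (LINT \<tau>|lborel. indicator {0..\<delta>} \<tau> * exp (- 1))"
    using \<delta> by simp
  also have "\<dots> \<le> (LINT \<tau>|lborel. indicator {0..1} \<tau> * exp (- (\<tau>\<^sup>2 * ?r\<^sup>2)))"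
  proof (rule integral_mono[OF i1 i2])
    fix \<tau> :: real
    show "indicator {0..\<delta>} \<tau> * exp (- 1) \<le> indicator {0..1} \<tau> * exp (- (\<tau>\<^sup>2 * ?r\<^sup>2))"
    proof (cases "\<tau> \<in> {0..\<delta>}")
      case True
      have "\<tau>\<^sup>2 * ?r\<^sup>2 \<le> \<delta>\<^sup>2 * (1 + ?r\<^sup>2)" using True \<delta> by (intro mult_mono power_mono) auto
      also have "\<dots> = 1" using one_plus_norm_pos[of \<xi>] by (simp add: \<delta>s power_divide)
      finally show ?thesis using True \<delta> by (auto simp: indicator_def)
    qed (auto simp: indicator_def)
  qed
  finally have "\<delta> \<le> exp 1 * (LINT \<tau>|lborel. indicator {0..1} \<tau> * exp (- (\<tau>\<^sup>2 * ?r\<^sup>2)))"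
    by (simp add: exp_minus field_simps)
  with w show ?thesis by linarith
qed

text \<open>Once the weight is replaced by Gaussians, the \<xi>-integral is \<pi> / (\<tau>^2 + 1 /
  N^2), whose integral over [0,1] is \<pi> N arctan N \<le> \<pi>^2 N / 2. The linear growth in N
  dictates the amplitude of the data.\<close>

lemma weighted_gauss_integral:
  assumes s: "s \<le> - 1 / 2" and N: "N > 0"
  shows "integrable lborel (\<lambda>\<xi>. weight s \<xi> * gauss (1 / N\<^sup>2) \<xi>)"
    and "(LINT \<xi>|lborel. weight s \<xi> * gauss (1 / N\<^sup>2) \<xi>) \<le> exp 1 * pi\<^sup>2 / 2 * N"
proof -
  let ?a = "1 / N\<^sup>2"
  have a: "?a > 0" using N by simp
  let ?F = "\<lambda>(\<xi>, \<tau>::real). indicator {0..1} \<tau> * (exp (- (\<tau>\<^sup>2 * (norm \<xi>)\<^sup>2)) * gauss ?a \<xi>)"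
  have F: "integrable (lborel \<Otimes>\<^sub>M lborel) ?F"
  proof (rule Bochner_Integration.integrable_bound)
    have "integrable lborel (indicator {0..1} :: real \<Rightarrow> real)"
      by (simp add: integrable_indicator_iff emeasure_lborel_Icc_eq)
    from lborel_integrable_mult_pair[OF gauss_integral(1)[OF a] this]
    show "integrable (lborel \<Otimes>\<^sub>M lborel) (\<lambda>(\<xi>, \<tau>::real). gauss ?a \<xi> * indicator {0..1} \<tau>)" .
    show "AE z in lborel \<Otimes>\<^sub>M lborel. norm (?F z) \<le> norm (case z of (\<xi>, \<tau>::real) \<Rightarrow> gauss ?a \<xi> * indicator {0..1} \<tau>)"
      by (auto simp: indicator_def mult_left_le_one_le)
  qed measurable
  have sw: "weight s \<xi> * gauss ?a \<xi> \<le> exp 1 * (LINT \<tau>|lborel. ?F (\<xi>, \<tau>))" for \<xi>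
  proof -
    have "weight s \<xi> * gauss ?a \<xi> \<le> exp 1 * (LINT \<tau>|lborel. indicator {0..1} \<tau> * exp (- (\<tau>\<^sup>2 * (norm \<xi>)\<^sup>2))) * gauss ?a \<xi>"
      by (rule mult_right_mono[OF weight_le_superposition[OF s]]) simp
    also have "\<dots> = exp 1 * (LINT \<tau>|lborel. indicator {0..1} \<tau> * exp (- (\<tau>\<^sup>2 * (norm \<xi>)\<^sup>2)) * gauss ?a \<xi>)" by simp
    finally show ?thesis by (simp add: mult.assoc)
  qed
  have i: "integrable lborel (\<lambda>\<xi>. exp 1 * (LINT \<tau>|lborel. ?F (\<xi>, \<tau>)))"
    using lborel_pair.integrable_fst'[OF F] by (intro integrable_mult_right) simp
  show i2: "integrable lborel (\<lambda>\<xi>. weight s \<xi> * gauss ?a \<xi>)"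
  proof (rule Bochner_Integration.integrable_bound[OF i])
    show "AE \<xi> in lborel. norm (weight s \<xi> * gauss ?a \<xi>) \<le> norm (exp 1 * (LINT \<tau>|lborel. ?F (\<xi>, \<tau>)))"
    proof (rule AE_I2)
      fix \<xi>
      have "norm (weight s \<xi> * gauss ?a \<xi>) = weight s \<xi> * gauss ?a \<xi>" using weight_pos[of s \<xi>] by simp
      also note sw
      also have "exp 1 * (LINT \<tau>|lborel. ?F (\<xi>, \<tau>)) \<le> norm (exp 1 * (LINT \<tau>|lborel. ?F (\<xi>, \<tau>)))" by (simp only: real_norm_def abs_ge_self)
      finally show "norm (weight s \<xi> * gauss ?a \<xi>) \<le> norm (exp 1 * (LINT \<tau>|lborel. ?F (\<xi>, \<tau>)))" .
    qed
  qed auto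
  have "(LINT \<xi>|lborel. weight s \<xi> * gauss ?a \<xi>) \<le> (LINT \<xi>|lborel. exp 1 * (LINT \<tau>|lborel. ?F (\<xi>, \<tau>)))"
    by (rule integral_mono[OF i2 i sw])
  also have "\<dots> = exp 1 * (LINT \<xi>|lborel. LINT \<tau>|lborel. ?F (\<xi>, \<tau>))" by (rule integral_mult_right_zero)
  also have "(LINT \<xi>|lborel. LINT \<tau>|lborel. ?F (\<xi>, \<tau>)) = (LINT \<tau>|lborel. LINT \<xi>|lborel. ?F (\<xi>, \<tau>))"
    using lborel_pair.Fubini_integral[OF F] by simp
  also have "\<dots> = (LINT \<tau>|lborel. (pi / (\<tau>\<^sup>2 + ?a)) * indicator {0..1} \<tau>)"
  proof (intro Bochner_Integration.integral_cong[OF refl])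
    fix \<tau> :: real
    have "exp (- (\<tau>\<^sup>2 * (norm \<xi>)\<^sup>2)) * gauss ?a \<xi> = gauss (\<tau>\<^sup>2 + ?a) \<xi>" for \<xi> :: "real^2"
      using gauss_mult[of "\<tau>\<^sup>2" \<xi> ?a] by (simp add: gauss_def)
    moreover have "(LINT \<xi>|lborel. gauss (\<tau>\<^sup>2 + ?a) \<xi>) = pi / (\<tau>\<^sup>2 + ?a)" using a by (intro gauss_integral(2)) (simp add: add_nonneg_pos)
    ultimately show "(LINT \<xi>|lborel. ?F (\<xi>, \<tau>)) = (pi / (\<tau>\<^sup>2 + ?a)) * indicator {0..1} \<tau>" by simp
  qed
  also have "\<dots> = pi * N * arctan (N * 1) - pi * N * arctan (N * 0)"
  proof (rule integral_FTC_Icc_nonneg)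
    have den: "x\<^sup>2 + ?a > 0" for x using a by (simp add: add_nonneg_pos)
    show "(\<lambda>\<tau>. pi / (\<tau>\<^sup>2 + ?a)) \<in> borel_measurable borel" by measurable
    fix x :: real
    show "0 \<le> pi / (x\<^sup>2 + ?a)" using den[of x] by simp
    have nz: "1 + (N * x)\<^sup>2 \<noteq> 0" using one_plus_norm_pos[of "N * x"] by simp
    have "((\<lambda>x. pi * N * arctan (N * x)) has_real_derivative (pi * N) * (inverse (1 + (N * x)\<^sup>2) * N)) (at x)"
      by (auto intro!: derivative_eq_intros)
    moreover have "(pi * N) * (inverse (1 + (N * x)\<^sup>2) * N) = pi / (x\<^sup>2 + ?a)"
      using N nz by (simp add: field_simps power2_eq_square)
    ultimately show "((\<lambda>x. pi * N * arctan (N * x)) has_real_derivative pi / (x\<^sup>2 + ?a)) (at x)" by simp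
  qed simp
  also have "\<dots> \<le> pi\<^sup>2 / 2 * N"
  proof -
    have "pi * N * arctan N \<le> pi * N * (pi / 2)" using arctan_bounded[of N] N by (intro mult_left_mono) auto
    thus ?thesis by (simp add: power2_eq_square mult_ac)
  qed
  finally show "(LINT \<xi>|lborel. weight s \<xi> * gauss ?a \<xi>) \<le> exp 1 * pi\<^sup>2 / 2 * N" by simp
qed

text \<open>Oscillation costs at most half of the mass \<pi> / b as long as \<tau> \<le> b / 4: cos
  x \<ge> 1 - x^2 / 2, and half of the Gaussian absorbs the factor |\<xi>|^4 in the
  correction.\<close>

lemma gauss_cos_integral:
  assumes b: "b > 0" and \<tau>: "0 \<le> \<tau>" "4 * \<tau> \<le> b"
  shows "integrable lborel (\<lambda>\<xi>. gauss b \<xi> * cos (\<tau> * (norm \<xi>)\<^sup>2))"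
    and "pi / (2 * b) \<le> (LINT \<xi>|lborel. gauss b \<xi> * cos (\<tau> * (norm \<xi>)\<^sup>2))"
proof -
  show i: "integrable lborel (\<lambda>\<xi>. gauss b \<xi> * cos (\<tau> * (norm \<xi>)\<^sup>2))"
    by (rule Bochner_Integration.integrable_bound[OF gauss_integral(1)[OF b]])
       (auto simp: abs_mult mult_left_le)
  have b2: "b / 2 > 0" using b by simp
  have i2: "integrable lborel (\<lambda>\<xi>. gauss b \<xi> - (4 * \<tau>\<^sup>2 / b\<^sup>2) * gauss (b / 2) \<xi>)"
    by (intro Bochner_Integration.integrable_diff integrable_mult_right gauss_integral b b2)
  have "gauss b \<xi> - (4 * \<tau>\<^sup>2 / b\<^sup>2) * gauss (b / 2) \<xi> \<le> gauss b \<xi> * cos (\<tau> * (norm \<xi>)\<^sup>2)" for \<xi> :: "real^2"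
  proof -
    let ?x = "(norm \<xi>)\<^sup>2"
    have c: "1 - (\<tau> * ?x)\<^sup>2 / 2 \<le> cos (\<tau> * ?x)"
    proof -
      have "cos (\<tau> * ?x) = 1 - 2 * (sin (\<tau> * ?x / 2))\<^sup>2" using cos_double_sin[of "\<tau> * ?x / 2"] by simp
      moreover have "(sin (\<tau> * ?x / 2))\<^sup>2 \<le> (\<tau> * ?x / 2)\<^sup>2"
        using abs_sin_x_le_abs_x[of "\<tau> * ?x / 2"] unfolding abs_le_square_iff .
      ultimately show ?thesis by (simp add: power_divide)
    qed
    have e: "?x\<^sup>2 \<le> 8 / b\<^sup>2 * exp (b / 2 * ?x)"
    proof -
      have nn: "0 \<le> b / 2 * ?x" using b by simp
      from exp_lower_Taylor_quadratic[OF nn] nn have "(b / 2 * ?x)\<^sup>2 / 2 \<le> exp (b / 2 * ?x)" by linarith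
      thus ?thesis using b by (simp add: field_simps power2_eq_square)
    qed
    have "gauss b \<xi> * (\<tau> * ?x)\<^sup>2 / 2 \<le> gauss b \<xi> * (\<tau>\<^sup>2 * (8 / b\<^sup>2 * exp (b / 2 * ?x))) / 2"
      unfolding power_mult_distrib by (intro divide_right_mono mult_left_mono e) auto
    also have "\<dots> = (4 * \<tau>\<^sup>2 / b\<^sup>2) * (gauss b \<xi> * exp (b / 2 * ?x))" by simp
    also have "gauss b \<xi> * exp (b / 2 * ?x) = gauss (b / 2) \<xi>" by (simp add: gauss_def field_simps flip: exp_add)
    finally have "gauss b \<xi> * (1 - (\<tau> * ?x)\<^sup>2 / 2) \<ge> gauss b \<xi> - (4 * \<tau>\<^sup>2 / b\<^sup>2) * gauss (b / 2) \<xi>"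
      by (simp add: right_diff_distrib)
    also have "gauss b \<xi> * (1 - (\<tau> * ?x)\<^sup>2 / 2) \<le> gauss b \<xi> * cos (\<tau> * ?x)" by (rule mult_left_mono[OF c]) simp
    finally show ?thesis .
  qed
  hence "(LINT \<xi>|lborel. gauss b \<xi> - (4 * \<tau>\<^sup>2 / b\<^sup>2) * gauss (b / 2) \<xi>) \<le> (LINT \<xi>|lborel. gauss b \<xi> * cos (\<tau> * (norm \<xi>)\<^sup>2))"
    by (rule integral_mono[OF i2 i])
  moreover have "(LINT \<xi>|lborel. gauss b \<xi> - (4 * \<tau>\<^sup>2 / b\<^sup>2) * gauss (b / 2) \<xi>) = pi / b - (4 * \<tau>\<^sup>2 / b\<^sup>2) * (2 * pi / b)"
    using gauss_integral[OF b] gauss_integral[OF b2] by simp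
  moreover have "pi / (2 * b) \<le> pi / b - (4 * \<tau>\<^sup>2 / b\<^sup>2) * (2 * pi / b)"
  proof -
    have "(4 * \<tau>)\<^sup>2 \<le> b\<^sup>2" using \<tau> by (intro power_mono) auto
    hence "4 * \<tau>\<^sup>2 / b\<^sup>2 \<le> 1 / 4" using b by (simp add: divide_le_eq power2_eq_square)
    hence "(4 * \<tau>\<^sup>2 / b\<^sup>2) * (2 * pi / b) \<le> 1 / 4 * (2 * pi / b)" using b by (intro mult_right_mono) auto
    thus ?thesis using b by (simp add: field_simps)
  qed
  ultimately show "pi / (2 * b) \<le> (LINT \<xi>|lborel. gauss b \<xi> * cos (\<tau> * (norm \<xi>)\<^sup>2))" by linarith
qed

text \<open>The product of the two shifted Gaussians is centred at \<zeta> = - \<xi> / 2. After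
  translation there, the \<zeta>-integral is the Fourier integral of a Gaussian at frequency 2
  \<tau> \<xi>, which gives e^(- \<tau>^2 N^2 |\<xi>|^2); the translation leaves the phase e^(- i
  \<tau> |\<xi>|^2).\<close>

lemma gauss_interaction:
  assumes N: "N > 0"
  shows "(LINT \<zeta>|lborel. cis (2 * \<tau> * (\<zeta> \<bullet> \<xi>)) * (complex_of_real (c * gauss (1 / (2 * N\<^sup>2)) (\<zeta> + \<xi>)) * cnj (complex_of_real (c * gauss (1 / (2 * N\<^sup>2)) \<zeta>))))
    = of_real (c\<^sup>2 * pi * N\<^sup>2 * gauss (1 / (4 * N\<^sup>2) + \<tau>\<^sup>2 * N\<^sup>2) \<xi>) * cis (- (\<tau> * (norm \<xi>)\<^sup>2))"
proof -
  let ?f = "\<lambda>\<zeta>. cis (2 * \<tau> * (\<zeta> \<bullet> \<xi>)) * (complex_of_real (c * gauss (1 / (2 * N\<^sup>2)) (\<zeta> + \<xi>)) * cnj (complex_of_real (c * gauss (1 / (2 * N\<^sup>2)) \<zeta>)))"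
  let ?m = "- (1 / 2) *\<^sub>R \<xi>"
  have a: "1 / N\<^sup>2 > 0" using N by simp
  have "(LINT \<zeta>|lborel. ?f \<zeta>) = (LINT \<zeta>|lborel. ?f (?m + \<zeta>))"
    by (rule lborel_integral_translate[symmetric]) measurable
  also have "\<dots> = (LINT \<zeta>|lborel. (of_real (c\<^sup>2 * gauss (1 / (4 * N\<^sup>2)) \<xi>) * cis (- (\<tau> * (norm \<xi>)\<^sup>2))) * (cis (\<zeta> \<bullet> ((2 * \<tau>) *\<^sub>R \<xi>)) * of_real (exp (- (1 / N\<^sup>2 * (norm \<zeta>)\<^sup>2)))))"
  proof (intro Bochner_Integration.integral_cong[OF refl])
    fix \<zeta> :: "real^2"
    have 1: "cis (2 * \<tau> * ((?m + \<zeta>) \<bullet> \<xi>)) = cis (- (\<tau> * (norm \<xi>)\<^sup>2)) * cis (\<zeta> \<bullet> ((2 * \<tau>) *\<^sub>R \<xi>))"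
      unfolding cis_mult by (simp add: inner_add_left power2_norm_eq_inner algebra_simps)
    have n: "(norm (?m + \<zeta> + \<xi>))\<^sup>2 + (norm (?m + \<zeta>))\<^sup>2 = 2 * (norm \<zeta>)\<^sup>2 + (norm \<xi>)\<^sup>2 / 2"
      unfolding power2_norm_eq_inner by (simp add: inner_add_left inner_add_right inner_diff_left inner_diff_right inner_commute algebra_simps)
    have "gauss (1 / (2 * N\<^sup>2)) (?m + \<zeta> + \<xi>) * gauss (1 / (2 * N\<^sup>2)) (?m + \<zeta>) = exp (- (1 / (2 * N\<^sup>2) * ((norm (?m + \<zeta> + \<xi>))\<^sup>2 + (norm (?m + \<zeta>))\<^sup>2)))"
      unfolding gauss_def exp_add[symmetric] distrib_left by simp
    also have "\<dots> = gauss (1 / (4 * N\<^sup>2)) \<xi> * exp (- (1 / N\<^sup>2 * (norm \<zeta>)\<^sup>2))"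
      unfolding n gauss_def exp_add[symmetric] using N by (simp add: field_simps)
    finally have 2: "gauss (1 / (2 * N\<^sup>2)) (?m + \<zeta> + \<xi>) * gauss (1 / (2 * N\<^sup>2)) (?m + \<zeta>) = gauss (1 / (4 * N\<^sup>2)) \<xi> * exp (- (1 / N\<^sup>2 * (norm \<zeta>)\<^sup>2))" .
    have "complex_of_real (c * gauss (1 / (2 * N\<^sup>2)) (?m + \<zeta> + \<xi>)) * cnj (complex_of_real (c * gauss (1 / (2 * N\<^sup>2)) (?m + \<zeta>)))
      = of_real (c\<^sup>2 * (gauss (1 / (2 * N\<^sup>2)) (?m + \<zeta> + \<xi>) * gauss (1 / (2 * N\<^sup>2)) (?m + \<zeta>)))"
      by (simp only: complex_cnj_complex_of_real of_real_mult[symmetric] power2_eq_square mult_ac)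
    also have "\<dots> = of_real (c\<^sup>2 * gauss (1 / (4 * N\<^sup>2)) \<xi>) * of_real (exp (- (1 / N\<^sup>2 * (norm \<zeta>)\<^sup>2)))"
      unfolding 2 by (simp only: of_real_mult mult.assoc)
    finally show "?f (?m + \<zeta>) = (of_real (c\<^sup>2 * gauss (1 / (4 * N\<^sup>2)) \<xi>) * cis (- (\<tau> * (norm \<xi>)\<^sup>2))) * (cis (\<zeta> \<bullet> ((2 * \<tau>) *\<^sub>R \<xi>)) * of_real (exp (- (1 / N\<^sup>2 * (norm \<zeta>)\<^sup>2))))"
      unfolding 1 by (simp only: mult_ac)
  qed
  also have "\<dots> = (of_real (c\<^sup>2 * gauss (1 / (4 * N\<^sup>2)) \<xi>) * cis (- (\<tau> * (norm \<xi>)\<^sup>2))) * of_real (pi / (1 / N\<^sup>2) * exp (- (norm ((2 * \<tau>) *\<^sub>R \<xi>))\<^sup>2 / (4 * (1 / N\<^sup>2))))"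
    by (simp only: integral_mult_right_zero gauss_plane(2)[OF a])
  also have "exp (- (norm ((2 * \<tau>) *\<^sub>R \<xi>))\<^sup>2 / (4 * (1 / N\<^sup>2))) = gauss (\<tau>\<^sup>2 * N\<^sup>2) \<xi>"
    using N by (simp add: gauss_def power_mult_distrib)
  also have "(of_real (c\<^sup>2 * gauss (1 / (4 * N\<^sup>2)) \<xi>) * cis (- (\<tau> * (norm \<xi>)\<^sup>2))) * of_real (pi / (1 / N\<^sup>2) * gauss (\<tau>\<^sup>2 * N\<^sup>2) \<xi>)
    = of_real (c\<^sup>2 * pi * N\<^sup>2 * (gauss (1 / (4 * N\<^sup>2)) \<xi> * gauss (\<tau>\<^sup>2 * N\<^sup>2) \<xi>)) * cis (- (\<tau> * (norm \<xi>)\<^sup>2))"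
    by simp
  finally show ?thesis unfolding gauss_mult .
qed

text \<open>For fixed A it is comparable with 1 / |\<xi>| when 2^(-J) < |\<xi>| < 1, like the
  iterate that it tests. As a finite sum of Gaussians it is a Schwartz function with explicit
  integrals.\<close>

definition probe :: "real \<Rightarrow> nat \<Rightarrow> real^2 \<Rightarrow> real" where
  "probe A J \<xi> = (\<Sum>j\<le>J. 2 ^ j * gauss (A * 4 ^ j) \<xi>)"

lemma schwartz_probe:
  assumes "A > 0" shows "(\<lambda>\<xi>. complex_of_real (probe A J \<xi>)) \<in> schwartz"
proof (induction J)
  case 0
  show ?case using schwartz_gaussian[OF assms] by (simp add: probe_def gauss_def)
next
  case (Suc J)
  have "(\<lambda>\<xi>. complex_of_real (gauss (A * 4 ^ Suc J) \<xi>)) \<in> schwartz"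
    unfolding gauss_def using assms by (intro schwartz_gaussian) simp
  from schwartz_add[OF Suc schwartz_cmult[OF this, of "2 ^ Suc J"]]
  show ?case by (simp add: probe_def)
qed

lemma probe_nonneg: "0 \<le> probe A J \<xi>"
  unfolding probe_def by (intro sum_nonneg) simp

lemma probe_measurable [measurable]: "probe A J \<in> borel_measurable borel"
  unfolding probe_def[abs_def] by measurable

text \<open>Each term is at most 2^(- |j - k|): different scales are almost orthogonal, so the
  double sum grows like J and not like J^2.\<close>

lemma dyadic_sum_bound:
  "(\<Sum>j\<le>J. \<Sum>k\<le>J. 2 ^ j * 2 ^ k / (4 ^ j + 4 ^ k :: real)) \<le> 4 * real (J + 1)"
proof -
  define t where "t = (\<lambda>j k::nat. if k \<le> j then 2 ^ k / 2 ^ j else (0::real))"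
  have pw: "2 ^ j * 2 ^ k / (4 ^ j + 4 ^ k :: real) \<le> t j k + t k j" for j k
  proof -
    have four: "(4::real) ^ n = 2 ^ n * 2 ^ n" for n by (simp flip: power_mult_distrib)
    have *: "2 ^ j * 2 ^ k / (4 ^ j + 4 ^ k :: real) \<le> 2 ^ k / 2 ^ j" for j k :: nat
    proof -
      have "2 ^ j * 2 ^ k / (4 ^ j + 4 ^ k :: real) \<le> 2 ^ j * 2 ^ k / 4 ^ j"
        by (intro divide_left_mono) (auto intro!: mult_pos_pos add_pos_pos)
      also have "\<dots> = 2 ^ k / 2 ^ j" by (simp add: four)
      finally show ?thesis .
    qed
    have "t j k \<ge> 0" "t k j \<ge> 0" by (auto simp: t_def)
    moreover have "2 ^ j * 2 ^ k / (4 ^ j + 4 ^ k :: real) \<le> t j k" if "k \<le> j" using *[of j k] that by (simp add: t_def)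
    moreover have "2 ^ j * 2 ^ k / (4 ^ j + 4 ^ k :: real) \<le> t k j" if "j \<le> k"
      using *[of k j] that by (simp add: t_def add.commute mult.commute)
    ultimately show ?thesis by (cases "k \<le> j") fastforce+
  qed
  have geo: "(\<Sum>k\<le>J. t j k) \<le> 2" if "j \<le> J" for j
  proof -
    have "(\<Sum>k\<le>J. t j k) = (\<Sum>k\<le>j. 2 ^ k / 2 ^ j)"
      using that unfolding t_def by (intro sum.mono_neutral_cong_right) auto
    also have "\<dots> = (2 ^ Suc j - 1) / 2 ^ j"
      by (simp add: sum_divide_distrib[symmetric] lessThan_Suc_atMost[symmetric] mask_eq_sum_exp[symmetric] flip: sum_gp_strict) (simp add: sum_gp_strict)
    also have "\<dots> \<le> 2" by (simp add: field_simps)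
    finally show ?thesis .
  qed
  have "(\<Sum>j\<le>J. \<Sum>k\<le>J. 2 ^ j * 2 ^ k / (4 ^ j + 4 ^ k :: real)) \<le> (\<Sum>j\<le>J. \<Sum>k\<le>J. t j k + t k j)"
    by (intro sum_mono pw)
  also have "\<dots> = (\<Sum>j\<le>J. \<Sum>k\<le>J. t j k) + (\<Sum>k\<le>J. \<Sum>j\<le>J. t k j)"
    by (simp add: sum.distrib) (rule sum.swap)
  also have "\<dots> \<le> (\<Sum>j\<le>J. 2) + (\<Sum>k\<le>J. 2)" by (intro add_mono sum_mono geo) auto
  finally show ?thesis by simp
qed

text \<open>1 + x \<le> e^x bounds the weight by e^(- s |\<xi>|^2). With A = 1 - s, half of the
  exponent A (4^j + 4^k) absorbs this growth, because 4^j + 4^k \<ge> 2; the other half integrates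
  to the sum in \<open>dyadic_sum_bound\<close>.\<close>

lemma probe_norm:
  assumes s: "s \<le> 0"
  shows "(LINT \<xi>|lborel. weight (- s) \<xi> * (probe (1 - s) J \<xi>)\<^sup>2) \<le> 8 * pi * real (J + 1)"
proof -
  let ?A = "1 - s"
  have A: "?A \<ge> 1" using s by simp
  let ?h = "\<lambda>j k. gauss (?A / 2 * (4 ^ j + 4 ^ k))"
  have pos: "?A / 2 * (4 ^ j + 4 ^ k) > 0" for j k :: nat using A by (auto intro!: mult_pos_pos add_pos_pos)
  have sq: "(probe ?A J \<xi>)\<^sup>2 = (\<Sum>j\<le>J. \<Sum>k\<le>J. 2 ^ j * 2 ^ k * gauss (?A * (4 ^ j + 4 ^ k)) \<xi>)" for \<xi>
    unfolding probe_def power2_eq_square sum_product distrib_left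
    by (intro sum.cong refl) (simp add: gauss_mult[symmetric] mult_ac)
  have w: "weight (- s) \<xi> * gauss (?A * (4 ^ j + 4 ^ k)) \<xi> \<le> ?h j k \<xi>" for \<xi> j k
  proof -
    have "weight (- s) \<xi> \<le> exp ((norm \<xi>)\<^sup>2) powr (- s)"
      unfolding weight_def using s exp_ge_add_one_self[of "(norm \<xi>)\<^sup>2"] by (intro powr_mono2) auto
    also have "\<dots> = gauss s \<xi>" by (simp add: gauss_def powr_def)
    finally have "weight (- s) \<xi> * gauss (?A * (4 ^ j + 4 ^ k)) \<xi> \<le> gauss s \<xi> * gauss (?A * (4 ^ j + 4 ^ k)) \<xi>"
      by (rule mult_right_mono) simp
    also have "\<dots> = gauss (s + ?A * (4 ^ j + 4 ^ k)) \<xi>" by (rule gauss_mult)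
    also have "\<dots> \<le> ?h j k \<xi>"
    proof -
      have "(1::real) \<le> 4 ^ j" "(1::real) \<le> 4 ^ k" by (auto intro: one_le_power)
      hence "(2::real) \<le> 4 ^ j + 4 ^ k" by linarith
      hence "?A / 2 * 2 \<le> ?A / 2 * (4 ^ j + 4 ^ k)" using A by (intro mult_left_mono) auto
      hence "?A / 2 * (4 ^ j + 4 ^ k) \<le> s + ?A * (4 ^ j + 4 ^ k)" by (simp add: field_simps)
      from mult_right_mono[OF this, of "(norm \<xi>)\<^sup>2"] show ?thesis unfolding gauss_def by simp
    qed
    finally show ?thesis .
  qed
  have S: "(\<lambda>\<xi>. complex_of_real (probe ?A J \<xi>)) \<in> schwartz" using A by (intro schwartz_probe) auto
  have i1: "integrable lborel (\<lambda>\<xi>. weight (- s) \<xi> * (probe ?A J \<xi>)\<^sup>2)"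
    using integrable_weight_schwartz[OF S, of "- s"] by simp
  have i2: "integrable lborel (\<lambda>\<xi>. \<Sum>j\<le>J. \<Sum>k\<le>J. 2 ^ j * 2 ^ k * ?h j k \<xi>)"
    by (intro Bochner_Integration.integrable_sum integrable_mult_right gauss_integral(1) pos)
  have "(LINT \<xi>|lborel. weight (- s) \<xi> * (probe ?A J \<xi>)\<^sup>2) \<le> (LINT \<xi>|lborel. (\<Sum>j\<le>J. \<Sum>k\<le>J. 2 ^ j * 2 ^ k * ?h j k \<xi>))"
  proof (rule integral_mono[OF i1 i2])
    fix \<xi>
    have "weight (- s) \<xi> * (probe ?A J \<xi>)\<^sup>2 = (\<Sum>j\<le>J. \<Sum>k\<le>J. 2 ^ j * 2 ^ k * (weight (- s) \<xi> * gauss (?A * (4 ^ j + 4 ^ k)) \<xi>))"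
      unfolding sq sum_distrib_left by (intro sum.cong refl) (simp add: mult_ac)
    also have "\<dots> \<le> (\<Sum>j\<le>J. \<Sum>k\<le>J. 2 ^ j * 2 ^ k * ?h j k \<xi>)" by (intro sum_mono mult_left_mono w) auto
    finally show "weight (- s) \<xi> * (probe ?A J \<xi>)\<^sup>2 \<le> (\<Sum>j\<le>J. \<Sum>k\<le>J. 2 ^ j * 2 ^ k * ?h j k \<xi>)" .
  qed
  also have "\<dots> = (\<Sum>j\<le>J. \<Sum>k\<le>J. 2 ^ j * 2 ^ k * (pi / (?A / 2 * (4 ^ j + 4 ^ k))))"
    using gauss_integral[OF pos]
    by (subst Bochner_Integration.integral_sum, intro Bochner_Integration.integrable_sum integrable_mult_right gauss_integral(1) pos)
       (intro sum.cong refl, subst Bochner_Integration.integral_sum, auto)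
  also have "\<dots> = (2 * pi / ?A) * (\<Sum>j\<le>J. \<Sum>k\<le>J. 2 ^ j * 2 ^ k / (4 ^ j + 4 ^ k))"
    unfolding sum_distrib_left by (intro sum.cong refl) (simp add: field_simps)
  also have "\<dots> \<le> (2 * pi) * (4 * real (J + 1))"
  proof (intro mult_mono dyadic_sum_bound)
    show "2 * pi / ?A \<le> 2 * pi" using A by (simp add: divide_le_eq mult_le_cancel_left1)
  qed (auto intro!: sum_nonneg)
  finally show ?thesis by (simp add: mult_ac)
qed

text \<open>For fixed \<tau> and up to the factor c^2 \<pi> N^2, piece j of the probe contributes at
  least 2^j \<pi> / (2 b), where b = A 4^j + 1 / (4 N^2) + \<tau>^2 N^2. While \<tau> \<le> 2^j / N,
  b is at most (A + 2) 4^j, so this time window yields \<pi> / (2 N (A + 2)) for every j, and the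
  scales add up to the factor J + 1. The condition 2^J \<le> N T puts all windows inside
  [0,T].\<close>

lemma second_iterate_lower_bound:
  assumes A: "A \<ge> 1" and T: "T > 0" and N: "N \<ge> 2" "2 ^ J \<le> N * T"
  shows "c\<^sup>2 * pi\<^sup>2 * N * real (J + 1) / (2 * (A + 2))
    \<le> cmod (LINT \<xi>|lborel. cis (T * (norm \<xi>)\<^sup>2) * second_iterate T (\<lambda>\<xi>. complex_of_real (c * gauss (1 / (2 * N\<^sup>2)) \<xi>)) \<xi>
        * (cis (- T * (norm \<xi>)\<^sup>2) * complex_of_real (probe A J \<xi>)))"
proof -
  let ?g = "\<lambda>\<xi>. complex_of_real (c * gauss (1 / (2 * N\<^sup>2)) \<xi>)"
  define P where "P = c\<^sup>2 * pi * N\<^sup>2"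
  define b0 where "b0 = (\<lambda>\<tau>::real. 1 / (4 * N\<^sup>2) + \<tau>\<^sup>2 * N\<^sup>2)"
  have N0: "N > 0" using N by simp
  have P: "P \<ge> 0" by (simp add: P_def)
  have b0: "b0 \<tau> > 0" for \<tau> using N0 by (simp add: b0_def add_pos_nonneg)
  have [measurable]: "b0 \<in> borel_measurable borel" unfolding b0_def by measurable
  have gm: "(\<lambda>z. gauss (b0 (fst z)) (snd z)) \<in> borel_measurable (lborel \<Otimes>\<^sub>M lborel)"
    unfolding gauss_def by measurable
  define F where "F = (\<lambda>(\<tau>::real, \<xi>::real^2). indicator {0..T} \<tau> *\<^sub>R (complex_of_real (P * gauss (b0 \<tau>) \<xi> * probe A J \<xi>) * cis (- (\<tau> * (norm \<xi>)\<^sup>2))))"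
  define FR where "FR = (\<lambda>(\<tau>::real, \<xi>::real^2). indicator {0..T} \<tau> * (P * gauss (b0 \<tau>) \<xi> * probe A J \<xi> * cos (\<tau> * (norm \<xi>)\<^sup>2)))"
  have Ai: "A * 4 ^ j > 0" for j :: nat using A by simp
  have pint: "integrable lborel (probe A J)"
    unfolding probe_def[abs_def] by (intro Bochner_Integration.integrable_sum integrable_mult_right gauss_integral(1) Ai)
  have Fm: "F \<in> borel_measurable (lborel \<Otimes>\<^sub>M lborel)"
    unfolding F_def case_prod_beta' using gm by measurable
  have Fi: "integrable (lborel \<Otimes>\<^sub>M lborel) F"
  proof (rule Bochner_Integration.integrable_bound[OF _ Fm])
    have "integrable lborel (indicator {0..T} :: real \<Rightarrow> real)"
      by (simp add: integrable_indicator_iff emeasure_lborel_Icc_eq)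
    from integrable_mult_right[OF lborel_integrable_mult_pair[OF this pint], of P]
    show "integrable (lborel \<Otimes>\<^sub>M lborel) (\<lambda>z. P * (case z of (\<tau>::real, \<xi>) \<Rightarrow> indicator {0..T} \<tau> * probe A J \<xi>))" .
    have g1: "gauss (b0 \<tau>) \<xi> \<le> 1" for \<tau> \<xi> using b0[of \<tau>] by (simp add: gauss_def)
    have "P * gauss (b0 \<tau>) \<xi> * probe A J \<xi> \<le> P * probe A J \<xi>" for \<tau> \<xi>
      using mult_right_mono[OF mult_left_mono[OF g1 P] probe_nonneg, of \<tau> \<xi> A J \<xi>] by simp
    thus "AE z in lborel \<Otimes>\<^sub>M lborel. norm (F z) \<le> norm (P * (case z of (\<tau>::real, \<xi>) \<Rightarrow> indicator {0..T} \<tau> * probe A J \<xi>))"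
      using P probe_nonneg[of A J] by (intro AE_I2) (auto simp: F_def norm_mult abs_mult indicator_def split: prod.split)
  qed
  have Re_F: "Re (F z) = FR z" for z
    by (cases z) (simp add: F_def FR_def)
  have FRi: "integrable (lborel \<Otimes>\<^sub>M lborel) FR"
    using integrable_bounded_linear[OF bounded_linear_Re Fi] by (simp add: Re_F)
  have S: "second_iterate T ?g \<xi> = (LINT \<tau>|lborel. indicator {0..T} \<tau> *\<^sub>R (complex_of_real (P * gauss (b0 \<tau>) \<xi>) * cis (- (\<tau> * (norm \<xi>)\<^sup>2))))" for \<xi>
    unfolding second_iterate_def gauss_interaction[OF N0] P_def b0_def ..
  define Q where "Q = (LINT \<xi>|lborel. cis (T * (norm \<xi>)\<^sup>2) * second_iterate T ?g \<xi> * (cis (- T * (norm \<xi>)\<^sup>2) * complex_of_real (probe A J \<xi>)))"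
  \<comment> \<open>The phase of the test function cancels that of the free evolution at time T;
    only e^(- i \<tau> |\<xi>|^2) from the interaction is left, and its real part is the cosine in
    \<open>FR\<close>.\<close>
  have "Q = (LINT \<xi>|lborel. LINT \<tau>|lborel. F (\<tau>, \<xi>))"
    unfolding Q_def
  proof (rule Bochner_Integration.integral_cong[OF refl])
    fix \<xi> :: "real^2"
    have one: "cis (T * (norm \<xi>)\<^sup>2) * cis (- T * (norm \<xi>)\<^sup>2) = 1" by (simp add: cis_mult)
    have "cis (T * (norm \<xi>)\<^sup>2) * second_iterate T ?g \<xi> * (cis (- T * (norm \<xi>)\<^sup>2) * complex_of_real (probe A J \<xi>))
      = (cis (T * (norm \<xi>)\<^sup>2) * cis (- T * (norm \<xi>)\<^sup>2)) * (second_iterate T ?g \<xi> * complex_of_real (probe A J \<xi>))"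
      by (simp only: mult_ac)
    also have "\<dots> = second_iterate T ?g \<xi> * complex_of_real (probe A J \<xi>)" by (simp only: one mult_1)
    also have "\<dots> = (LINT \<tau>|lborel. indicator {0..T} \<tau> *\<^sub>R (complex_of_real (P * gauss (b0 \<tau>) \<xi>) * cis (- (\<tau> * (norm \<xi>)\<^sup>2))) * complex_of_real (probe A J \<xi>))"
      unfolding S by (rule Bochner_Integration.integral_mult_left_zero[symmetric])
    also have "\<dots> = (LINT \<tau>|lborel. F (\<tau>, \<xi>))"
      by (intro Bochner_Integration.integral_cong[OF refl]) (simp add: F_def mult_ac)
    finally show "cis (T * (norm \<xi>)\<^sup>2) * second_iterate T ?g \<xi> * (cis (- T * (norm \<xi>)\<^sup>2) * complex_of_real (probe A J \<xi>)) = (LINT \<tau>|lborel. F (\<tau>, \<xi>))" .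
  qed
  also have "\<dots> = (LINT z|(lborel \<Otimes>\<^sub>M lborel). F z)"
    using lborel_pair.integral_snd[of "\<lambda>\<tau> \<xi>. F (\<tau>, \<xi>)"] Fi by simp
  finally have "Re Q = Re (LINT z|(lborel \<Otimes>\<^sub>M lborel). F z)" by simp
  also have "\<dots> = (LINT z|(lborel \<Otimes>\<^sub>M lborel). FR z)"
    using integral_bounded_linear[OF bounded_linear_Re Fi] by (simp add: Re_F)
  also have "\<dots> = (LINT \<tau>|lborel. LINT \<xi>|lborel. FR (\<tau>, \<xi>))"
    using lborel_pair.integral_fst'[OF FRi] by simp
  finally have ReQ: "Re Q = (LINT \<tau>|lborel. LINT \<xi>|lborel. FR (\<tau>, \<xi>))" .
  \<comment> \<open>The lower bound for the pairing with piece j, with b replaced by its bound 4^j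
    (A + 2) on the window.\<close>
  define k where "k = (\<lambda>j::nat. 2 ^ j * pi / (2 * (4 ^ j * (A + 2))))"
  let ?L = "\<lambda>\<tau>::real. P * (\<Sum>j\<le>J. indicator {0..2 ^ j / N} \<tau> * k j)"
  have Li: "integrable lborel ?L"
    by (intro integrable_mult_right Bochner_Integration.integrable_sum integrable_mult_left)
       (simp add: integrable_indicator_iff emeasure_lborel_Icc_eq)
  have "(LINT \<tau>|lborel. ?L \<tau>) \<le> (LINT \<tau>|lborel. LINT \<xi>|lborel. FR (\<tau>, \<xi>))"
  proof (rule integral_mono[OF Li])
    show "integrable lborel (\<lambda>\<tau>. LINT \<xi>|lborel. FR (\<tau>, \<xi>))" using lborel_pair.integrable_fst'[OF FRi] .
    fix \<tau> :: real
    have sub: "2 ^ j / N \<le> T" if "j \<le> J" for j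
    proof -
      have "(2::real) ^ j \<le> 2 ^ J" using that by (intro power_increasing) auto
      hence "2 ^ j \<le> N * T" using N(2) by (rule order_trans)
      thus ?thesis using N0 by (simp add: divide_le_eq mult.commute)
    qed
    show "?L \<tau> \<le> (LINT \<xi>|lborel. FR (\<tau>, \<xi>))"
    proof (cases "\<tau> \<in> {0..T}")
      case False
      hence "indicator {0..2 ^ j / N} \<tau> = (0::real)" if "j \<le> J" for j
        using sub[OF that] by (auto simp: indicator_def)
      thus ?thesis using False by (simp add: FR_def)
    next
      case True
      let ?b = "\<lambda>j::nat. A * 4 ^ j + b0 \<tau>"
      have four: "(1::real) \<le> 4 ^ j" for j :: nat by (rule one_le_power) simp
      have bpos: "?b j > 0" for j using Ai[of j] b0[of \<tau>] by simp
      \<comment> \<open>N \<ge> 2 enters through 4 \<tau> \<le> 2 \<tau> N \<le> 1 + (\<tau> N)^2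
        \<le> b, the condition under which \<open>gauss_cos_integral\<close> controls the
        oscillation.\<close>
      have b\<tau>: "4 * \<tau> \<le> ?b j" for j
      proof -
        have "4 * \<tau> \<le> 2 * (\<tau> * N)" using True N mult_left_mono[of 2 N "2 * \<tau>"] by simp
        also have "\<dots> \<le> 1 + (\<tau> * N)\<^sup>2" using sum_squares_bound[of 1 "\<tau> * N"] by simp
        also have "\<dots> \<le> A * 4 ^ j + b0 \<tau>"
          using mult_mono[OF A four[of j]] A by (simp add: b0_def power_mult_distrib add_mono)
        finally show ?thesis .
      qed
      have FRs: "FR (\<tau>, \<xi>) = P * (\<Sum>j\<le>J. 2 ^ j * (gauss (?b j) \<xi> * cos (\<tau> * (norm \<xi>)\<^sup>2)))" for \<xi>
        using True by (simp add: FR_def probe_def gauss_mult[symmetric] sum_distrib_left sum_distrib_right mult_ac)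
      have "(LINT \<xi>|lborel. FR (\<tau>, \<xi>)) = P * (\<Sum>j\<le>J. 2 ^ j * (LINT \<xi>|lborel. gauss (?b j) \<xi> * cos (\<tau> * (norm \<xi>)\<^sup>2)))"
        unfolding FRs using True gauss_cos_integral(1)[OF bpos _ b\<tau>]
        by (simp add: Bochner_Integration.integral_sum)
      also have "\<dots> \<ge> ?L \<tau>"
      proof (intro mult_left_mono sum_mono P)
        fix j assume "j \<in> {..J}"
        have low: "2 ^ j * (pi / (2 * ?b j)) \<le> 2 ^ j * (LINT \<xi>|lborel. gauss (?b j) \<xi> * cos (\<tau> * (norm \<xi>)\<^sup>2))"
          using True by (intro mult_left_mono gauss_cos_integral(2)[OF bpos _ b\<tau>]) auto
        have "indicator {0..2 ^ j / N} \<tau> * k j \<le> 2 ^ j * (pi / (2 * ?b j))"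
        proof (cases "\<tau> \<in> {0..2 ^ j / N}")
          case True
          have "\<tau> * N \<le> 2 ^ j" using True N0 by (simp add: le_divide_eq)
          hence "(\<tau> * N)\<^sup>2 \<le> (2 ^ j)\<^sup>2" using True N0 by (intro power_mono) auto
          also have "(2 ^ j)\<^sup>2 = (4::real) ^ j" by (simp add: power_mult[symmetric] mult.commute power2_eq_square flip: power_mult_distrib)
          finally have 1: "\<tau>\<^sup>2 * N\<^sup>2 \<le> 4 ^ j" by (simp add: power_mult_distrib)
          have "1 \<le> 4 * N\<^sup>2" using mult_mono[of 2 N 2 N] N by (simp add: power2_eq_square)
          hence 2: "1 / (4 * N\<^sup>2) \<le> 4 ^ j" using four[of j] N0 by (simp add: divide_le_eq mult_ge1_I)
          have "?b j \<le> 4 ^ j * (A + 2)" using 1 2 by (simp add: b0_def algebra_simps)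
          hence "2 ^ j * (pi / (2 * (4 ^ j * (A + 2)))) \<le> 2 ^ j * (pi / (2 * ?b j))"
            using bpos[of j] A by (intro mult_left_mono divide_left_mono) auto
          thus ?thesis using True by (simp add: k_def)
        next
          case False thus ?thesis using bpos[of j] by simp
        qed
        with low show "indicator {0..2 ^ j / N} \<tau> * k j \<le> 2 ^ j * (LINT \<xi>|lborel. gauss (?b j) \<xi> * cos (\<tau> * (norm \<xi>)\<^sup>2))" by linarith
      qed
      finally show ?thesis .
    qed
  qed
  moreover have "(LINT \<tau>|lborel. ?L \<tau>) = c\<^sup>2 * pi\<^sup>2 * N * real (J + 1) / (2 * (A + 2))"
  proof -
    have "(LINT \<tau>|lborel. ?L \<tau>) = P * (\<Sum>j\<le>J. (LINT \<tau>|lborel. indicator {0..2 ^ j / N} \<tau> * k j))"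
      by (subst integral_mult_right_zero, subst Bochner_Integration.integral_sum)
         (auto simp: integrable_indicator_iff emeasure_lborel_Icc_eq)
    also have "(\<Sum>j\<le>J. (LINT \<tau>|lborel. indicator {0..2 ^ j / N} \<tau> * k j)) = (\<Sum>j\<le>J. pi / (2 * N * (A + 2)))"
    proof (intro sum.cong refl)
      fix j :: nat
      have "(LINT \<tau>|lborel. indicator {0..2 ^ j / N} \<tau> * k j) = 2 ^ j / N * k j" using N0 by simp
      also have "\<dots> = (2 ^ j * 2 ^ j) / 4 ^ j * (pi / (2 * N * (A + 2)))" by (simp add: k_def mult_ac)
      also have "(2 ^ j * 2 ^ j) / (4::real) ^ j = 1" by (simp flip: power_mult_distrib)
      finally show "(LINT \<tau>|lborel. indicator {0..2 ^ j / N} \<tau> * k j) = pi / (2 * N * (A + 2))" by simp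
    qed
    also have "P * (\<Sum>j\<le>J. pi / (2 * N * (A + 2))) = c\<^sup>2 * pi\<^sup>2 * N * real (J + 1) / (2 * (A + 2))"
    proof -
      define m where "m = A + 2"
      have "m \<noteq> 0" using A by (simp add: m_def)
      thus ?thesis using N0 by (simp add: P_def power2_eq_square field_simps flip: m_def)
    qed
    finally show ?thesis .
  qed
  ultimately have "c\<^sup>2 * pi\<^sup>2 * N * real (J + 1) / (2 * (A + 2)) \<le> Re Q" by (simp only: ReQ)
  also have "\<dots> \<le> cmod Q" by (rule complex_Re_le_cmod)
  finally show ?thesis unfolding Q_def .
qed

section \<open>Gaussian data and the contradiction\<close>

lemma scaleR_dist_of: "x *\<^sub>R dist_of v = dist_of (\<lambda>\<xi>. of_real x * v \<xi>)"
  by (rule ext) (simp add: scaleR_fun_def dist_of_def scaleR_conv_of_real mult.assoc)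

lemma gauss_data:
  fixes c a :: real
  assumes a: "a > 0"
  defines "g \<equiv> \<lambda>\<xi>. complex_of_real (c * gauss a \<xi>)"
  shows "continuous_on UNIV g" "\<exists>B. \<forall>\<xi>. cmod (g \<xi>) \<le> B * decay \<xi>" "integrable lborel g"
    "dist_of g \<in> vecs (sobolev_rad s)"
    "nrm (sobolev_rad s) (dist_of g) = sqrt (LINT \<xi>|lborel. weight s \<xi> * (cmod (g \<xi>))\<^sup>2)"
proof -
  show g: "continuous_on UNIV g" unfolding g_def by (intro continuous_intros)
  obtain B where B: "\<And>\<xi>. gauss a \<xi> \<le> B * decay \<xi>" using gauss_decay_bound[OF a] by blast
  have b: "cmod (g \<xi>) \<le> (\<bar>c\<bar> * B) * decay \<xi>" for \<xi>
    using mult_left_mono[OF B, of "\<bar>c\<bar>"] by (simp add: g_def norm_mult mult.assoc)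
  thus "\<exists>B. \<forall>\<xi>. cmod (g \<xi>) \<le> B * decay \<xi>" by blast
  have m: "g \<in> borel_measurable borel" using g by (rule borel_measurable_continuous_onI)
  show i: "integrable lborel g" by (rule integrable_weight_decay(1)[OF m b])
  have "dist_of g \<in> radial"
    by (rule dist_of_radial[OF i]) (simp add: g_def gauss_def orthogonal_transformation_norm)
  thus "dist_of g \<in> vecs (sobolev_rad s)"
    using dist_of_in_sobolev[OF i integrable_weight_decay(2)[OF m b]] by (simp add: sobolev_rad_def)
  show "nrm (sobolev_rad s) (dist_of g) = sqrt (LINT \<xi>|lborel. weight s \<xi> * (cmod (g \<xi>))\<^sup>2)"
    using sobolev_nrm_dist_of[OF i] by (simp add: sobolev_rad_def)
qed

theorem theorem1p5:
  fixes \<eta> :: complex and s T :: real and \<Phi> :: "dist \<Rightarrow> real \<Rightarrow> dist"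
  assumes "\<eta> \<noteq> 0" and "s \<le> - 1 / 2" and "T > 0"
    and "data_to_solution_map \<eta> s T \<Phi>"
  shows "\<not> C2_at (sobolev_rad s) (C_space T (sobolev_rad s)) \<Phi> 0"
proof
  let ?X = "sobolev_rad s" and ?Y = "C_space T (sobolev_rad s)"
  assume C2: "C2_at ?X ?Y \<Phi> 0"
  note T = \<open>T > 0\<close> and s = \<open>s \<le> - 1 / 2\<close>
  have nrm_X: "nrm ?X = nrm (sobolev s)" by (simp add: sobolev_rad_def)
  have nrm_nonneg: "0 \<le> nrm (sobolev s) f" for f
    by (auto simp: sobolev_def intro!: integral_nonneg_AE)
  \<comment> \<open>Keeping only a finite and bounded H^s norm on [0,T] makes closure under
    differences a consequence of the triangle inequality.\<close>
  define D where "D = {F. (\<forall>t\<in>{0..T}. sobolev_fn s (F t)) \<and> bdd_above ((\<lambda>t. nrm (sobolev s) (F t)) ` {0..T})}"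
  have nrm_Y: "nrm ?Y F = (SUP t\<in>{0..T}. nrm (sobolev s) (F t))" for F by (simp add: C_space_def nrm_X)
  have D_le: "nrm (sobolev s) (F t) \<le> nrm ?Y F" if "F \<in> D" "t \<in> {0..T}" for F t
    using that unfolding nrm_Y D_def by (auto intro: cSUP_upper)
  have diff_le: "nrm (sobolev s) ((F - G) t) \<le> nrm ?Y F + nrm ?Y G" if "F \<in> D" "G \<in> D" "t \<in> {0..T}" for F G t
    using sobolev_fn_diff(2)[of s "F t" "G t"] D_le[OF that(1,3)] D_le[OF that(2,3)] that
    unfolding D_def by fastforce
  have D_diff: "F - G \<in> D" if "F \<in> D" "G \<in> D" for F G
  proof -
    have "sobolev_fn s ((F - G) t)" if "t \<in> {0..T}" for t
      using \<open>F \<in> D\<close> \<open>G \<in> D\<close> that sobolev_fn_diff(1) by (simp add: D_def)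
    moreover have "bdd_above ((\<lambda>t. nrm (sobolev s) ((F - G) t)) ` {0..T})"
      by (rule bdd_aboveI2[OF diff_le[OF that]])
    ultimately show ?thesis unfolding D_def by blast
  qed
  have scale: "x *\<^sub>R dist_of (\<lambda>\<xi>. complex_of_real (c * gauss a \<xi>)) = dist_of (\<lambda>\<xi>. complex_of_real (x * c * gauss a \<xi>))" for x c a
    by (simp add: scaleR_dist_of mult.assoc)
  have scale_mem: "x *\<^sub>R dist_of (\<lambda>\<xi>. complex_of_real (c * gauss a \<xi>)) \<in> vecs (sobolev_rad s')" if "a > 0" for x c a s'
    unfolding scale by (rule gauss_data(4)[OF that])
  have scale_nrm: "nrm ?X (x *\<^sub>R dist_of (\<lambda>\<xi>. complex_of_real (c * gauss a \<xi>))) = \<bar>x\<bar> * nrm ?X (dist_of (\<lambda>\<xi>. complex_of_real (c * gauss a \<xi>)))" if "a > 0" for x c a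
  proof -
    have "(LINT \<xi>|lborel. weight s \<xi> * (cmod (complex_of_real (x * c * gauss a \<xi>)))\<^sup>2)
      = (LINT \<xi>|lborel. x\<^sup>2 * (weight s \<xi> * (cmod (complex_of_real (c * gauss a \<xi>)))\<^sup>2))"
      by (intro Bochner_Integration.integral_cong[OF refl]) (simp add: norm_mult power_mult_distrib mult_ac)
    also have "\<dots> = x\<^sup>2 * (LINT \<xi>|lborel. weight s \<xi> * (cmod (complex_of_real (c * gauss a \<xi>)))\<^sup>2)"
      by (rule integral_mult_right_zero)
    finally show ?thesis
      unfolding scale gauss_data(5)[OF that] by (simp only: real_sqrt_mult real_sqrt_abs)
  qed
  \<comment> \<open>The zero distribution arises as 0 times a Gaussian one.\<close>
  have X0: "0 \<in> vecs ?X" "nrm ?X 0 = 0"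
    using scale_mem[of 1 0 1 s] scale_nrm[of 1 0 1] by simp_all
  have YD: "vecs ?Y \<subseteq> D"
    using C_space_bdd_above[of T _ s] T unfolding D_def by auto
  show False
  proof (rule C2_at_second_coefficient_bound[OF C2 X0 _ _ YD D_diff])
    show "0 \<le> nrm ?X x" for x by (simp add: nrm_X nrm_nonneg)
    show "\<Phi> x \<in> vecs ?Y" if "x \<in> vecs ?X" "nrm ?X x < 1" for x
      using assms(4) that unfolding data_to_solution_map_def by blast
    show "nrm ?Y (F - G) \<le> nrm ?Y F + nrm ?Y G" if "F \<in> D" "G \<in> D" for F G
      unfolding nrm_Y[of "F - G"] using T diff_le[OF that] by (intro cSUP_least) auto
  next
    fix K :: real
    assume K: "K \<ge> 0"
      "\<And>e \<l> C a b M r. \<lbrakk>\<And>c. c *\<^sub>R e \<in> vecs ?X; \<And>c. nrm ?X (c *\<^sub>R e) = \<bar>c\<bar> * nrm ?X e; nrm ?X e \<le> 1;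
         \<And>F G. F \<in> D \<Longrightarrow> G \<in> D \<Longrightarrow> \<l> (F - G) = (\<l> F - \<l> G :: complex);
         \<And>F c. F \<in> D \<Longrightarrow> \<l> (c *\<^sub>R F) = of_real c * \<l> F;
         \<And>F. F \<in> D \<Longrightarrow> cmod (\<l> F) \<le> C * nrm ?Y F; C \<ge> 0; r > 0;
         \<And>\<epsilon>. 0 \<le> \<epsilon> \<Longrightarrow> \<epsilon> < r \<Longrightarrow> cmod (\<l> (\<Phi> (\<epsilon> *\<^sub>R e)) - of_real \<epsilon> * a - of_real \<epsilon> ^ 2 * b) \<le> M * \<epsilon> ^ 3\<rbrakk>
       \<Longrightarrow> cmod b \<le> C * K"
    \<comment> \<open>The constant in \<open>weighted_gauss_integral\<close>.\<close>
    define \<kappa> :: real where "\<kappa> = exp 1 * pi\<^sup>2 / 2"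
    have \<kappa>: "\<kappa> > 0" by (simp add: \<kappa>_def)
    define \<mu> where "\<mu> = cmod \<eta> / (2 * pi) * (pi\<^sup>2 / (2 * \<kappa> * (3 - s)))"
    have \<mu>: "\<mu> > 0" using \<open>\<eta> \<noteq> 0\<close> \<kappa> s by (simp add: \<mu>_def)
    have main: "\<mu> * real (J + 1) \<le> sqrt (8 * pi * real (J + 1)) * K" for J :: nat
    proof -
      define N where "N = max 2 (2 ^ J / T)"
      have N: "N \<ge> 2" "2 ^ J \<le> N * T"
      proof -
        have "2 ^ J / T \<le> N" by (simp add: N_def)
        thus "2 ^ J \<le> N * T" using T by (simp add: divide_le_eq)
      qed (simp add: N_def)
      have N0: "N > 0" using N by simp
      define a where "a = 1 / (2 * N\<^sup>2)"
      have a: "a > 0" using N0 by (simp add: a_def)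
      \<comment> \<open>Normalises the data: the squared norm is at most c^2 \<kappa> N = 1.\<close>
      define c where "c = 1 / sqrt (\<kappa> * N)"
      have c2: "c\<^sup>2 = 1 / (\<kappa> * N)" using \<kappa> N0 by (simp add: c_def power_divide)
      define g where "g = (\<lambda>\<xi>. complex_of_real (c * gauss a \<xi>))"
      define e where "e = dist_of g"
      define \<psi> where "\<psi> = (\<lambda>\<xi>. cis (- T * (norm \<xi>)\<^sup>2) * complex_of_real (probe (1 - s) J \<xi>))"
      have \<psi>: "\<psi> \<in> schwartz" unfolding \<psi>_def using s by (intro schwartz_mult_cis schwartz_probe) auto
      let ?\<l> = "\<lambda>F::real \<Rightarrow> dist. F T (fourier \<psi>)"
      let ?C = "sqrt (LINT \<xi>|lborel. weight (- s) \<xi> * (cmod (\<psi> \<xi>))\<^sup>2)"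
      let ?a = "LINT \<xi>|lborel. cis (T * (norm \<xi>)\<^sup>2) * g \<xi> * \<psi> \<xi>"
      let ?Q = "LINT \<xi>|lborel. cis (T * (norm \<xi>)\<^sup>2) * second_iterate T g \<xi> * \<psi> \<xi>"
      let ?b = "- \<i> * \<eta> / of_real (2 * pi) * ?Q"
      have e_mem: "x *\<^sub>R e \<in> vecs (sobolev_rad s')" for x s' unfolding e_def g_def by (rule scale_mem[OF a])
      have e_nrm: "nrm ?X (x *\<^sub>R e) = \<bar>x\<bar> * nrm ?X e" for x unfolding e_def g_def by (rule scale_nrm[OF a])
      have e1: "nrm ?X e \<le> 1"
      proof -
        have "(LINT \<xi>|lborel. weight s \<xi> * (cmod (g \<xi>))\<^sup>2) = (LINT \<xi>|lborel. c\<^sup>2 * (weight s \<xi> * gauss (1 / N\<^sup>2) \<xi>))"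
        proof (intro Bochner_Integration.integral_cong[OF refl])
          fix \<xi>
          have "(gauss a \<xi>)\<^sup>2 = gauss (1 / N\<^sup>2) \<xi>" unfolding power2_eq_square[of "gauss a \<xi>"] gauss_mult by (simp add: a_def)
          thus "weight s \<xi> * (cmod (g \<xi>))\<^sup>2 = c\<^sup>2 * (weight s \<xi> * gauss (1 / N\<^sup>2) \<xi>)"
            by (simp add: g_def norm_mult power_mult_distrib)
        qed
        also have "\<dots> \<le> c\<^sup>2 * (\<kappa> * N)"
          unfolding integral_mult_right_zero \<kappa>_def by (intro mult_left_mono weighted_gauss_integral(2) s N0) simp
        also have "\<dots> = 1" using \<kappa> N0 by (simp add: c2)
        finally show ?thesis unfolding e_def g_def gauss_data(5)[OF a] by simp
      qed
      obtain B where B: "\<And>\<xi>. cmod (g \<xi>) \<le> B * decay \<xi>" using gauss_data(2)[OF a, of c] unfolding g_def by blast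
      obtain r C' u where r: "r > 0" and ex: "\<And>\<epsilon>. 0 \<le> \<epsilon> \<Longrightarrow> \<epsilon> < r \<Longrightarrow>
          smooth_solution \<eta> T (dist_of (\<lambda>\<xi>. of_real \<epsilon> * g \<xi>)) (u \<epsilon>) \<and>
          (\<forall>\<psi>\<in>schwartz. cmod (u \<epsilon> T (fourier \<psi>)
              - of_real \<epsilon> * (LINT \<xi>|lborel. cis (T * (norm \<xi>)\<^sup>2) * g \<xi> * \<psi> \<xi>)
              - of_real \<epsilon> ^ 2 * (- \<i> * \<eta> / of_real (2 * pi) * (LINT \<xi>|lborel. cis (T * (norm \<xi>)\<^sup>2) * second_iterate T g \<xi> * \<psi> \<xi>)))
            \<le> C' * \<epsilon> ^ 3 * (LINT \<xi>|lborel. decay \<xi> * cmod (\<psi> \<xi>)))"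
        using smooth_solution_expansion[OF T gauss_data(1)[OF a, of c, folded g_def] B, of \<eta>] by blast
      have "cmod ?b \<le> ?C * K"
      proof (rule K(2)[where \<l> = ?\<l> and e = e and a = ?a and r = "min r 1" and M = "C' * (LINT \<xi>|lborel. decay \<xi> * cmod (\<psi> \<xi>))"])
        show "x *\<^sub>R e \<in> vecs ?X" "nrm ?X (x *\<^sub>R e) = \<bar>x\<bar> * nrm ?X e" "nrm ?X e \<le> 1" for x
          by (rule e_mem e_nrm e1)+
        show "?\<l> (F - G) = ?\<l> F - ?\<l> G" for F G by simp
        show "?\<l> (x *\<^sub>R F) = of_real x * ?\<l> F" for x F by (simp add: scaleR_fun_def scaleR_conv_of_real)
        show "cmod (?\<l> F) \<le> ?C * nrm ?Y F" if "F \<in> D" for F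
        proof -
          have "sobolev_fn s (F T)" using that T by (simp add: D_def)
          hence "cmod (?\<l> F) \<le> ?C * nrm (sobolev s) (F T)" by (rule sobolev_fn_eval_bound[OF _ \<psi>])
          also have "\<dots> \<le> ?C * nrm ?Y F"
            using T
            by (intro mult_left_mono D_le[OF that] real_sqrt_ge_zero integral_nonneg_AE AE_I2 mult_nonneg_nonneg less_imp_le[OF weight_pos]) auto
          finally show ?thesis .
        qed
        show "0 \<le> ?C"
          by (intro real_sqrt_ge_zero integral_nonneg_AE AE_I2 mult_nonneg_nonneg less_imp_le[OF weight_pos]) auto
        show "min r 1 > 0" using r by simp
        \<comment> \<open>\<epsilon> < 1 keeps \<epsilon> e inside the unit ball, where \<Phi> has
          to return the smooth solution.\<close>
        fix \<epsilon> :: real assume \<epsilon>: "0 \<le> \<epsilon>" "\<epsilon> < min r 1"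
        have "\<epsilon> *\<^sub>R e \<in> smooth_radial_data" unfolding smooth_radial_data_def using e_mem by blast
        moreover have "nrm ?X (\<epsilon> *\<^sub>R e) < 1"
          using e1 \<epsilon> mult_left_le[OF e1, of \<epsilon>] unfolding e_nrm by simp
        moreover have "smooth_solution \<eta> T (\<epsilon> *\<^sub>R e) (u \<epsilon>)"
          using ex[of \<epsilon>] \<epsilon> by (simp add: e_def scaleR_dist_of)
        ultimately have "\<Phi> (\<epsilon> *\<^sub>R e) T = u \<epsilon> T"
          using assms(4) T unfolding data_to_solution_map_def by auto
        thus "cmod (?\<l> (\<Phi> (\<epsilon> *\<^sub>R e)) - of_real \<epsilon> * ?a - of_real \<epsilon> ^ 2 * ?b) \<le> C' * (LINT \<xi>|lborel. decay \<xi> * cmod (\<psi> \<xi>)) * \<epsilon> ^ 3"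
          using ex[of \<epsilon>] \<epsilon> \<psi> by (simp add: mult_ac)
      qed
      moreover have "\<mu> * real (J + 1) \<le> cmod ?b"
      proof -
        have "c\<^sup>2 * pi\<^sup>2 * N * real (J + 1) / (2 * ((1 - s) + 2)) \<le> cmod ?Q"
          unfolding g_def a_def \<psi>_def using s by (intro second_iterate_lower_bound T N) simp
        hence "cmod \<eta> / (2 * pi) * (c\<^sup>2 * pi\<^sup>2 * N * real (J + 1) / (2 * ((1 - s) + 2))) \<le> cmod \<eta> / (2 * pi) * cmod ?Q"
          by (intro mult_left_mono) auto
        \<comment> \<open>c^2 N = 1 / \<kappa>, so the lower bound no longer contains N and depends
          on J only through J + 1.\<close>
        moreover have "c\<^sup>2 * pi\<^sup>2 * N * real (J + 1) / (2 * ((1 - s) + 2)) = pi\<^sup>2 / (2 * \<kappa> * (3 - s)) * real (J + 1)"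
          using \<kappa> N0 by (simp add: c2)
        moreover have "cmod ?b = cmod \<eta> / (2 * pi) * cmod ?Q" by (simp only: norm_mult norm_divide) simp
        ultimately show ?thesis by (simp only: \<mu>_def mult.assoc)
      qed
      moreover have "?C \<le> sqrt (8 * pi * real (J + 1))"
      proof (rule real_sqrt_le_mono)
        have "(LINT \<xi>|lborel. weight (- s) \<xi> * (cmod (\<psi> \<xi>))\<^sup>2) = (LINT \<xi>|lborel. weight (- s) \<xi> * (probe (1 - s) J \<xi>)\<^sup>2)"
          by (simp add: \<psi>_def norm_mult)
        also have "\<dots> \<le> 8 * pi * real (J + 1)" using s by (intro probe_norm) simp
        finally show "(LINT \<xi>|lborel. weight (- s) \<xi> * (cmod (\<psi> \<xi>))\<^sup>2) \<le> 8 * pi * real (J + 1)" .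
      qed
      ultimately show ?thesis using mult_right_mono[OF _ K(1)] by (meson order_trans)
    qed
    \<comment> \<open>Dividing \<open>main\<close> by sqrt(J + 1) bounds sqrt(J + 1) by L for every
      J, as K does not depend on J; any J > L^2 is then a contradiction.\<close>
    define L where "L = sqrt (8 * pi) * K / \<mu>"
    have "sqrt (real (J + 1)) \<le> L" for J :: nat
    proof -
      let ?q = "sqrt (real (J + 1))"
      have q: "?q > 0" by simp
      have "\<mu> * (?q * ?q) \<le> sqrt (8 * pi) * ?q * K"
        using main[of J] by (simp add: real_sqrt_mult)
      hence "(\<mu> * ?q) * ?q \<le> (sqrt (8 * pi) * K) * ?q" by (simp only: mult_ac)
      hence "\<mu> * ?q \<le> sqrt (8 * pi) * K" using q by (simp only: mult_le_cancel_right_pos)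
      thus ?thesis using \<mu> by (simp add: L_def le_divide_eq mult.commute)
    qed
    moreover obtain J :: nat where "L\<^sup>2 < real J" using reals_Archimedean2 by blast
    ultimately have "sqrt (real (J + 1)) \<le> L" "L\<^sup>2 < real (J + 1)" by (auto intro: less_trans)
    hence "real (J + 1) \<le> L\<^sup>2" using power_mono[of "sqrt (real (J + 1))" L 2] by simp
    with \<open>L\<^sup>2 < real (J + 1)\<close> show False by simp
  qed
qed

end
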